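(* For every fixed integer $k\ge 0$, as $T\to\infty$, $$N_\eta^{k}(T)=N_\zeta(T)+O(\log T).$$
   Context: $\zeta$ is the Riemann zeta function and $\eta$ is the Euler (Dirichlet) eta function, $\eta(s)=\sum_{n\ge 1}(-1)^{n+1}n^{-s}$ for $\Re(s)>0$, extended to an entire function by $\eta(s)=(1-2^{1-s})\zeta(s)$. $N_\zeta(T)$ is the number of zeros $\rho$ of $\zeta(s)$ inside the critical strip $0<\Re(s)<1$ with $0<\Im(\rho)\le T$. For an integer $k\ge1$, $N_\eta^k(T)$ is the number of zeros $\rho\in\mathbb{C}$ of the $k$-th derivative $\eta^{(k)}(s)$ with $0<\Im(\rho)\le T$. For $k=0$, $N_\eta^0(T)$ is (by convention) the number of zeros $\rho\in\mathbb{C}$ of $\eta(s)-1$ with $0<\Im(\rho)\le T$. Zeros are counted with multiplicity. The implied constant may depend on $k$. *)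

theory Defs
  imports "HOL-Complex_Analysis.Complex_Analysis" "HOL-Library.Landau_Symbols"
begin

text \<open>
  The Riemann zeta function: the holomorphic continuation of the Dirichlet series
  \<open>1 + 1/2^s + 1/3^s + \<dots>\<close>, \<open>Re s > 1\<close>, to the plane without the point \<open>1\<close>. The continuation
  is unique since \<open>- {1}\<close> is connected; the value at the pole is fixed to \<open>0\<close> only to make
  the description determine a total function.
\<close>

definition is_zeta :: "(complex \<Rightarrow> complex) \<Rightarrow> bool" where
  "is_zeta f \<longleftrightarrow>
     f holomorphic_on - {1} \<and>
     (\<forall>s. Re s > 1 \<longrightarrow> (\<lambda>n. of_nat (Suc n) powr (- s)) sums f s) \<and>
     f 1 = 0"

lemma is_zeta_unique:
  assumes "is_zeta f" "is_zeta g"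
  shows "f = g"
proof
  fix s :: complex
  have con: "connected (- {1 :: complex})"
    by (rule connected_punctured_universe) simp
  have op: "open {z :: complex. Re z > 1}"
    by (rule open_halfspace_Re_gt)
  have eq: "f z = g z" if "z \<in> {z. Re z > 1}" for z
    using assms that unfolding is_zeta_def by (blast intro: sums_unique2)
  show "f s = g s"
  proof (cases "s = 1")
    case True
    then show ?thesis using assms by (simp add: is_zeta_def)
  next
    case False
    have "2 \<in> {z :: complex. Re z > 1}"
      by simp
    then show ?thesis
      using analytic_continuation_open[of "{z. Re z > 1}" "- {1}" f g s] con op eq False assms
      by (fastforce simp: is_zeta_def)
  qed
qed

definition zeta :: "complex \<Rightarrow> complex" where
  "zeta = (THE f. is_zeta f)"

definition eta :: "complex \<Rightarrow> complex" where
  "eta s = (if Re s > 0 then (\<Sum>n. (-1) ^ n * of_nat (Suc n) powr (- s))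
            else (1 - 2 powr (1 - s)) * zeta s)"

text \<open>The set of zeros of \<open>f\<close> in \<open>A\<close>, and their number counted with multiplicity.\<close>

definition zeros_in :: "(complex \<Rightarrow> complex) \<Rightarrow> complex set \<Rightarrow> complex set" where
  "zeros_in f A = {\<rho> \<in> A. f \<rho> = 0}"

definition zero_count :: "(complex \<Rightarrow> complex) \<Rightarrow> complex set \<Rightarrow> nat" where
  "zero_count f A = (\<Sum>\<rho>\<in>zeros_in f A. nat (zorder f \<rho>))"

definition zeta_region :: "real \<Rightarrow> complex set" where
  "zeta_region T = {s. 0 < Re s \<and> Re s < 1 \<and> 0 < Im s \<and> Im s \<le> T}"

definition eta_region :: "real \<Rightarrow> complex set" where
  "eta_region T = {s. 0 < Im s \<and> Im s \<le> T}"

definition N_zeta :: "real \<Rightarrow> nat" where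
  "N_zeta T = zero_count zeta (zeta_region T)"

text \<open>By convention, the case \<open>k = 0\<close> concerns \<open>eta - 1\<close> rather than \<open>eta\<close>.\<close>

definition eta_deriv :: "nat \<Rightarrow> complex \<Rightarrow> complex" where
  "eta_deriv k = (if k = 0 then (\<lambda>s. eta s - 1) else (deriv ^^ k) eta)"

definition N_eta :: "nat \<Rightarrow> real \<Rightarrow> nat" where
  "N_eta k T = zero_count (eta_deriv k) (eta_region T)"

end

theory Submission
  imports Defs
begin

text \<open>
  By the argument principle, applied to a rectangle with vertical sides far to the left and far to
  the right, the difference of the two counts is the variation of the argument of
  \<open>eta_deriv k s * 2 powr s\<close> minus that of \<open>zeta\<close>. On the right side the former is close to a
  nonzero constant and \<open>zeta\<close> is close to \<open>1\<close>. On the left side the functional equation shows that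
  the quotient of the two functions is a constant times \<open>k\<close> factors \<open>Digamma (1 - s) - ln pi\<close> and
  two functions close to \<open>1\<close>, and all these factors have positive real part. On the upper side,
  dividing out the \<open>O(ln T)\<close> zeros in a disc and applying the Borel-Caratheodory inequality to
  the logarithm of what remains bounds the variation for \<open>eta_deriv k\<close>, \<open>eta\<close> and
  \<open>1 - 2 powr (1 - s)\<close> by \<open>O(ln T)\<close>. Zeros of \<open>eta_deriv k\<close> to the left of the rectangle are real.
  The zeros of \<open>zeta\<close> in the rectangle lie in the open critical strip because \<open>zeta\<close> does not vanish
  on the line \<open>Re s = 1\<close>.
\<close>

section \<open>Mellin transforms and the functional equation on a real interval\<close>

text \<open>On the left side each of the two arguments varies by an amount of order
  \<open>T * ln T\<close>, so only a quotient can be estimated there. This is the reason for the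
  factor \<open>2 powr s\<close>: on the right it cancels the leading decay
  \<open>2 powr (- s)\<close> of \<open>eta_deriv k\<close>, and on the left it turns
  \<open>1 - 2 powr (1 - s)\<close>, whose argument varies linearly in \<open>T\<close>, into
  \<open>- 2 * (1 - 2 powr (s - 1))\<close>. The convention \<open>eta - 1\<close> for
  \<open>k = 0\<close> has a similar origin: \<open>eta\<close> itself would bring in the zeros of
  \<open>1 - 2 powr (1 - s)\<close> on the line \<open>Re s = 1\<close>, whose number is
  proportional to \<open>T\<close>. The left side has abscissa \<open>1 - 2 * n\<close>, because the
  cosine in the functional equation vanishes at the odd integers \<open>w = 1 - s\<close>, whereas
  on vertical lines through even integers its modulus is a hyperbolic cosine and dominates the error
  term. On the upper side \<open>zeta\<close> is traded for \<open>eta\<close> and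
  \<open>1 - 2 powr (1 - s)\<close>, which are entire, since the discs used there may contain the
  pole.\<close>

lemma Gamma_nn_integral_subst:
  fixes g g' :: "real \<Rightarrow> real"
  assumes "a > 0"
    and der: "\<And>x. x > 0 \<Longrightarrow> (g has_field_derivative g' x) (at x)"
    and inj: "inj_on g {0<..}" and img: "g ` {0<..} = {0<..}"
    and pos: "\<And>x. x > 0 \<Longrightarrow> g' x \<ge> 0"
  shows "(\<integral>\<^sup>+x. ennreal (g' x * (g x powr (a - 1) * exp (- g x))) * indicator {0<..} x \<partial>lborel) = ennreal (Gamma a)"
proof -
  define f :: "real \<Rightarrow> real" where "f = (\<lambda>t. t powr (a - 1) * exp (- t))"
  have "((\<lambda>t. t powr (a - 1) / exp t) has_integral Gamma a) {0..}"
    by (rule Gamma_integral_real) fact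
  then have "(f has_integral Gamma a) {0..}"
    by (simp add: f_def exp_minus divide_inverse)
  then have "((\<lambda>t. if t \<in> {0<..} then f t else 0) has_integral Gamma a) {0..}"
    by (rule has_integral_spike [of "{0}", rotated 2]) auto
  then have f: "(f has_integral Gamma a) {0<..}"
    by (subst (asm) has_integral_restrict) auto
  have "f absolutely_integrable_on {0<..}"
    by (rule nonnegative_absolutely_integrable_1) (use f in \<open>auto simp: f_def integrable_on_def\<close>)
  then have "f absolutely_integrable_on (g ` {0<..}) \<and> integral (g ` {0<..}) f = Gamma a"
    using f img by auto
  then have *: "(\<lambda>x. \<bar>g' x\<bar> * f (g x)) absolutely_integrable_on {0<..} \<and>
      integral {0<..} (\<lambda>x. \<bar>g' x\<bar> * f (g x)) = Gamma a"
    by (subst has_absolute_integral_change_of_variables_1')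
       (use der inj in \<open>auto intro: has_field_derivative_at_within\<close>)
  then have "(\<lambda>x. \<bar>g' x\<bar> * f (g x)) integrable_on {0<..}"
    using set_lebesgue_integral_eq_integral(1) by blast
  with * have "((\<lambda>x. \<bar>g' x\<bar> * f (g x)) has_integral Gamma a) {0<..}"
    by (simp add: has_integral_iff)
  then have "((\<lambda>x. g' x * (g x powr (a - 1) * exp (- g x))) has_integral Gamma a) {0<..}"
    by (rule has_integral_eq[rotated]) (use pos in \<open>auto simp: f_def\<close>)
  then show ?thesis
    by (intro nn_integral_has_integral_lebesgue') (use pos in auto)
qed

text \<open>Working with \<open>ennreal\<close>-valued integrals lets Tonelli and the exchange of
  sum and integral be applied in this section without separate integrability proofs.\<close>

lemma Gamma_nn_integral_scaled:
  assumes "a > 0" "c > 0"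
  shows "(\<integral>\<^sup>+x. ennreal (x powr (a - 1) * exp (- c * x)) * indicator {0<..} x \<partial>lborel) = ennreal (Gamma a * c powr (- a))" (is "?I = _")
proof -
  have "(\<integral>\<^sup>+x. ennreal (c * ((c * x) powr (a - 1) * exp (- (c * x)))) * indicator {0<..} x \<partial>lborel) = ennreal (Gamma a)"
  proof (rule Gamma_nn_integral_subst)
    show "(\<lambda>x. c * x) ` {0<..} = {0<..}"
    proof (intro equalityI subsetI)
      fix y :: real assume "y \<in> {0<..}"
      then show "y \<in> (\<lambda>x. c * x) ` {0<..}"
        using assms by (intro image_eqI[of _ _ "y / c"]) auto
    qed (use assms in auto)
  qed (use assms in \<open>auto intro!: derivative_eq_intros simp: inj_on_def\<close>)
  also have "(\<integral>\<^sup>+x. ennreal (c * ((c * x) powr (a - 1) * exp (- (c * x)))) * indicator {0<..} x \<partial>lborel)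
     = (\<integral>\<^sup>+x. ennreal (c powr a) * (ennreal (x powr (a - 1) * exp (- c * x)) * indicator {0<..} x) \<partial>lborel)"
    by (intro nn_integral_cong)
       (use assms in \<open>auto simp: indicator_def powr_mult powr_diff ennreal_mult[symmetric] field_simps\<close>)
  also have "\<dots> = ennreal (c powr a) * ?I"
    by (rule nn_integral_cmult) measurable
  finally have *: "ennreal (c powr a) * ?I = ennreal (Gamma a)" .
  have "?I
     = ennreal (c powr (- a)) * (ennreal (c powr a) * ?I)"
    by (subst mult.assoc[symmetric]) (use assms in \<open>simp add: ennreal_mult[symmetric] powr_add[symmetric]\<close>)
  also have "\<dots> = ennreal (Gamma a * c powr (- a))"
    unfolding * using assms by (simp add: ennreal_mult[symmetric] mult.commute)
  finally show ?thesis .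
qed

text \<open>The substitution is \<open>c * x^2\<close>; the exponent \<open>2 * a - 1\<close> is
  what remains of \<open>a - 1\<close> once the factor \<open>x\<close> of the derivative is
  absorbed.\<close>

lemma Gamma_nn_integral_gauss:
  assumes "a > 0" "c > 0"
  shows "(\<integral>\<^sup>+x. ennreal (x powr (2 * a - 1) * exp (- c * x\<^sup>2)) * indicator {0<..} x \<partial>lborel) = ennreal (Gamma a * c powr (- a) / 2)" (is "?I = _")
proof -
  have "(\<integral>\<^sup>+x. ennreal ((2 * c * x) * ((c * x\<^sup>2) powr (a - 1) * exp (- (c * x\<^sup>2)))) * indicator {0<..} x \<partial>lborel) = ennreal (Gamma a)"
  proof (rule Gamma_nn_integral_subst)
    show "(\<lambda>x. c * x\<^sup>2) ` {0<..} = {0<..}"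
    proof (intro equalityI subsetI)
      fix y :: real assume "y \<in> {0<..}"
      then show "y \<in> (\<lambda>x. c * x\<^sup>2) ` {0<..}"
        using assms by (intro image_eqI[of _ _ "sqrt (y / c)"]) auto
    qed (use assms in auto)
    show "inj_on (\<lambda>x. c * x\<^sup>2) {0<..}"
      using assms by (auto simp: inj_on_def)
  qed (use assms in \<open>auto intro!: derivative_eq_intros simp: algebra_simps\<close>)
  also have "(\<integral>\<^sup>+x. ennreal ((2 * c * x) * ((c * x\<^sup>2) powr (a - 1) * exp (- (c * x\<^sup>2)))) * indicator {0<..} x \<partial>lborel)
     = (\<integral>\<^sup>+x. ennreal (2 * c powr a) * (ennreal (x powr (2 * a - 1) * exp (- c * x\<^sup>2)) * indicator {0<..} x) \<partial>lborel)"
  proof (intro nn_integral_cong)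
    fix x :: real
    have "x powr (2 * a - 1) = x * (x\<^sup>2) powr (a - 1)" if "x > 0"
    proof -
      have "(x\<^sup>2) powr (a - 1) = x powr (2 * (a - 1))"
        using that by (simp add: powr_powr flip: powr_numeral)
      also have "x * x powr (2 * (a - 1)) = x powr (1 + 2 * (a - 1))"
        using that by (subst powr_add) simp
      finally show ?thesis by (simp add: algebra_simps)
    qed
    then show "ennreal ((2 * c * x) * ((c * x\<^sup>2) powr (a - 1) * exp (- (c * x\<^sup>2)))) * indicator {0<..} x
       = ennreal (2 * c powr a) * (ennreal (x powr (2 * a - 1) * exp (- c * x\<^sup>2)) * indicator {0<..} x)"
      using assms by (auto simp: indicator_def powr_mult powr_diff[of c] ennreal_mult[symmetric] field_simps)
  qed
  also have "\<dots> = ennreal (2 * c powr a) * ?I"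
    by (rule nn_integral_cmult) measurable
  finally have *: "ennreal (2 * c powr a) * ?I = ennreal (Gamma a)" .
  have "?I
     = ennreal (c powr (- a) / 2) * (ennreal (2 * c powr a) * ?I)"
    by (subst mult.assoc[symmetric]) (use assms in \<open>simp add: ennreal_mult[symmetric] powr_add[symmetric]\<close>)
  also have "\<dots> = ennreal (Gamma a * c powr (- a) / 2)"
    unfolding * using assms by (simp add: ennreal_mult[symmetric] mult.commute)
  finally show ?thesis .
qed

lemma nn_integral_exp_Ioi:
  fixes c :: real assumes "c > 0"
  shows "(\<integral>\<^sup>+y. ennreal (exp (- c * y)) * indicator {0<..} y \<partial>lborel) = ennreal (1 / c)"
proof -
  have "(\<integral>\<^sup>+y. ennreal (exp (- c * y)) * indicator {0<..} y \<partial>lborel)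
      = (\<integral>\<^sup>+y. ennreal (y powr (1 - 1) * exp (- c * y)) * indicator {0<..} y \<partial>lborel)"
    by (intro nn_integral_cong) (auto simp: indicator_def)
  also have "\<dots> = ennreal (1 / c)"
    by (subst Gamma_nn_integral_scaled) (use assms in \<open>auto simp: powr_minus divide_inverse\<close>)
  finally show ?thesis .
qed

text \<open>The denominator is written as the integral of \<open>exp (- (x^2 + c^2) * y)\<close>
  over \<open>y > 0\<close>. After the exchange of integrals a Gaussian moment and a Gamma integral
  remain, and the product \<open>Gamma a * Gamma (1 - a)\<close> with \<open>a = (s + 1) / 2\<close>
  becomes the cosine by reflection.\<close>

lemma nn_integral_powr_over_sum_squares:
  fixes s c :: real
  assumes "-1 < s" "s < 1" "c > 0"
  shows "(\<integral>\<^sup>+x. ennreal (x powr s / (x\<^sup>2 + c\<^sup>2)) * indicator {0<..} x \<partial>lborel) = ennreal (c powr (s - 1) * (pi / (2 * cos (pi * s / 2))))"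
proof -
  define a where "a = (s + 1) / 2"
  have a: "0 < a" "a < 1" "s = 2 * a - 1" using assms by (auto simp: a_def field_simps)
  let ?F = "\<lambda>x y. ennreal (x powr s * exp (- (x\<^sup>2 + c\<^sup>2) * y)) * indicator {0<..} x * indicator {0<..} y"
  have "(\<integral>\<^sup>+x. ennreal (x powr s / (x\<^sup>2 + c\<^sup>2)) * indicator {0<..} x \<partial>lborel)
      = (\<integral>\<^sup>+x. \<integral>\<^sup>+y. ?F x y \<partial>lborel \<partial>lborel)"
  proof (intro nn_integral_cong)
    fix x :: real
    have "(\<integral>\<^sup>+y. ?F x y \<partial>lborel) = (\<integral>\<^sup>+y. (ennreal (x powr s) * indicator {0<..} x) * (ennreal (exp (- (x\<^sup>2 + c\<^sup>2) * y)) * indicator {0<..} y) \<partial>lborel)"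
      by (intro nn_integral_cong) (auto simp: ennreal_mult indicator_def)
    also have "\<dots> = (ennreal (x powr s) * indicator {0<..} x) * ennreal (1 / (x\<^sup>2 + c\<^sup>2))"
      using assms by (subst nn_integral_cmult, measurable, subst nn_integral_exp_Ioi) (auto simp: add_nonneg_pos)
    also have "\<dots> = ennreal (x powr s / (x\<^sup>2 + c\<^sup>2)) * indicator {0<..} x"
      by (auto simp: indicator_def ennreal_mult[symmetric])
    finally show "ennreal (x powr s / (x\<^sup>2 + c\<^sup>2)) * indicator {0<..} x = (\<integral>\<^sup>+y. ?F x y \<partial>lborel)" ..
  qed
  also have "\<dots> = (\<integral>\<^sup>+y. \<integral>\<^sup>+x. ?F x y \<partial>lborel \<partial>lborel)"
    by (rule lborel_pair.Fubini'[symmetric]) measurable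
  also have "\<dots> = (\<integral>\<^sup>+y. ennreal (Gamma a / 2) * (ennreal (y powr ((1 - a) - 1) * exp (- c\<^sup>2 * y)) * indicator {0<..} y) \<partial>lborel)"
  proof (intro nn_integral_cong)
    fix y :: real
    show "(\<integral>\<^sup>+x. ?F x y \<partial>lborel) = ennreal (Gamma a / 2) * (ennreal (y powr ((1 - a) - 1) * exp (- c\<^sup>2 * y)) * indicator {0<..} y)"
    proof (cases "y > 0")
      case True
      have "(\<integral>\<^sup>+x. ?F x y \<partial>lborel) = (\<integral>\<^sup>+x. ennreal (exp (- c\<^sup>2 * y)) * (ennreal (x powr (2 * a - 1) * exp (- y * x\<^sup>2)) * indicator {0<..} x) \<partial>lborel)"
        by (intro nn_integral_cong)
           (use True in \<open>auto simp: ennreal_mult[symmetric] indicator_def a(3) exp_add[symmetric] algebra_simps\<close>)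
      also have "\<dots> = ennreal (exp (- c\<^sup>2 * y)) * ennreal (Gamma a * y powr (- a) / 2)"
        by (subst nn_integral_cmult, measurable, subst Gamma_nn_integral_gauss) (use a True in auto)
      finally show ?thesis
        using True a by (simp add: ennreal_mult[symmetric] mult_ac)
    qed auto
  qed
  also have "\<dots> = ennreal (Gamma a / 2) * ennreal (Gamma (1 - a) * (c\<^sup>2) powr (- (1 - a)))"
    by (subst nn_integral_cmult, measurable, subst Gamma_nn_integral_scaled) (use a assms in auto)
  also have "\<dots> = ennreal (Gamma a * Gamma (1 - a) / 2 * (c\<^sup>2) powr (- (1 - a)))"
    using a by (simp add: ennreal_mult[symmetric] mult_ac)
  also have "Gamma a * Gamma (1 - a) = pi / sin (pi * a)"
  proof -
    have "complex_of_real (Gamma a * Gamma (1 - a)) = of_real (pi / sin (pi * a))"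
      using Gamma_reflection_complex[of "of_real a"]
      by (simp add: Gamma_complex_of_real[symmetric] sin_of_real[symmetric])
    then show ?thesis by (simp only: of_real_eq_iff)
  qed
  also have "sin (pi * a) = cos (pi * s / 2)"
    by (simp add: a_def sin_cos_eq field_simps)
  also have "(c\<^sup>2) powr (- (1 - a)) = c powr (s - 1)"
  proof -
    have "2 * - (1 - a) = s - 1" by (simp add: a_def field_simps)
    then show ?thesis using assms powr_powr[of c 2 "- (1 - a)"] by (simp flip: powr_numeral)
  qed
  finally show ?thesis by (simp add: field_simps)
qed

text \<open>For \<open>s < 0\<close> a single exponential is not integrable against
  \<open>x powr (s - 1)\<close> at \<open>0\<close>; the difference is, being \<open>x\<close> times
  the integral of \<open>exp (- u * x)\<close> over \<open>u\<close> between \<open>a\<close> and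
  \<open>b\<close>. The value \<open>a = 0\<close> is allowed because the first pair of the
  geometric expansion needs it.\<close>

lemma nn_integral_powr_exp_diff:
  fixes s a b :: real
  assumes s: "-1 < s" "s < 0" and ab: "0 \<le> a" "a < b"
  shows "(\<integral>\<^sup>+x. ennreal (x powr (s - 1) * (exp (- a * x) - exp (- b * x))) * indicator {0<..} x \<partial>lborel)
     = ennreal (Gamma (s + 1) * ((b powr (- s) - a powr (- s)) / (- s)))"
proof -
  let ?F = "\<lambda>x u. ennreal (x powr s * exp (- u * x)) * indicator {0<..} x * indicator {a..b} u"
  have "(\<integral>\<^sup>+x. ennreal (x powr (s - 1) * (exp (- a * x) - exp (- b * x))) * indicator {0<..} x \<partial>lborel)
      = (\<integral>\<^sup>+x. \<integral>\<^sup>+u. ?F x u \<partial>lborel \<partial>lborel)"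
  proof (intro nn_integral_cong)
    fix x :: real
    show "ennreal (x powr (s - 1) * (exp (- a * x) - exp (- b * x))) * indicator {0<..} x = (\<integral>\<^sup>+u. ?F x u \<partial>lborel)"
    proof (cases "x > 0")
      case True
      have "((\<lambda>u. x powr s * exp (- u * x)) has_integral (x powr s * (- exp (- b * x) / x) - x powr s * (- exp (- a * x) / x))) {a..b}"
        by (rule fundamental_theorem_of_calculus)
           (use ab True in \<open>auto intro!: derivative_eq_intros simp: has_real_derivative_iff_has_vector_derivative[symmetric]\<close>)
      then have "(\<integral>\<^sup>+u. ennreal (x powr s * exp (- u * x)) * indicator {a..b} u \<partial>lborel)
         = ennreal (x powr s * (- exp (- b * x) / x) - x powr s * (- exp (- a * x) / x))"
        by (intro nn_integral_has_integral_lebesgue') auto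
      also have "(x powr s * (- exp (- b * x) / x) - x powr s * (- exp (- a * x) / x)) = x powr (s - 1) * (exp (- a * x) - exp (- b * x))"
        using True by (simp add: powr_diff field_simps)
      finally show ?thesis using True by simp
    qed auto
  qed
  also have "\<dots> = (\<integral>\<^sup>+u. \<integral>\<^sup>+x. ?F x u \<partial>lborel \<partial>lborel)"
    by (rule lborel_pair.Fubini'[symmetric]) measurable
  also have "\<dots> = (\<integral>\<^sup>+u. ennreal (Gamma (s + 1)) * (ennreal (u powr (- s - 1)) * indicator {a..b} u) \<partial>lborel)"
  proof (rule nn_integral_cong_AE)
    \<comment> \<open>The inner Gamma integral requires \<open>u > 0\<close>, but the interval may
      begin at \<open>0\<close>; that point is discarded as a null set.\<close>
    have "AE u in lborel. u \<noteq> (0::real)"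
      by (rule AE_lborel_singleton)
    then show "AE u in lborel. (\<integral>\<^sup>+x. ?F x u \<partial>lborel) = ennreal (Gamma (s + 1)) * (ennreal (u powr (- s - 1)) * indicator {a..b} u)"
    proof eventually_elim
      case (elim u)
      show ?case
      proof (cases "u \<in> {a..b}")
        case True
        then have "u > 0" using elim ab by auto
        then show ?thesis
          using Gamma_nn_integral_scaled[of "s + 1" u] s True
          by (simp add: ennreal_mult[symmetric])
      qed auto
    qed
  qed
  also have "\<dots> = ennreal (Gamma (s + 1)) * (\<integral>\<^sup>+u. ennreal (u powr (- s - 1)) * indicator {a..b} u \<partial>lborel)"
    by (rule nn_integral_cmult) measurable
  also have "(\<integral>\<^sup>+u. ennreal (u powr (- s - 1)) * indicator {a..b} u \<partial>lborel) = ennreal (b powr (- s) / (- s) - a powr (- s) / (- s))"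
  proof (rule nn_integral_has_integral_lebesgue')
    show "((\<lambda>u. u powr (- s - 1)) has_integral (b powr (- s) / (- s) - a powr (- s) / (- s))) {a..b}"
    proof (rule fundamental_theorem_of_calculus_interior)
      show "continuous_on {a..b} (\<lambda>u. u powr (- s) / (- s))"
        using s ab by (auto intro!: continuous_intros continuous_on_powr')
      show "((\<lambda>u. u powr (- s) / (- s)) has_vector_derivative u powr (- s - 1)) (at u)" if "u \<in> {a<..<b}" for u
        using that ab s by (auto intro!: derivative_eq_intros simp: has_real_derivative_iff_has_vector_derivative[symmetric])
    qed (use ab in auto)
  qed auto
  finally show ?thesis
    using s ab by (simp add: ennreal_mult'[symmetric] diff_divide_distrib)
qed

section \<open>Two expansions of the hyperbolic tangent\<close>

lemma Digamma_reflection_complex: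
  fixes z :: complex
  assumes "z \<notin> \<int>"
  shows "Digamma (1 - z) - Digamma z = of_real pi * cot (of_real pi * z)"
proof -
  have nz: "z \<notin> \<int>\<^sub>\<le>\<^sub>0" "1 - z \<notin> \<int>\<^sub>\<le>\<^sub>0"
  proof -
    show "z \<notin> \<int>\<^sub>\<le>\<^sub>0" using assms nonpos_Ints_Int by blast
    have "z \<in> \<int>" if "1 - z \<in> \<int>"
      using Ints_diff[OF Ints_1 that] by simp
    then show "1 - z \<notin> \<int>\<^sub>\<le>\<^sub>0" using assms nonpos_Ints_Int by blast
  qed
  have "((\<lambda>z. rGamma z * rGamma (1 - z)) has_field_derivative
      (- rGamma z * Digamma z) * rGamma (1 - z) + (- rGamma (1 - z) * Digamma (1 - z) * (- 1)) * rGamma z) (at z)"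
    using nz by (auto intro!: derivative_eq_intros)
  moreover have "((\<lambda>z. sin (of_real pi * z) / of_real pi) has_field_derivative cos (of_real pi * z)) (at z)"
    by (auto intro!: derivative_eq_intros)
  ultimately have "(- rGamma z * Digamma z) * rGamma (1 - z) + (- rGamma (1 - z) * Digamma (1 - z) * (- 1)) * rGamma z = cos (of_real pi * z)"
    unfolding rGamma_reflection_complex by (rule DERIV_unique)
  then have "(rGamma z * rGamma (1 - z)) * (Digamma (1 - z) - Digamma z) = cos (of_real pi * z)"
    by (simp add: algebra_simps)
  then have "(sin (of_real pi * z) / of_real pi) * (Digamma (1 - z) - Digamma z) = cos (of_real pi * z)"
    by (simp only: rGamma_reflection_complex)
  moreover have "sin (of_real pi * z) \<noteq> 0"
    using rGamma_reflection_complex[of z] nz by (auto simp: rGamma_eq_zero_iff)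
  ultimately show ?thesis by (simp add: cot_def field_simps)
qed

text \<open>The difference of the Digamma series at \<open>1 - z\<close> and \<open>z\<close> is the
  partial fraction expansion of the cotangent. On the line \<open>Re z = 1 / 2\<close> the point
  \<open>1 - z\<close> is \<open>cnj z\<close>, so imaginary parts give a real series, and the
  cotangent turns into a hyperbolic tangent.\<close>

lemma tanh_partial_fractions:
  fixes x :: real
  shows "(\<lambda>n. 4 * x / (x\<^sup>2 + ((2 * real n + 1) * pi)\<^sup>2)) sums tanh (x / 2)"
proof -
  define y where "y = x / (2 * pi)"
  define z where "z = Complex (1 / 2) y"
  have z: "z \<notin> \<int>" 
  proof
    assume "z \<in> \<int>"
    then obtain m where "z = of_int m" by (auto elim: Ints_cases)
    then have "1 / 2 = real_of_int m" by (simp add: z_def complex_eq_iff)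
    then have "real_of_int 1 = real_of_int (2 * m)" by simp
    then show False by (simp only: of_int_eq_iff) presburger
  qed
  have z1: "1 - z = cnj z" by (simp add: z_def complex_eq_iff)
  have nz: "z \<noteq> 0" "cnj z \<noteq> 0" by (auto simp: z_def complex_eq_iff)
  have "(\<lambda>n. inverse (z + of_nat n) - inverse (cnj z + of_nat n)) sums
      (((\<Sum>n. inverse (of_nat (Suc n)) - inverse (cnj z + of_nat n)) - (\<Sum>n. inverse (of_nat (Suc n)) - inverse (z + of_nat n))))"
    using sums_diff[OF summable_sums[OF summable_Digamma[OF nz(2)]] summable_sums[OF summable_Digamma[OF nz(1)]]]
    by simp
  also have "(((\<Sum>n. inverse (of_nat (Suc n)) - inverse (cnj z + of_nat n)) - (\<Sum>n. inverse (of_nat (Suc n)) - inverse (z + of_nat n))))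
     = Digamma (1 - z) - Digamma z"
    by (simp add: Digamma_def z1)
  also have "\<dots> = of_real pi * cot (of_real pi * z)"
    by (rule Digamma_reflection_complex) fact
  also have "of_real pi * z = of_real (pi / 2) + \<i> * of_real (x / 2)"
    by (simp add: z_def complex_eq_iff y_def)
  also have "cot (of_real (pi / 2) + \<i> * of_real (x / 2)) = - \<i> * of_real (tanh (x / 2))"
  proof -
    have "sin (of_real (pi / 2) + \<i> * of_real (x / 2)) = (of_real (cosh (x / 2)) :: complex)"
      by (simp add: complex_eq_iff sin_add Re_sin Im_sin Re_cos Im_cos cosh_def sinh_def)
    moreover have "cos (of_real (pi / 2) + \<i> * of_real (x / 2)) = - \<i> * (of_real (sinh (x / 2)) :: complex)"
      by (simp add: complex_eq_iff cos_add Re_sin Im_sin Re_cos Im_cos cosh_def sinh_def)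
    ultimately show ?thesis by (simp add: cot_def tanh_def)
  qed
  finally have "(\<lambda>n. Im (inverse (z + of_nat n) - inverse (cnj z + of_nat n))) sums Im (of_real pi * (- \<i> * of_real (tanh (x / 2))))"
    by (rule sums_Im)
  then have "(\<lambda>n. (- 1 / pi) * Im (inverse (z + of_nat n) - inverse (cnj z + of_nat n))) sums ((- 1 / pi) * Im (of_real pi * (- \<i> * of_real (tanh (x / 2)))))"
    by (rule sums_mult)
  moreover have "(- 1 / pi) * Im (of_real pi * (- \<i> * of_real (tanh (x / 2)))) = tanh (x / 2)"
    by simp
  moreover have "(- 1 / pi) * Im (inverse (z + of_nat n) - inverse (cnj z + of_nat n)) = 4 * x / (x\<^sup>2 + ((2 * real n + 1) * pi)\<^sup>2)" for n
  proof -
    have pos: "(1 / 2 + real n)\<^sup>2 + y\<^sup>2 > 0" by (intro add_pos_nonneg) auto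
    have "(- 1 / pi) * Im (inverse (z + of_nat n) - inverse (cnj z + of_nat n)) = (2 * y / pi) / ((1 / 2 + real n)\<^sup>2 + y\<^sup>2)"
    proof -
      have zn: "z + of_nat n = Complex (1 / 2 + real n) y" "cnj z + of_nat n = Complex (1 / 2 + real n) (- y)"
        by (simp_all add: z_def complex_eq_iff)
      show ?thesis
        unfolding zn by (simp add: add_divide_distrib[symmetric])
    qed
    also have "\<dots> = (2 * y / pi * (4 * pi\<^sup>2)) / (((1 / 2 + real n)\<^sup>2 + y\<^sup>2) * (4 * pi\<^sup>2))"
      by (rule nonzero_mult_divide_mult_cancel_right[symmetric]) simp
    also have "2 * y / pi * (4 * pi\<^sup>2) = 4 * x"
      by (simp add: y_def power2_eq_square)
    also have "(((1 / 2 + real n)\<^sup>2 + y\<^sup>2) * (4 * pi\<^sup>2)) = x\<^sup>2 + ((2 * real n + 1) * pi)\<^sup>2"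
      by (simp add: y_def power2_eq_square field_simps)
    finally show ?thesis .
  qed
  ultimately show ?thesis by simp
qed

text \<open>With \<open>q = exp (- x)\<close> the value is
  \<open>(1 - q) / (1 + q) = (1 - q)^2 / (1 - q^2)\<close>, and only the last denominator is
  expanded. The square in front keeps every term nonnegative.\<close>

lemma tanh_geometric:
  fixes x :: real
  assumes "x > 0"
  shows "(\<lambda>m. (1 - exp (- x))\<^sup>2 * exp (- (2 * real m) * x)) sums tanh (x / 2)"
proof -
  have "exp (- 2 * x) < 1" using assms by simp
  then have "(\<lambda>m. (1 - exp (- x))\<^sup>2 * exp (- 2 * x) ^ m) sums ((1 - exp (- x))\<^sup>2 * (1 / (1 - exp (- 2 * x))))"
    by (intro sums_mult geometric_sums) simp
  moreover have "exp (- 2 * x) ^ m = exp (- (2 * real m) * x)" for m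
    by (simp add: exp_of_nat_mult[symmetric] algebra_simps)
  moreover have "(1 - exp (- x))\<^sup>2 * (1 / (1 - exp (- 2 * x))) = tanh (x / 2)"
  proof -
    have e: "exp (- 2 * x) = exp (- x) ^ 2" by (simp add: power2_eq_square exp_add[symmetric])
    have "exp (- x) < 1" using assms by simp
    moreover have "1 + exp (- x) > 0" by (intro add_pos_pos) auto
    ultimately have ne: "1 - exp (- x) \<noteq> 0" "1 + exp (- x) \<noteq> 0" by auto
    have "1 - exp (- 2 * x) = (1 - exp (- x)) * (1 + exp (- x))"
      unfolding e by (simp add: power2_eq_square algebra_simps)
    then have "(1 - exp (- x))\<^sup>2 * (1 / (1 - exp (- 2 * x))) = (1 - exp (- x)) / (1 + exp (- x))"
      using ne by (simp add: power2_eq_square)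
    also have "\<dots> = tanh (x / 2)" by (simp add: tanh_real_altdef)
    finally show ?thesis .
  qed
  ultimately show ?thesis by simp
qed

text \<open>
  Both series arise from the integral of \<open>x powr (s - 1) * tanh (x / 2)\<close> over the positive axis:
  one from the partial fractions of \<open>tanh\<close>, the other from its expansion in powers of \<open>exp (- x)\<close>,
  with the alternating terms paired so that all of them are nonnegative.
\<close>
lemma alternating_eta_real:
  fixes s :: real
  assumes s: "-1 < s" "s < 0"
  obtains S where
    "(\<lambda>n. 2 * pi / cos (pi * s / 2) * ((2 * real n + 1) * pi) powr (s - 1)) sums S"
    "(\<lambda>m. Gamma (s + 1) / s * (real (2 * m) powr (- s) - 2 * real (2 * m + 1) powr (- s) + real (2 * m + 2) powr (- s))) sums S"
proof -
  let ?H = "\<lambda>x. ennreal (x powr (s - 1) * tanh (x / 2)) * indicator {0<..} x"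
  let ?G = "\<lambda>m x. ennreal (x powr (s - 1) * ((1 - exp (- x))\<^sup>2 * exp (- (2 * real m) * x))) * indicator {0<..} x"
  define c where "c = (\<lambda>n. (2 * real n + 1) * pi)"
  let ?A = "\<lambda>n x. ennreal (4 * (x powr s / (x\<^sup>2 + (c n)\<^sup>2))) * indicator {0<..} x"
  have c: "c n > 0" for n unfolding c_def by (intro mult_pos_pos) (auto intro: add_nonneg_pos)
  define K where "K = (\<integral>\<^sup>+x. ?H x \<partial>lborel)"
  define A where "A = (\<lambda>n. 2 * pi / cos (pi * s / 2) * c n powr (s - 1))"
  define I where "I = (\<lambda>a b. Gamma (s + 1) * ((b powr (- s) - a powr (- s)) / (- s)))"
  define B where "B = (\<lambda>m. Gamma (s + 1) / s * (real (2 * m) powr (- s) - 2 * real (2 * m + 1) powr (- s) + real (2 * m + 2) powr (- s)))"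
  have cos: "cos (pi * s / 2) > 0" 
  proof (intro cos_gt_zero_pi)
    have "pi * (- 1) < pi * s" using s by (intro mult_strict_left_mono) auto
    then show "- (pi / 2) < pi * s / 2" by simp
    have "pi * s < 0" using s by (simp add: mult_pos_neg)
    then show "pi * s / 2 < pi / 2" using pi_gt_zero by linarith
  qed
  have A0: "A n \<ge> 0" for n using cos by (auto simp: A_def)
  have "K = (\<integral>\<^sup>+x. (\<Sum>n. ?A n x) \<partial>lborel)"
    unfolding K_def
  proof (intro nn_integral_cong)
    fix x :: real
    show "?H x = (\<Sum>n. ?A n x)"
    proof (cases "x > 0")
      case True
      have "(\<lambda>n. x powr (s - 1) * (4 * x / (x\<^sup>2 + ((2 * real n + 1) * pi)\<^sup>2))) sums (x powr (s - 1) * tanh (x / 2))"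
        by (intro sums_mult tanh_partial_fractions)
      also have "(\<lambda>n. x powr (s - 1) * (4 * x / (x\<^sup>2 + ((2 * real n + 1) * pi)\<^sup>2))) = (\<lambda>n. 4 * (x powr s / (x\<^sup>2 + (c n)\<^sup>2)))"
        using True by (simp add: fun_eq_iff c_def powr_diff)
      finally have "(\<Sum>n. ennreal (4 * (x powr s / (x\<^sup>2 + (c n)\<^sup>2)))) = ennreal (x powr (s - 1) * tanh (x / 2))"
        by (intro suminf_ennreal_eq) (auto simp: sum_nonneg)
      then show ?thesis using True by simp
    qed auto
  qed
  also have "\<dots> = (\<Sum>n. \<integral>\<^sup>+x. ?A n x \<partial>lborel)"
    by (rule nn_integral_suminf) measurable
  also have "\<dots> = (\<Sum>n. ennreal (A n))"
  proof (intro suminf_cong)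
    fix n
    have "(\<integral>\<^sup>+x. ?A n x \<partial>lborel)
       = (\<integral>\<^sup>+x. ennreal 4 * (ennreal (x powr s / (x\<^sup>2 + (c n)\<^sup>2)) * indicator {0<..} x) \<partial>lborel)"
      by (intro nn_integral_cong) (simp only: ennreal_mult'[OF zero_le_numeral] mult.assoc)
    also have "\<dots> = ennreal 4 * ennreal (c n powr (s - 1) * (pi / (2 * cos (pi * s / 2))))"
      by (subst nn_integral_cmult, measurable, subst nn_integral_powr_over_sum_squares) (use s c in auto)
    also have "\<dots> = ennreal (A n)"
      using cos by (subst ennreal_mult[symmetric]) (auto simp: A_def field_simps)
    finally show "(\<integral>\<^sup>+x. ?A n x \<partial>lborel) = ennreal (A n)" .
  qed
  finally have KA: "K = (\<Sum>n. ennreal (A n))" .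
  have sumA: "summable A"
  proof -
    have "summable (\<lambda>n. real (Suc n) powr (s - 1))"
      using s by (subst summable_Suc_iff) (simp add: summable_real_powr_iff)
    moreover have "c n powr (s - 1) \<le> real (Suc n) powr (s - 1)" for n
    proof (rule powr_mono2')
      have "real (Suc n) * 1 \<le> (2 * real n + 1) * pi"
        using pi_ge_two by (intro mult_mono) auto
      then show "real (Suc n) \<le> c n" by (simp add: c_def)
    qed (use s in auto)
    ultimately have "summable (\<lambda>n. c n powr (s - 1))"
      by (rule_tac summable_comparison_test') auto
    then show ?thesis unfolding A_def by (rule summable_mult)
  qed
  have fin: "K = ennreal (suminf A)"
    unfolding KA by (intro suminf_ennreal2 A0 sumA)
  \<comment> \<open>The integral of \<open>?G m\<close> is the difference of two integrals of the
    preceding kind. In \<open>ennreal\<close> the difference is avoided: one integral is expressed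
    as a sum, and the finite summand is cancelled after passing to reals.\<close>
  have piece: "(\<integral>\<^sup>+x. ?G m x \<partial>lborel) = ennreal (B m) \<and> B m \<ge> 0" for m
  proof -
    let ?P = "(\<integral>\<^sup>+x. ?G m x \<partial>lborel)"
    let ?e = "\<lambda>a b x. ennreal (x powr (s - 1) * (exp (- a * x) - exp (- b * x))) * indicator {0<..} x"
    have "ennreal (I (real (2 * m)) (real (2 * m + 1))) = (\<integral>\<^sup>+x. ?e (real (2 * m)) (real (2 * m + 1)) x \<partial>lborel)"
      unfolding I_def by (rule nn_integral_powr_exp_diff[symmetric]) (use s in auto)
    also have "\<dots> = (\<integral>\<^sup>+x. ?G m x
         + ?e (real (2 * m + 1)) (real (2 * m + 2)) x \<partial>lborel)"
    proof (intro nn_integral_cong)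
      fix x :: real
      have "x powr (s - 1) * (exp (- real (2 * m) * x) - exp (- real (2 * m + 1) * x)) =
         x powr (s - 1) * ((1 - exp (- x))\<^sup>2 * exp (- (2 * real m) * x)) + x powr (s - 1) * (exp (- real (2 * m + 1) * x) - exp (- real (2 * m + 2) * x))"
      proof -
        have e1: "exp (- real (2 * m + 1) * x) = exp (- (2 * real m) * x) * exp (- x)"
          by (simp add: exp_add[symmetric] algebra_simps)
        have e2: "exp (- real (2 * m + 2) * x) = exp (- (2 * real m) * x) * exp (- x) * exp (- x)"
          by (simp add: exp_add[symmetric] algebra_simps)
        show ?thesis unfolding e1 e2 by (simp add: power2_eq_square algebra_simps)
      qed
      moreover have "exp (- real (2 * m + 1) * x) - exp (- real (2 * m + 2) * x) \<ge> 0" if "x > 0"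
        using that by (auto intro!: mult_right_mono)
      ultimately show "?e (real (2 * m)) (real (2 * m + 1)) x = ?G m x
         + ?e (real (2 * m + 1)) (real (2 * m + 2)) x"
        by (cases "x > 0") (auto simp: ennreal_plus[symmetric] simp del: ennreal_plus)
    qed
    also have "\<dots> = ?P + (\<integral>\<^sup>+x. ?e (real (2 * m + 1)) (real (2 * m + 2)) x \<partial>lborel)"
      by (rule nn_integral_add) measurable
    also have "(\<integral>\<^sup>+x. ?e (real (2 * m + 1)) (real (2 * m + 2)) x \<partial>lborel) = ennreal (I (real (2 * m + 1)) (real (2 * m + 2)))"
      unfolding I_def by (rule nn_integral_powr_exp_diff) (use s in auto)
    finally have eq: "ennreal (I (real (2 * m)) (real (2 * m + 1))) = ?P + ennreal (I (real (2 * m + 1)) (real (2 * m + 2)))" .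
    have I0: "I a b \<ge> 0" if "0 \<le> a" "a \<le> b" for a b
    proof -
      have "a powr (- s) \<le> b powr (- s)" using s that by (intro powr_mono2) auto
      moreover have "Gamma (s + 1) > 0" using s by (intro Gamma_real_pos) auto
      ultimately show ?thesis unfolding I_def using s by (intro mult_nonneg_nonneg divide_nonneg_pos) simp_all
    qed
    have "?P \<le> ennreal (I (real (2 * m)) (real (2 * m + 1)))"
      unfolding eq by (rule order_trans[OF _ add_increasing2]) (rule order_refl, rule zero_le, rule order_refl)
    then have "?P < top"
      by (rule le_less_trans) (rule ennreal_less_top)
    then obtain p where p: "?P = ennreal p" "p \<ge> 0"
      by (cases ?P rule: ennreal_cases) auto
    have "I (real (2 * m)) (real (2 * m + 1)) = p + I (real (2 * m + 1)) (real (2 * m + 2))"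
    proof -
      have I: "I (real (2 * m + 1)) (real (2 * m + 2)) \<ge> 0" "I (real (2 * m)) (real (2 * m + 1)) \<ge> 0"
        by (intro I0; simp)+
      have "ennreal (I (real (2 * m)) (real (2 * m + 1))) = ennreal (p + I (real (2 * m + 1)) (real (2 * m + 2)))"
        unfolding eq p(1) by (rule ennreal_plus[symmetric]) (use p I in auto)
      then show ?thesis using p I by (subst (asm) ennreal_inj) auto
    qed
    then have "p = I (real (2 * m)) (real (2 * m + 1)) - I (real (2 * m + 1)) (real (2 * m + 2))"
      by linarith
    also have "\<dots> = B m"
      using s by (simp add: I_def B_def field_simps)
    finally show ?thesis using p by simp
  qed
  have "K = (\<integral>\<^sup>+x. (\<Sum>m. ?G m x) \<partial>lborel)"
    unfolding K_def
  proof (intro nn_integral_cong)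
    fix x :: real
    show "?H x = (\<Sum>m. ?G m x)"
    proof (cases "x > 0")
      case True
      have "(\<lambda>m. x powr (s - 1) * ((1 - exp (- x))\<^sup>2 * exp (- (2 * real m) * x))) sums (x powr (s - 1) * tanh (x / 2))"
        by (intro sums_mult tanh_geometric True)
      then have "(\<Sum>m. ennreal (x powr (s - 1) * ((1 - exp (- x))\<^sup>2 * exp (- (2 * real m) * x)))) = ennreal (x powr (s - 1) * tanh (x / 2))"
        by (intro suminf_ennreal_eq) auto
      then show ?thesis using True by simp
    qed auto
  qed
  also have "\<dots> = (\<Sum>m. \<integral>\<^sup>+x. ?G m x \<partial>lborel)"
    by (rule nn_integral_suminf) measurable
  also have "\<dots> = (\<Sum>m. ennreal (B m))"
    using piece by simp
  finally have KB: "K = (\<Sum>m. ennreal (B m))" .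
  have B0: "B m \<ge> 0" for m using piece by blast
  \<comment> \<open>Convergence of the second series is inherited from the first one through the
    common value \<open>K\<close>.\<close>
  have sumB: "summable B"
    by (rule summable_suminf_not_top) (use B0 KB fin in auto)
  have "K = ennreal (suminf B)"
    unfolding KB by (intro suminf_ennreal2 B0 sumB)
  then have "suminf A = suminf B"
    using fin suminf_nonneg[OF sumA A0] suminf_nonneg[OF sumB B0] by simp
  then show ?thesis
    using that[of "suminf A"] summable_sums[OF sumA] summable_sums[OF sumB] unfolding A_def B_def c_def by simp
qed

section \<open>The eta function\<close>

lemma holomorphic_on_suminf:
  fixes f :: "nat \<Rightarrow> complex \<Rightarrow> complex"
  assumes "open S" and holo: "\<And>n. f n holomorphic_on S"
    and bound: "\<And>x. x \<in> S \<Longrightarrow> \<exists>d>0. \<exists>M. cball x d \<subseteq> S \<and> summable M \<and> (\<forall>n. \<forall>y\<in>cball x d. norm (f n y) \<le> M n)"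
  shows "(\<lambda>s. \<Sum>n. f n s) holomorphic_on S"
proof (rule holomorphic_uniform_sequence)
  show "(\<lambda>s. \<Sum>i<n. f i s) holomorphic_on S" for n
    by (intro holomorphic_intros holo)
  fix x assume "x \<in> S"
  from bound[OF this] obtain d M where "d > 0" "cball x d \<subseteq> S" "summable M" "\<And>n y. y \<in> cball x d \<Longrightarrow> norm (f n y) \<le> M n"
    by blast
  then show "\<exists>d>0. cball x d \<subseteq> S \<and> uniform_limit (cball x d) (\<lambda>n s. \<Sum>i<n. f i s) (\<lambda>s. \<Sum>n. f n s) sequentially"
    by (intro exI[of _ d] conjI Weierstrass_m_test) auto
qed fact

lemma has_field_derivative_powr_affine:
  fixes z w c :: complex
  assumes "Re (z + c) > 0"
  shows "((\<lambda>z. (z + c) powr w) has_field_derivative w * (z + c) powr (w - 1)) (at z within S)"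
proof -
  have "z + c \<notin> \<real>\<^sub>\<le>\<^sub>0" using assms by (auto simp: complex_nonpos_Reals_iff)
  then show ?thesis
    using DERIV_chain2[OF has_field_derivative_powr, of "\<lambda>z. z + c" z 1 S w] 
    by (auto intro!: derivative_eq_intros)
qed

lemma closed_segment_of_real_E:
  assumes "z \<in> closed_segment (of_real a :: complex) (of_real b)" "a \<le> b"
  obtains t where "z = of_real t" "a \<le> t" "t \<le> b"
  using assms by (auto simp: closed_segment_of_real closed_segment_eq_real_ivl)

text \<open>A mean value estimate; for \<open>Re z \<ge> -1\<close> the derivative is largest in
  modulus at the left end \<open>t\<close>.\<close>

lemma norm_powr_diff_le:
  fixes z :: complex and t u :: real
  assumes "0 < t" "t \<le> u" "Re z \<ge> -1"
  shows "norm (of_real u powr (- z) - of_real t powr (- z)) \<le> norm z * t powr (- Re z - 1) * (u - t)"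
proof -
  let ?S = "closed_segment (of_real t :: complex) (of_real u)"
  \<comment> \<open>The summand \<open>0\<close> brings the powers into the shape of
    \<open>has_field_derivative_powr_affine\<close>.\<close>
  have "norm ((of_real u + 0) powr (- z) - (of_real t + 0) powr (- z)) \<le> norm z * t powr (- Re z - 1) * norm (of_real u - of_real t :: complex)"
  proof (rule field_differentiable_bound[where S = ?S and f = "\<lambda>x. (x + 0) powr (- z)" and f' = "\<lambda>x. - z * (x + 0) powr (- z - 1)"])
    fix x assume "x \<in> ?S"
    then obtain y where y: "x = of_real y" "t \<le> y" "y \<le> u"
      using assms by (elim closed_segment_of_real_E) auto
    show "((\<lambda>x. (x + 0) powr (- z)) has_field_derivative - z * (x + 0) powr (- z - 1)) (at x within ?S)"
      by (rule has_field_derivative_powr_affine) (use assms y in auto)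
    have "y powr (- Re z - 1) \<le> t powr (- Re z - 1)"
      using assms y by (intro powr_mono2') auto
    then show "norm (- z * (x + 0) powr (- z - 1)) \<le> norm z * t powr (- Re z - 1)"
      using assms y by (auto simp: norm_mult norm_powr_real_powr intro!: mult_left_mono)
  qed auto
  then show ?thesis using assms by (simp flip: of_real_diff)
qed

text \<open>The second difference is an increment of the first difference \<open>f\<close>, and the
  derivative of \<open>f\<close> is again a first difference, with \<open>s + 1\<close> in place of
  \<open>s\<close>. So the mean value estimate is used twice and gains two powers of
  \<open>t\<close>.\<close>

lemma norm_powr_second_diff_le:
  fixes s :: complex and t :: real
  assumes "0 < t" "Re s \<ge> -2"
  shows "norm (of_real t powr (- s) - 2 * of_real (t + 1) powr (- s) + of_real (t + 2) powr (- s))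
     \<le> norm s * norm (s + 1) * t powr (- Re s - 2)"
proof -
  define f where "f = (\<lambda>x :: complex. (x + 1) powr (- s) - (x + 0) powr (- s))"
  let ?S = "closed_segment (of_real t :: complex) (of_real (t + 1))"
  have "norm (f (of_real (t + 1)) - f (of_real t)) \<le> (norm s * norm (s + 1) * t powr (- Re s - 2)) * norm (of_real (t + 1) - of_real t :: complex)"
  proof (rule field_differentiable_bound[where S = ?S and f' = "\<lambda>x. - s * (x + 1) powr (- s - 1) - (- s) * (x + 0) powr (- s - 1)"])
    fix x assume "x \<in> ?S"
    then obtain y where y: "x = of_real y" "t \<le> y" "y \<le> t + 1"
      using assms by (elim closed_segment_of_real_E) auto
    show "(f has_field_derivative - s * (x + 1) powr (- s - 1) - (- s) * (x + 0) powr (- s - 1)) (at x within ?S)"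
      unfolding f_def by (intro DERIV_diff has_field_derivative_powr_affine) (use assms y in auto)
    have "norm (of_real (y + 1) powr (- (s + 1)) - of_real y powr (- (s + 1))) \<le> norm (s + 1) * y powr (- Re (s + 1) - 1) * (y + 1 - y)"
      by (rule norm_powr_diff_le) (use assms y in auto)
    also have "\<dots> = norm (s + 1) * y powr (- Re s - 2)" by (simp add: algebra_simps)
    also have "\<dots> \<le> norm (s + 1) * t powr (- Re s - 2)"
      using assms y by (intro mult_left_mono powr_mono2') auto
    finally have "norm s * norm (of_real (y + 1) powr (- (s + 1)) - of_real y powr (- (s + 1))) \<le> norm s * (norm (s + 1) * t powr (- Re s - 2))"
      by (rule mult_left_mono) auto
    also have "norm s * norm (of_real (y + 1) powr (- (s + 1)) - of_real y powr (- (s + 1))) = norm (- s * (x + 1) powr (- s - 1) - (- s) * (x + 0) powr (- s - 1))"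
    proof -
      have e: "- (s + 1) = - s - 1" by simp
      show ?thesis
        unfolding e norm_mult[symmetric] by (subst norm_minus_cancel[symmetric]) (simp add: y right_diff_distrib)
    qed
    finally show "norm (- s * (x + 1) powr (- s - 1) - (- s) * (x + 0) powr (- s - 1)) \<le> norm s * norm (s + 1) * t powr (- Re s - 2)"
      by (simp add: mult.assoc)
  qed auto
  moreover have "f (of_real (t + 1)) - f (of_real t) = of_real t powr (- s) - 2 * of_real (t + 1) powr (- s) + of_real (t + 2) powr (- s)"
    by (simp add: f_def add.assoc)
  ultimately show ?thesis by (simp flip: of_real_diff)
qed

text \<open>
  The mean of two consecutive partial sums of the alternating series is a sum of second
  differences, which converges for \<open>Re s > - 1\<close>. The pairing starts at the index \<open>0\<close>, where
  \<open>0 powr (- s) = 0\<close>.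
\<close>
definition eta_term :: "nat \<Rightarrow> complex \<Rightarrow> complex" where
  "eta_term m s = of_nat (2 * m) powr (- s) - 2 * of_nat (2 * m + 1) powr (- s) + of_nat (2 * m + 2) powr (- s)"

text \<open>The term of index \<open>0\<close> stands apart because the bound for second differences
  needs a positive base. The factor \<open>- 1 / 2\<close> undoes the weight with which
  \<open>eta_term\<close> collects the alternating terms.\<close>

definition eta_ser :: "complex \<Rightarrow> complex" where
  "eta_ser s = - (eta_term 0 s + (\<Sum>m. eta_term (Suc m) s)) / 2"

lemma norm_eta_term_Suc_le:
  assumes "Re s \<ge> -2"
  shows "norm (eta_term (Suc m) s) \<le> norm s * norm (s + 1) * real (Suc m) powr (- Re s - 2)"
proof -
  have "norm (eta_term (Suc m) s) \<le> norm s * norm (s + 1) * real (2 * Suc m) powr (- Re s - 2)"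
    using norm_powr_second_diff_le[of "real (2 * Suc m)" s] assms
    by (simp add: eta_term_def add_ac)
  also have "\<dots> \<le> norm s * norm (s + 1) * real (Suc m) powr (- Re s - 2)"
    using assms by (intro mult_left_mono powr_mono2') auto
  finally show ?thesis .
qed

lemma summable_Suc_powr: "a < -1 \<Longrightarrow> summable (\<lambda>m. real (Suc m) powr a)"
  by (subst summable_Suc_iff) (simp add: summable_real_powr_iff)

lemma summable_eta_term:
  assumes "Re s > -1"
  shows "summable (\<lambda>m. eta_term (Suc m) s)"
proof (rule summable_comparison_test')
  show "summable (\<lambda>m. norm s * norm (s + 1) * real (Suc m) powr (- Re s - 2))"
    using assms by (intro summable_mult summable_Suc_powr) auto
  show "norm (eta_term (Suc m) s) \<le> norm s * norm (s + 1) * real (Suc m) powr (- Re s - 2)" if "m \<ge> 0" for m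
    using assms by (intro norm_eta_term_Suc_le) auto
qed

lemma eta_ser_sums:
  assumes "Re s > -1"
  shows "(\<lambda>m. eta_term m s) sums (- 2 * eta_ser s)"
proof -
  have "(\<lambda>m. eta_term (Suc m) s) sums (\<Sum>m. eta_term (Suc m) s)"
    by (rule summable_sums[OF summable_eta_term[OF assms]])
  then have "(\<lambda>m. eta_term m s) sums ((\<Sum>m. eta_term (Suc m) s) + eta_term 0 s)"
    by (rule sums_Suc)
  moreover have "(\<Sum>m. eta_term (Suc m) s) + eta_term 0 s = - 2 * eta_ser s"
    by (simp add: eta_ser_def)
  ultimately show ?thesis by simp
qed

lemma norm_of_nat_powr:
  assumes "n > 0"
  shows "norm (of_nat n powr w :: complex) = real n powr Re w"
  using norm_powr_real_powr[of "of_nat n" w] assms by simp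

lemma holomorphic_on_of_nat_powr [holomorphic_intros]:
  assumes "f holomorphic_on A"
  shows "(\<lambda>s. of_nat n powr f s) holomorphic_on A"
  by (cases "n = 0") (auto intro!: holomorphic_intros assms)

lemma holomorphic_eta_term: "eta_term m holomorphic_on A"
  unfolding eta_term_def[abs_def] by (intro holomorphic_intros)

lemma holomorphic_eta_ser: "eta_ser holomorphic_on {s. Re s > -1}"
proof -
  have "(\<lambda>s. \<Sum>m. eta_term (Suc m) s) holomorphic_on {s. Re s > -1}"
  proof (rule holomorphic_on_suminf)
    show "open {s. Re s > -1}" by (rule open_halfspace_Re_gt)
    fix x assume x: "x \<in> {s. Re s > -1}"
    define d where "d = (Re x + 1) / 2"
    have d: "d > 0" using x by (simp add: d_def)
    have cb: "Re y \<ge> Re x - d" "norm y \<le> norm x + d" if "y \<in> cball x d" for y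
    proof -
      have "norm (x - y) \<le> d" using that by (simp add: dist_norm)
      then show "Re y \<ge> Re x - d" using abs_Re_le_cmod[of "x - y"] by auto
      show "norm y \<le> norm x + d" using \<open>norm (x - y) \<le> d\<close> norm_triangle_ineq4[of x "x - y"] by simp
    qed
    show "\<exists>d>0. \<exists>M. cball x d \<subseteq> {s. Re s > -1} \<and> summable M \<and> (\<forall>n. \<forall>y\<in>cball x d. norm (eta_term (Suc n) y) \<le> M n)"
    proof (rule exI[of _ d], intro conjI exI)
      show "cball x d \<subseteq> {s. Re s > -1}"
      proof
        fix y assume "y \<in> cball x d"
        from cb(1)[OF this] show "y \<in> {s. Re s > -1}" using d by (simp add: d_def field_simps)
      qed
      show "summable (\<lambda>m. (norm x + d) * (norm x + d + 1) * real (Suc m) powr (- (Re x - d) - 2))"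
        using d by (intro summable_mult summable_Suc_powr) (simp add: d_def field_simps)
      show "\<forall>n. \<forall>y\<in>cball x d. norm (eta_term (Suc n) y) \<le> (norm x + d) * (norm x + d + 1) * real (Suc n) powr (- (Re x - d) - 2)"
      proof (intro allI ballI)
        fix n y assume y: "y \<in> cball x d"
        have "Re y \<ge> -2" using cb(1)[OF y] d by (simp add: d_def field_simps)
        then have "norm (eta_term (Suc n) y) \<le> norm y * norm (y + 1) * real (Suc n) powr (- Re y - 2)"
          by (rule norm_eta_term_Suc_le)
        also have "\<dots> \<le> (norm x + d) * (norm x + d + 1) * real (Suc n) powr (- (Re x - d) - 2)"
          using cb[OF y] d norm_triangle_ineq[of y 1]
          by (intro mult_mono powr_mono mult_nonneg_nonneg) auto
        finally show "norm (eta_term (Suc n) y) \<le> (norm x + d) * (norm x + d + 1) * real (Suc n) powr (- (Re x - d) - 2)" .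
      qed
    qed (use d in auto)
  qed (rule holomorphic_eta_term)
  then show ?thesis unfolding eta_ser_def[abs_def]
    by (intro holomorphic_intros holomorphic_eta_term) auto
qed

lemma tendsto_of_nat_powr_0:
  assumes "Re s > 0"
  shows "(\<lambda>n. of_nat n powr (- s) :: complex) \<longlonglongrightarrow> 0"
proof (rule tendsto_norm_zero_cancel)
  have "(\<lambda>n. real n powr (- Re s)) \<longlonglongrightarrow> 0"
    using assms by (intro tendsto_neg_powr filterlim_real_sequentially) auto
  moreover have "eventually (\<lambda>n. real n powr (- Re s) = norm (of_nat n powr (- s) :: complex)) sequentially"
    using eventually_gt_at_top[of 0] by eventually_elim (simp add: norm_of_nat_powr)
  ultimately show "(\<lambda>n. norm (of_nat n powr (- s) :: complex)) \<longlonglongrightarrow> 0"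
    by (rule Lim_transform_eventually)
qed

text \<open>A partial sum of \<open>eta_term\<close> is \<open>- 2\<close> times an even partial sum
  of the alternating series up to a term that tends to \<open>0\<close> when
  \<open>Re s > 0\<close>; the odd partial sums differ from the even ones by one more such
  term.\<close>

lemma eta_ser_alternating_sums:
  assumes "Re s > 0"
  shows "(\<lambda>n. (-1) ^ n * of_nat (Suc n) powr (- s)) sums eta_ser s"
proof -
  define S where "S = (\<lambda>N. \<Sum>n<N. (-1) ^ n * of_nat (Suc n) powr (- s) :: complex)"
  have part: "(\<Sum>m<M. eta_term m s) = - 2 * S (2 * M) - of_nat (2 * M) powr (- s)" for M
  proof (induction M)
    case (Suc M)
    have "S (2 * Suc M) = S (2 * M) + of_nat (2 * M + 1) powr (- s) - of_nat (2 * M + 2) powr (- s)"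
      by (simp add: S_def algebra_simps)
    then show ?case
      unfolding sum.lessThan_Suc Suc.IH by (simp add: eta_term_def)
  qed (simp add: S_def)
  have lim2: "(\<lambda>M. of_nat (2 * M) powr (- s) :: complex) \<longlonglongrightarrow> 0"
    by (rule filterlim_compose[OF tendsto_of_nat_powr_0[OF assms], of "\<lambda>M. 2 * M"]) real_asymp
  have lim1: "(\<lambda>M. of_nat (2 * M + 1) powr (- s) :: complex) \<longlonglongrightarrow> 0"
    by (rule filterlim_compose[OF tendsto_of_nat_powr_0[OF assms], of "\<lambda>M. 2 * M + 1"]) real_asymp
  have "(\<lambda>M. \<Sum>m<M. eta_term m s) \<longlonglongrightarrow> - 2 * eta_ser s"
    using eta_ser_sums[of s] assms by (simp add: sums_def)
  then have "(\<lambda>M. (- 1 / 2) * (\<Sum>m<M. eta_term m s) - of_nat (2 * M) powr (- s) / 2) \<longlonglongrightarrow> (- 1 / 2) * (- 2 * eta_ser s) - 0 / 2"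
    by (intro tendsto_intros lim2) auto
  moreover have "(\<lambda>M. (- 1 / 2) * (\<Sum>m<M. eta_term m s) - of_nat (2 * M) powr (- s) / 2) = (\<lambda>M. S (2 * M))"
    unfolding part by (simp add: fun_eq_iff field_simps)
  ultimately have even: "(\<lambda>M. S (2 * M)) \<longlonglongrightarrow> eta_ser s"
    by simp
  have "(\<lambda>M. S (2 * M) + of_nat (2 * M + 1) powr (- s)) \<longlonglongrightarrow> eta_ser s + 0"
    by (intro tendsto_intros even lim1)
  also have "(\<lambda>M. S (2 * M) + of_nat (2 * M + 1) powr (- s)) = (\<lambda>M. S (2 * M + 1))"
    by (simp add: S_def fun_eq_iff add_ac)
  finally have odd: "(\<lambda>M. S (2 * M + 1)) \<longlonglongrightarrow> eta_ser s" by simp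
  have "S \<longlonglongrightarrow> eta_ser s"
  proof (rule LIMSEQ_I)
    fix r :: real assume "r > 0"
    from LIMSEQ_D[OF even this] LIMSEQ_D[OF odd this] obtain A B where
      AB: "\<And>M. M \<ge> A \<Longrightarrow> norm (S (2 * M) - eta_ser s) < r" "\<And>M. M \<ge> B \<Longrightarrow> norm (S (2 * M + 1) - eta_ser s) < r"
      by blast
    have "norm (S n - eta_ser s) < r" if "n \<ge> 2 * A + 2 * B + 1" for n
    proof (cases "even n")
      case True
      then obtain m where "n = 2 * m" by (elim evenE)
      then show ?thesis using AB(1)[of m] that by auto
    next
      case False
      then obtain m where "n = 2 * m + 1" by (elim oddE)
      then show ?thesis using AB(2)[of m] that by auto
    qed
    then show "\<exists>no. \<forall>n\<ge>no. norm (S n - eta_ser s) < r" by blast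
  qed
  then show ?thesis by (simp add: sums_def S_def)
qed

section \<open>The functional equation of eta\<close>

definition odd_zeta :: "complex \<Rightarrow> complex" where
  "odd_zeta w = (\<Sum>n. of_nat (2 * n + 1) powr (- w))"

text \<open>The value of \<open>eta\<close> at \<open>1 - w\<close> for \<open>Re w > 1\<close>, as
  \<open>eta_reflection\<close> will say. The sum over odd integers, equal to
  \<open>(1 - 2 powr (- w)) * zeta w\<close>, appears because the poles of
  \<open>tanh (x / 2)\<close> are the odd multiples of \<open>pi * \<i>\<close>.\<close>

definition eta_refl :: "complex \<Rightarrow> complex" where
  "eta_refl w = - 2 * of_real pi powr (- w) * Gamma w * cos (of_real pi * w / 2) * odd_zeta w"

lemma norm_odd_zeta_term_le:
  assumes "Re w > 0"
  shows "norm (of_nat (2 * n + 1) powr (- w) :: complex) \<le> real (Suc n) powr (- Re w)"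
proof -
  have "norm (of_nat (2 * n + 1) powr (- w) :: complex) = real (2 * n + 1) powr (- Re w)"
    by (subst norm_of_nat_powr) auto
  also have "\<dots> \<le> real (Suc n) powr (- Re w)"
    using assms by (intro powr_mono2') auto
  finally show ?thesis .
qed

lemma odd_zeta_sums:
  assumes "Re w > 1"
  shows "(\<lambda>n. of_nat (2 * n + 1) powr (- w)) sums odd_zeta w"
  unfolding odd_zeta_def
proof (rule summable_sums, rule summable_comparison_test'[where N = 0])
  show "summable (\<lambda>m. real (Suc m) powr (- Re w))"
    using assms by (intro summable_Suc_powr) auto
  show "norm (of_nat (2 * n + 1) powr (- w) :: complex) \<le> real (Suc n) powr (- Re w)" for n
    by (rule norm_odd_zeta_term_le) (use assms in auto)
qed

lemma holomorphic_odd_zeta: "odd_zeta holomorphic_on {w. Re w > 1}"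
  unfolding odd_zeta_def[abs_def]
proof (rule holomorphic_on_suminf)
  show "open {s. Re s > 1}" by (rule open_halfspace_Re_gt)
  show "(\<lambda>w. of_nat (2 * n + 1) powr (- w)) holomorphic_on {w. Re w > 1}" for n
    by (intro holomorphic_intros)
  fix x assume x: "x \<in> {s. Re s > 1}"
  define d where "d = (Re x - 1) / 2"
  have d: "d > 0" using x by (simp add: d_def)
  have cb: "Re y \<ge> Re x - d" if "y \<in> cball x d" for y
  proof -
    have "norm (x - y) \<le> d" using that by (simp add: dist_norm)
    then show "Re y \<ge> Re x - d" using abs_Re_le_cmod[of "x - y"] by auto
  qed
  show "\<exists>d>0. \<exists>M. cball x d \<subseteq> {s. Re s > 1} \<and> summable M \<and> (\<forall>n. \<forall>y\<in>cball x d. norm (of_nat (2 * n + 1) powr (- y) :: complex) \<le> M n)"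
  proof (rule exI[of _ d], intro conjI exI)
    show sub: "cball x d \<subseteq> {s. Re s > 1}"
    proof
      fix y assume "y \<in> cball x d"
      from cb(1)[OF this] show "y \<in> {s. Re s > 1}" using d by (simp add: d_def field_simps)
    qed
    show "summable (\<lambda>m. real (Suc m) powr (- (Re x - d)))"
      using d by (intro summable_Suc_powr) (simp add: d_def field_simps)
    show "\<forall>n. \<forall>y\<in>cball x d. norm (of_nat (2 * n + 1) powr (- y) :: complex) \<le> real (Suc n) powr (- (Re x - d))"
    proof (intro allI ballI)
      fix n y assume y: "y \<in> cball x d"
      have "norm (of_nat (2 * n + 1) powr (- y) :: complex) \<le> real (Suc n) powr (- Re y)"
        using sub y by (intro norm_odd_zeta_term_le) auto
      also have "\<dots> \<le> real (Suc n) powr (- (Re x - d))"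
        using cb[OF y] by (intro powr_mono) auto
      finally show "norm (of_nat (2 * n + 1) powr (- y) :: complex) \<le> real (Suc n) powr (- (Re x - d))" .
    qed
  qed (use d in auto)
qed

lemma Re_pos_not_nonpos_Int: "Re w > 0 \<Longrightarrow> w \<notin> \<int>\<^sub>\<le>\<^sub>0"
  by (auto elim!: nonpos_Ints_cases)

lemma holomorphic_eta_refl: "eta_refl holomorphic_on {w. Re w > 1}"
  unfolding eta_refl_def[abs_def]
  by (intro holomorphic_intros holomorphic_odd_zeta) (auto elim!: nonpos_Ints_cases)

text \<open>Both series of \<open>alternating_eta_real\<close> have the same sum \<open>S\<close>:
  one is a multiple of \<open>eta_ser s\<close>, the other a multiple of
  \<open>odd_zeta (1 - s)\<close>. What is left is to simplify the quotient of the two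
  multiples.\<close>

lemma eta_ser_functional_real:
  fixes s :: real
  assumes s: "-1 < s" "s < 0"
  shows "eta_ser (of_real s) = eta_refl (1 - of_real s)"
proof -
  obtain S where
    S1: "(\<lambda>n. 2 * pi / cos (pi * s / 2) * ((2 * real n + 1) * pi) powr (s - 1)) sums S" and
    S2: "(\<lambda>m. Gamma (s + 1) / s * (real (2 * m) powr (- s) - 2 * real (2 * m + 1) powr (- s) + real (2 * m + 2) powr (- s))) sums S"
    by (rule alternating_eta_real[OF s])
  have cos: "cos (pi * s / 2) > 0" 
  proof (intro cos_gt_zero_pi)
    have "pi * (- 1) < pi * s" using s by (intro mult_strict_left_mono) auto
    then show "- (pi / 2) < pi * s / 2" by simp
    have "pi * s < 0" using s by (simp add: mult_pos_neg)
    then show "pi * s / 2 < pi / 2" using pi_gt_zero by linarith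
  qed
  have cpowr: "of_nat n powr (- of_real s) = (of_real (real n powr (- s)) :: complex)" for n
    using powr_of_real[of "real n" "- s"] by simp
  have "(\<lambda>m. of_real (Gamma (s + 1) / s * (real (2 * m) powr (- s) - 2 * real (2 * m + 1) powr (- s) + real (2 * m + 2) powr (- s)))) sums (of_real S :: complex)"
    using S2 by (rule sums_of_real)
  also have "(\<lambda>m. of_real (Gamma (s + 1) / s * (real (2 * m) powr (- s) - 2 * real (2 * m + 1) powr (- s) + real (2 * m + 2) powr (- s))))
     = (\<lambda>m. of_real (Gamma (s + 1) / s) * eta_term m (of_real s) :: complex)"
    unfolding eta_term_def cpowr by (simp add: fun_eq_iff)
  finally have "(\<lambda>m. of_real (Gamma (s + 1) / s) * eta_term m (of_real s) :: complex) sums of_real S" .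
  moreover have "(\<lambda>m. of_real (Gamma (s + 1) / s) * eta_term m (of_real s) :: complex) sums (of_real (Gamma (s + 1) / s) * (- 2 * eta_ser (of_real s)))"
    by (intro sums_mult eta_ser_sums) (use s in auto)
  ultimately have A: "of_real S = of_real (Gamma (s + 1) / s) * (- 2 * eta_ser (of_real s))"
    by (rule sums_unique2)
  have "(\<lambda>n. of_nat (2 * n + 1) powr (- (1 - of_real s))) sums odd_zeta (1 - of_real s)"
    by (rule odd_zeta_sums) (use s in auto)
  then have "(\<lambda>n. of_real (2 * pi / cos (pi * s / 2) * pi powr (s - 1)) * of_nat (2 * n + 1) powr (- (1 - of_real s))) sums (of_real (2 * pi / cos (pi * s / 2) * pi powr (s - 1)) * odd_zeta (1 - of_real s))"
    by (rule sums_mult)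
  also have "(\<lambda>n. of_real (2 * pi / cos (pi * s / 2) * pi powr (s - 1)) * of_nat (2 * n + 1) powr (- (1 - of_real s)))
     = (\<lambda>n. complex_of_real (2 * pi / cos (pi * s / 2) * ((2 * real n + 1) * pi) powr (s - 1)))"
  proof
    fix n
    have "of_nat (2 * n + 1) powr (- (1 - of_real s)) = (of_real (real (2 * n + 1) powr (s - 1)) :: complex)"
      by (subst powr_of_real[symmetric]) auto
    moreover have "((2 * real n + 1) * pi) powr (s - 1) = (2 * real n + 1) powr (s - 1) * pi powr (s - 1)"
      by (rule powr_mult)
    ultimately show "of_real (2 * pi / cos (pi * s / 2) * pi powr (s - 1)) * of_nat (2 * n + 1) powr (- (1 - of_real s))
     = complex_of_real (2 * pi / cos (pi * s / 2) * ((2 * real n + 1) * pi) powr (s - 1))" by (simp add: add_ac)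
  qed
  finally have B: "of_real S = of_real (2 * pi / cos (pi * s / 2) * pi powr (s - 1)) * odd_zeta (1 - of_real s)"
    using sums_of_real[OF S1] by (rule sums_unique2[rotated])
  \<comment> \<open>Reflection of \<open>Gamma\<close> trades \<open>1 / Gamma (s + 1)\<close> for
    \<open>Gamma (1 - s)\<close>; the double angle formula for the sine then cancels the cosine in
    the denominator.\<close>
  have G: "Gamma (1 - s) * sin (pi * s) / pi = s / Gamma (s + 1)"
  proof -
    have "complex_of_real (s / Gamma (s + 1)) = of_real s * rGamma (of_real s + 1)"
      by (simp add: rGamma_inverse_Gamma Gamma_complex_of_real[symmetric] divide_inverse)
    also have "\<dots> = rGamma (of_real s)" by (rule rGamma_plus1)
    also have "\<dots> = Gamma (1 - of_real s) * (rGamma (of_real s) * rGamma (1 - of_real s))"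
      using Re_pos_not_nonpos_Int[of "1 - of_real s"] s by (simp add: Gamma_def rGamma_eq_zero_iff)
    also have "\<dots> = of_real (Gamma (1 - s) * sin (pi * s) / pi)"
      by (subst rGamma_reflection_complex) (simp add: Gamma_complex_of_real[symmetric] sin_of_real[symmetric])
    finally show ?thesis by (simp only: of_real_eq_iff)
  qed
  have Gp: "Gamma (s + 1) > 0" using s by (intro Gamma_real_pos) auto
  have "of_real (s / Gamma (s + 1)) * of_real S = - 2 * eta_ser (of_real s)"
  proof -
    have "s / Gamma (s + 1) * (Gamma (s + 1) / s) = 1"
    proof -
      have "Gamma (s + 1) \<noteq> 0" using Gp by linarith
      then show ?thesis using s by (simp add: field_simps)
    qed
    then have "complex_of_real (s / Gamma (s + 1)) * of_real (Gamma (s + 1) / s) = 1"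
      by (simp only: of_real_mult[symmetric] of_real_1)
    then show ?thesis unfolding A mult.assoc[symmetric] by simp
  qed
  then have "eta_ser (of_real s) = - (1 / 2) * (of_real (s / Gamma (s + 1)) * of_real S)"
    by simp
  also have "of_real (s / Gamma (s + 1)) * of_real S = of_real (Gamma (1 - s) * sin (pi * s) / pi * (2 * pi / cos (pi * s / 2) * pi powr (s - 1))) * odd_zeta (1 - of_real s)"
    unfolding B G[symmetric] by (simp only: of_real_mult mult.assoc)
  also have "sin (pi * s) = 2 * sin (pi * s / 2) * cos (pi * s / 2)"
    using sin_double[of "pi * s / 2"] by simp
  also have "Gamma (1 - s) * (2 * sin (pi * s / 2) * cos (pi * s / 2)) / pi * (2 * pi / cos (pi * s / 2) * pi powr (s - 1))
     = 4 * (pi powr (s - 1) * Gamma (1 - s) * sin (pi * s / 2))"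
    using cos by (simp add: field_simps)
  also have "- (1 / 2) * (of_real (4 * (pi powr (s - 1) * Gamma (1 - s) * sin (pi * s / 2))) * odd_zeta (1 - of_real s))
     = - 2 * of_real (pi powr (s - 1)) * of_real (Gamma (1 - s)) * of_real (sin (pi * s / 2)) * odd_zeta (1 - of_real s)"
    by simp
  also have "of_real (pi powr (s - 1)) = (of_real pi powr (- (1 - of_real s)) :: complex)"
    by (simp add: powr_of_real[symmetric])
  also have "of_real (Gamma (1 - s)) = Gamma (1 - of_real s :: complex)"
    by (simp add: Gamma_complex_of_real[symmetric])
  also have "of_real (sin (pi * s / 2)) = cos (of_real pi * (1 - of_real s) / 2 :: complex)"
  proof -
    have "of_real pi * (1 - of_real s) / 2 = complex_of_real (pi / 2 - pi * s / 2)"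
      by (simp add: right_diff_distrib diff_divide_distrib)
    then have "cos (of_real pi * (1 - of_real s) / 2 :: complex) = of_real (cos (pi / 2 - pi * s / 2))"
      by (simp only: cos_of_real)
    also have "cos (pi / 2 - pi * s / 2) = sin (pi * s / 2)"
      by (simp add: cos_diff)
    finally show ?thesis by simp
  qed
  finally show ?thesis by (simp add: eta_refl_def)
qed

text \<open>The Mellin argument is confined to a real interval; the identity theorem, with the
  interior point \<open>- 1 / 2\<close> as accumulation point, carries the equation to the open
  strip.\<close>

lemma eta_ser_functional:
  assumes "-1 < Re s" "Re s < 0"
  shows "eta_ser s = eta_refl (1 - s)"
proof -
  define S where "S = {s. -1 < Re s} \<inter> {s. Re s < 0}"
  define U where "U = complex_of_real ` {-1<..<0}"
  have op: "open S" unfolding S_def by (intro open_Int open_halfspace_Re_gt open_halfspace_Re_lt)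
  have con: "connected S" unfolding S_def
    by (intro convex_connected convex_Int convex_halfspace_Re_gt convex_halfspace_Re_lt)
  have "eta_ser s - eta_refl (1 - s) = 0"
  proof (rule analytic_continuation[where S = S and U = U and f = "\<lambda>s. eta_ser s - eta_refl (1 - s)" and \<xi> = "of_real (-1/2)"])
    have "eta_ser holomorphic_on S"
      by (rule holomorphic_on_subset[OF holomorphic_eta_ser]) (auto simp: S_def)
    moreover have "(eta_refl \<circ> (\<lambda>s. 1 - s)) holomorphic_on S"
      by (rule holomorphic_on_compose_gen[OF _ holomorphic_eta_refl]) (auto simp: S_def intro!: holomorphic_intros)
    ultimately show "(\<lambda>s. eta_ser s - eta_refl (1 - s)) holomorphic_on S"
      by (intro holomorphic_on_diff) (auto simp: o_def)
    show "complex_of_real (- 1 / 2) islimpt U"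
      unfolding islimpt_approachable
    proof (intro allI impI)
      fix e :: real assume e: "e > 0"
      define t where "t = - 1 / 2 + min (e / 2) (1 / 4)"
      have "t \<in> {-1<..<0}" "t \<noteq> - 1 / 2" "dist t (- 1 / 2) < e"
        using e by (auto simp: t_def dist_real_def min_def)
      then have "complex_of_real t \<in> U" "complex_of_real t \<noteq> complex_of_real (- 1 / 2)"
        "dist (complex_of_real t) (complex_of_real (- 1 / 2)) < e"
        unfolding U_def dist_of_real of_real_eq_iff by auto
      then show "\<exists>x'\<in>U. x' \<noteq> complex_of_real (- 1 / 2) \<and> dist x' (complex_of_real (- 1 / 2)) < e"
        by blast
    qed
    show "eta_ser z - eta_refl (1 - z) = 0" if "z \<in> U" for z
      using that eta_ser_functional_real by (auto simp: U_def)
  qed (use assms op con in \<open>auto simp: S_def U_def\<close>)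
  then show ?thesis by simp
qed

section \<open>The zeta function\<close>

text \<open>The quotient is the integral of \<open>x powr (- s)\<close> from \<open>n + 1\<close> to
  \<open>n + 2\<close>, so each term measures the error of replacing the sum by the integral, and
  the sum converges for \<open>Re s > 0\<close>. Dividing \<open>eta\<close> by
  \<open>1 - 2 powr (1 - s)\<close> instead would leave the zeros of the divisor on
  \<open>Re s = 1\<close> to be dealt with.\<close>

definition zeta_term :: "nat \<Rightarrow> complex \<Rightarrow> complex" where
  "zeta_term n s = of_nat (Suc n) powr (- s) - (of_nat (n + 2) powr (1 - s) - of_nat (Suc n) powr (1 - s)) / (1 - s)"

definition zeta_ser :: "complex \<Rightarrow> complex" where
  "zeta_ser s = 1 / (s - 1) + (\<Sum>n. zeta_term n s)"

text \<open>Up to sign the term is an increment of the primitive \<open>f\<close> of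
  \<open>x powr (- s) - t powr (- s)\<close>, and \<open>norm_powr_diff_le\<close> bounds that
  difference on a segment of length \<open>1\<close>.\<close>

lemma norm_zeta_term_le:
  assumes "Re s > 0" "s \<noteq> 1"
  shows "norm (zeta_term n s) \<le> norm s * real (Suc n) powr (- Re s - 1)"
proof -
  define t where "t = real (Suc n)"
  have t: "t > 0" by (simp add: t_def)
  define f where "f = (\<lambda>x :: complex. (x + 0) powr (1 - s) / (1 - s) - x * of_real t powr (- s))"
  let ?S = "closed_segment (of_real t :: complex) (of_real (t + 1))"
  have "norm (f (of_real (t + 1)) - f (of_real t)) \<le> (norm s * t powr (- Re s - 1)) * norm (of_real (t + 1) - of_real t :: complex)"
  proof (rule field_differentiable_bound[where S = ?S and f' = "\<lambda>x. ((1 - s) * (x + 0) powr (1 - s - 1)) / (1 - s) - of_real t powr (- s)"])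
    fix x assume "x \<in> ?S"
    then obtain y where y: "x = of_real y" "t \<le> y" "y \<le> t + 1"
      using assms by (elim closed_segment_of_real_E) auto
    have "(f has_field_derivative ((1 - s) * (x + 0) powr (1 - s - 1)) / (1 - s) - 1 * of_real t powr (- s)) (at x within ?S)"
      unfolding f_def
      by (intro DERIV_diff DERIV_cdivide has_field_derivative_powr_affine DERIV_cmult_right DERIV_ident) (use t y in auto)
    then show "(f has_field_derivative ((1 - s) * (x + 0) powr (1 - s - 1)) / (1 - s) - of_real t powr (- s)) (at x within ?S)"
      by simp
    have "norm (of_real y powr (- s) - of_real t powr (- s)) \<le> norm s * t powr (- Re s - 1) * (y - t)"
      by (rule norm_powr_diff_le) (use assms t y in auto)
    also have "\<dots> \<le> norm s * t powr (- Re s - 1) * 1"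
      using y by (intro mult_left_mono) auto
    finally show "norm (((1 - s) * (x + 0) powr (1 - s - 1)) / (1 - s) - of_real t powr (- s)) \<le> norm s * t powr (- Re s - 1)"
      using assms by (simp add: y)
  qed auto
  moreover have "f (of_real (t + 1)) - f (of_real t) = - zeta_term n s"
    using assms by (simp add: f_def zeta_term_def t_def add_ac diff_divide_distrib algebra_simps)
  ultimately show ?thesis by (simp add: t_def flip: of_real_diff)
qed

lemma holomorphic_zeta_term: "1 \<notin> A \<Longrightarrow> zeta_term n holomorphic_on A"
  unfolding zeta_term_def[abs_def] by (intro holomorphic_intros) auto

lemma holomorphic_zeta_ser: "zeta_ser holomorphic_on ({s. Re s > 0} - {1})"
proof -
  have op: "open ({s. Re s > 0} - {1})"
    by (intro open_Diff open_halfspace_Re_gt) auto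
  have "(\<lambda>s. \<Sum>n. zeta_term n s) holomorphic_on ({s. Re s > 0} - {1})"
  proof (rule holomorphic_on_suminf[OF op])
    fix x :: complex assume x: "x \<in> {s. Re s > 0} - {1}"
    then obtain d0 where d0: "d0 > 0" "cball x d0 \<subseteq> {s. Re s > 0} - {1}"
      using op open_contains_cball by blast
    define d where "d = min d0 (Re x / 2)"
    have d: "d > 0" "d \<le> Re x / 2" using x d0 by (auto simp: d_def)
    have sub: "cball x d \<subseteq> {s. Re s > 0} - {1}" using d0 by (auto simp: d_def)
    have cb: "Re y \<ge> Re x / 2" "norm y \<le> norm x + d" if "y \<in> cball x d" for y
    proof -
      have *: "norm (x - y) \<le> d" using that by (simp add: dist_norm)
      then show "Re y \<ge> Re x / 2" using abs_Re_le_cmod[of "x - y"] d by auto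
      show "norm y \<le> norm x + d" using * norm_triangle_ineq4[of x "x - y"] by simp
    qed
    show "\<exists>d>0. \<exists>M. cball x d \<subseteq> {s. Re s > 0} - {1} \<and> summable M \<and> (\<forall>n. \<forall>y\<in>cball x d. norm (zeta_term n y) \<le> M n)"
    proof (rule exI[of _ d], intro conjI exI)
      show "summable (\<lambda>m. (norm x + d) * real (Suc m) powr (- (Re x / 2) - 1))"
        using d x by (intro summable_mult summable_Suc_powr) auto
      show "\<forall>n. \<forall>y\<in>cball x d. norm (zeta_term n y) \<le> (norm x + d) * real (Suc n) powr (- (Re x / 2) - 1)"
      proof (intro allI ballI)
        fix n y assume y: "y \<in> cball x d"
        have "norm (zeta_term n y) \<le> norm y * real (Suc n) powr (- Re y - 1)"
          using sub y by (intro norm_zeta_term_le) auto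
        also have "\<dots> \<le> (norm x + d) * real (Suc n) powr (- (Re x / 2) - 1)"
          using cb[OF y] d by (intro mult_mono powr_mono) auto
        finally show "norm (zeta_term n y) \<le> (norm x + d) * real (Suc n) powr (- (Re x / 2) - 1)" .
      qed
    qed (use d sub in auto)
  qed (auto intro!: holomorphic_zeta_term)
  then show ?thesis unfolding zeta_ser_def[abs_def] by (intro holomorphic_intros) auto
qed

lemma summable_zeta_terms:
  assumes "Re s > 1"
  shows "summable (\<lambda>n. of_nat (Suc n) powr (- s) :: complex)"
proof (rule summable_comparison_test'[where N = 0])
  show "summable (\<lambda>m. real (Suc m) powr (- Re s))"
    using assms by (intro summable_Suc_powr) auto
  show "norm (of_nat (Suc n) powr (- s) :: complex) \<le> real (Suc n) powr (- Re s)" for n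
    using norm_of_nat_powr[of "Suc n" "- s"] by simp
qed

lemma zeta_ser_sums:
  assumes "Re s > 1"
  shows "(\<lambda>n. of_nat (Suc n) powr (- s)) sums zeta_ser s"
proof -
  have s: "s \<noteq> 1" using assms by auto
  have lim: "(\<lambda>n. of_nat (n + 1) powr (- (s - 1)) :: complex) \<longlonglongrightarrow> 0"
    by (rule filterlim_compose[OF tendsto_of_nat_powr_0, of _ "\<lambda>n. n + 1"]) (use assms in \<open>auto intro: filterlim_Suc\<close>)
  have "(\<lambda>n. of_nat (Suc n + 1) powr (1 - s) - of_nat (n + 1) powr (1 - s) :: complex) sums (0 - of_nat (0 + 1) powr (1 - s))"
    by (rule telescope_sums) (use lim in simp)
  then have "(\<lambda>n. (of_nat (Suc n + 1) powr (1 - s) - of_nat (n + 1) powr (1 - s) :: complex) / (1 - s)) sums ((0 - of_nat (0 + 1) powr (1 - s)) / (1 - s))"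
    by (rule sums_divide)
  from sums_diff[OF summable_sums[OF summable_zeta_terms[OF assms]] this]
  have "(\<lambda>n. zeta_term n s) sums ((\<Sum>n. of_nat (Suc n) powr (- s)) + 1 / (1 - s))"
    by (simp add: zeta_term_def add_ac)
  then have "(\<Sum>n. zeta_term n s) = (\<Sum>n. of_nat (Suc n) powr (- s)) + 1 / (1 - s)"
    by (rule sums_unique[symmetric])
  also have "1 / (1 - s) = - (1 / (s - 1))"
    using minus_divide_right[of 1 "s - 1"] by simp
  finally have "zeta_ser s = (\<Sum>n. of_nat (Suc n) powr (- s))"
    by (simp add: zeta_ser_def)
  then show ?thesis using summable_sums[OF summable_zeta_terms[OF assms]] by simp
qed

lemma sums_pair_group: "f sums (S :: complex) \<Longrightarrow> (\<lambda>n. f (2 * n) + f (2 * n + 1)) sums S"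
proof -
  assume "f sums S"
  then have "(\<lambda>n. sum f {n * 2..<n * 2 + 2}) sums S"
    by (rule sums_group) simp
  moreover have "sum f {n * 2..<n * 2 + 2} = f (2 * n) + f (2 * n + 1)" for n
  proof -
    have "{n * 2..<n * 2 + 2} = {2 * n, 2 * n + 1}" by auto
    then show ?thesis by simp
  qed
  ultimately show ?thesis by simp
qed

lemma of_nat_mult_powr_complex:
  "of_nat (m * n) powr (s :: complex) = of_nat m powr s * of_nat n powr s"
proof (cases "m = 0 \<or> n = 0")
  case False
  then show ?thesis
    using powr_times_real[of "of_nat m" "of_nat n" s] by simp
qed auto

text \<open>Terms are grouped into pairs of an odd and an even integer. The even integers contribute
  \<open>2 powr (- s) * zeta_ser s\<close>; subtracting this twice or once gives the two
  identities.\<close>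

lemma zeta_ser_eta_ser:
  assumes "Re s > 1"
  shows "(1 - 2 powr (1 - s)) * zeta_ser s = eta_ser s"
    and "odd_zeta s = (1 - 2 powr (- s)) * zeta_ser s"
proof -
  have A: "(\<lambda>n. of_nat (2 * n + 1) powr (- s) + of_nat (2 * n + 2) powr (- s)) sums zeta_ser s"
    using sums_pair_group[OF zeta_ser_sums[OF assms]] by (simp add: add_ac)
  have B: "(\<lambda>n. of_nat (2 * n + 1) powr (- s) - of_nat (2 * n + 2) powr (- s)) sums eta_ser s"
    using sums_pair_group[OF eta_ser_alternating_sums, of s] assms by (simp add: add_ac)
  have C: "(\<lambda>n. of_nat (2 * n + 2) powr (- s)) sums (2 powr (- s) * zeta_ser s)"
  proof -
    have "(\<lambda>n. 2 powr (- s) * of_nat (Suc n) powr (- s)) sums (2 powr (- s) * zeta_ser s)"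
      by (intro sums_mult zeta_ser_sums assms)
    also have "(\<lambda>n. 2 powr (- s) * of_nat (Suc n) powr (- s)) = (\<lambda>n. of_nat (2 * n + 2) powr (- s))"
    proof
      fix n
      show "2 powr (- s) * of_nat (Suc n) powr (- s) = of_nat (2 * n + 2) powr (- s)"
        using of_nat_mult_powr_complex[of 2 "Suc n" "- s"] by simp
    qed
    finally show ?thesis .
  qed
  have "(\<lambda>n. (of_nat (2 * n + 1) powr (- s) + of_nat (2 * n + 2) powr (- s)) - 2 * of_nat (2 * n + 2) powr (- s)) sums (zeta_ser s - 2 * (2 powr (- s) * zeta_ser s))"
    by (intro sums_diff sums_mult A C)
  then have "(\<lambda>n. of_nat (2 * n + 1) powr (- s) - of_nat (2 * n + 2) powr (- s)) sums (zeta_ser s - 2 * (2 powr (- s) * zeta_ser s))"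
    by (simp add: algebra_simps)
  from sums_unique2[OF this B] have "zeta_ser s - 2 * (2 powr (- s) * zeta_ser s) = eta_ser s" .
  moreover have "2 powr (1 - s) = 2 * 2 powr (- s)"
    using powr_add[of 2 1 "- s"] by simp
  ultimately show "(1 - 2 powr (1 - s)) * zeta_ser s = eta_ser s"
    by (simp add: algebra_simps)
  have "(\<lambda>n. of_nat (2 * n + 1) powr (- s)) sums (zeta_ser s - 2 powr (- s) * zeta_ser s)"
    using sums_diff[OF A C] by simp
  from sums_unique2[OF odd_zeta_sums[OF assms] this]
  show "odd_zeta s = (1 - 2 powr (- s)) * zeta_ser s" by (simp add: algebra_simps)
qed

lemma zeta_ser_eta_ser_ext:
  assumes "Re s > 0" "s \<noteq> 1"
  shows "(1 - 2 powr (1 - s)) * zeta_ser s = eta_ser s"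
proof -
  let ?f = "\<lambda>s. (1 - 2 powr (1 - s)) * zeta_ser s"
  let ?S = "{s. Re s > 0} - {1}"
  have "?f s = eta_ser s"
  proof (rule analytic_continuation_open[where f = ?f and g = eta_ser and s = "{s. Re s > 1}" and s' = ?S])
    show "open {s. Re s > 1}" by (rule open_halfspace_Re_gt)
    show "open ?S" by (intro open_Diff open_halfspace_Re_gt) auto
    have "2 \<in> {s. Re s > 1}" by simp
    then show "{s. Re s > 1} \<noteq> {}" by blast
    show "connected ?S"
      by (rule connected_open_delete) (auto intro: open_halfspace_Re_gt convex_connected convex_halfspace_Re_gt)
    show "?f holomorphic_on ?S" by (intro holomorphic_intros holomorphic_zeta_ser) auto
    show "eta_ser holomorphic_on ?S"
      by (rule holomorphic_on_subset[OF holomorphic_eta_ser]) auto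
  qed (use assms zeta_ser_eta_ser in auto)
  then show ?thesis by simp
qed

section \<open>Identification of the continuations with eta and zeta\<close>

definition eta_entire :: "complex \<Rightarrow> complex" where
  "eta_entire s = (if Re s > -1 then eta_ser s else eta_refl (1 - s))"

lemma eta_entire_refl: "Re s < 0 \<Longrightarrow> eta_entire s = eta_refl (1 - s)"
  by (auto simp: eta_entire_def eta_ser_functional)

text \<open>By the functional equation the reflected branch is valid on all of
  \<open>Re s < 0\<close>, so two open half planes with a common strip cover the plane.\<close>

lemma holomorphic_eta_entire: "eta_entire holomorphic_on A"
proof -
  have 1: "eta_entire holomorphic_on {s. Re s > -1}"
    by (rule holomorphic_transform[OF holomorphic_eta_ser]) (auto simp: eta_entire_def)
  have "(eta_refl \<circ> (\<lambda>s. 1 - s)) holomorphic_on {s. Re s < 0}"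
    by (rule holomorphic_on_compose_gen[OF _ holomorphic_eta_refl]) (auto intro!: holomorphic_intros)
  then have 2: "eta_entire holomorphic_on {s. Re s < 0}"
    by (rule holomorphic_transform) (auto simp: eta_entire_refl)
  have "eta_entire holomorphic_on ({s. Re s > -1} \<union> {s. Re s < 0})"
    by (rule holomorphic_on_Un[OF 1 2]) (auto intro: open_halfspace_Re_gt open_halfspace_Re_lt)
  then show ?thesis by (rule holomorphic_on_subset) auto
qed

lemma two_powr_neq_1: "Re s < 1 \<Longrightarrow> 1 - 2 powr (1 - s) \<noteq> (0 :: complex)"
proof
  assume s: "Re s < 1" and "1 - 2 powr (1 - s) = (0 :: complex)"
  then have "norm (2 powr (1 - s) :: complex) = 1" by simp
  also have "norm (2 powr (1 - s) :: complex) = 2 powr (1 - Re s)"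
    using norm_of_nat_powr[of 2 "1 - s"] by simp
  finally show False using s by simp
qed

text \<open>The quotient is used only where \<open>Re s \<le> 0\<close>, because the zeros of its
  denominator lie on \<open>Re s = 1\<close>. The value at \<open>1\<close> is the one prescribed by
  \<open>is_zeta\<close>.\<close>

definition zeta_ext :: "complex \<Rightarrow> complex" where
  "zeta_ext s = (if s = 1 then 0 else if Re s > 0 then zeta_ser s else eta_entire s / (1 - 2 powr (1 - s)))"

lemma zeta_ext_eq: "s \<noteq> 1 \<Longrightarrow> Re s < 1 \<Longrightarrow> zeta_ext s = eta_entire s / (1 - 2 powr (1 - s))"
  using zeta_ser_eta_ser_ext[of s] two_powr_neq_1[of s] by (auto simp: zeta_ext_def eta_entire_def field_simps)

lemma is_zeta_zeta_ext: "is_zeta zeta_ext"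
  unfolding is_zeta_def
proof (intro conjI allI impI)
  have 1: "zeta_ext holomorphic_on ({s. Re s > 0} - {1})"
    by (rule holomorphic_transform[OF holomorphic_zeta_ser]) (auto simp: zeta_ext_def)
  have "(\<lambda>s. eta_entire s / (1 - 2 powr (1 - s))) holomorphic_on {s. Re s < 1}"
    by (intro holomorphic_intros holomorphic_eta_entire) (use two_powr_neq_1 in auto)
  then have 2: "zeta_ext holomorphic_on {s. Re s < 1}"
  proof (rule holomorphic_transform)
    show "eta_entire s / (1 - 2 powr (1 - s)) = zeta_ext s" if "s \<in> {s. Re s < 1}" for s
      using zeta_ext_eq[of s] that by force
  qed
  have "zeta_ext holomorphic_on (({s. Re s > 0} - {1}) \<union> {s. Re s < 1})"
    by (rule holomorphic_on_Un[OF 1 2]) (auto intro: open_halfspace_Re_gt open_halfspace_Re_lt)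
  then show "zeta_ext holomorphic_on - {1}" by (rule holomorphic_on_subset) auto
  show "(\<lambda>n. of_nat (Suc n) powr (- s)) sums zeta_ext s" if "Re s > 1" for s
  proof -
    have "zeta_ext s = zeta_ser s" using that by (auto simp: zeta_ext_def)
    then show ?thesis using zeta_ser_sums[OF that] by simp
  qed
qed (simp add: zeta_ext_def)

lemma zeta_eq_ext: "zeta = zeta_ext"
  unfolding zeta_def using is_zeta_zeta_ext is_zeta_unique by blast

lemma is_zeta_zeta: "is_zeta zeta"
  unfolding zeta_eq_ext by (rule is_zeta_zeta_ext)

lemma holomorphic_zeta: "1 \<notin> A \<Longrightarrow> zeta holomorphic_on A"
  using is_zeta_zeta holomorphic_on_subset[of zeta "- {1}" A] by (auto simp: is_zeta_def)

lemma zeta_sums: "Re s > 1 \<Longrightarrow> (\<lambda>n. of_nat (Suc n) powr (- s)) sums zeta s"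
  using is_zeta_zeta by (auto simp: is_zeta_def)

lemma eta_eq_entire: "eta = eta_entire"
proof
  fix s
  show "eta s = eta_entire s"
  proof (cases "Re s > 0")
    case True
    then show ?thesis using sums_unique[OF eta_ser_alternating_sums[OF True]]
      by (simp add: eta_def eta_entire_def)
  next
    case False
    then have "s \<noteq> 1" "Re s < 1" by auto
    then show ?thesis using False two_powr_neq_1[of s]
      by (simp add: eta_def zeta_eq_ext zeta_ext_eq)
  qed
qed

lemma holomorphic_eta: "eta holomorphic_on A"
  unfolding eta_eq_entire by (rule holomorphic_eta_entire)

text \<open>The point \<open>1\<close> is excluded because the right hand side is \<open>0\<close>
  there by the convention for the pole, whereas \<open>eta\<close> takes the value
  \<open>ln 2\<close>.\<close>

lemma eta_conv_zeta: "s \<noteq> 1 \<Longrightarrow> eta s = (1 - 2 powr (1 - s)) * zeta s"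
  using zeta_ser_eta_ser_ext[of s] two_powr_neq_1[of s]
  by (cases "Re s > 0") (auto simp: eta_eq_entire zeta_eq_ext zeta_ext_def eta_entire_def)

lemma eta_reflection: "Re w > 1 \<Longrightarrow> eta (1 - w) = eta_refl w"
  unfolding eta_eq_entire by (subst eta_entire_refl) auto

lemma odd_zeta_conv_zeta: "Re w > 1 \<Longrightarrow> odd_zeta w = (1 - 2 powr (- w)) * zeta w"
  using zeta_ser_eta_ser(2)[of w] by (auto simp: zeta_eq_ext zeta_ext_def)

lemma eta_sums: "Re s > 0 \<Longrightarrow> (\<lambda>n. (-1) ^ n * of_nat (Suc n) powr (- s)) sums eta s"
  using eta_ser_alternating_sums[of s] by (simp add: eta_eq_entire eta_entire_def)

text \<open>The exponent \<open>2\<close> comes from the factor \<open>norm s * norm (s + 1)\<close>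
  in the bound for second differences; on \<open>Re s \<ge> -1/2\<close> the remaining powers are
  dominated by a fixed convergent series.\<close>

lemma eta_poly_bound:
  obtains C where "C > 0" "\<And>s. Re s \<ge> -1/2 \<Longrightarrow> norm (eta s) \<le> C * (1 + norm s) ^ 2"
proof -
  define Z where "Z = (\<Sum>m. real (Suc m) powr (- 3 / 2))"
  have sZ: "summable (\<lambda>m. real (Suc m) powr (- 3 / 2))" by (rule summable_Suc_powr) simp
  have Z0: "Z \<ge> 0" unfolding Z_def by (intro suminf_nonneg sZ) auto
  have "norm (eta s) \<le> (4 + Z) * (1 + norm s) ^ 2" if s: "Re s \<ge> -1/2" for s
  proof -
    have n: "norm (eta_term (Suc m) s) \<le> norm s * norm (s + 1) * real (Suc m) powr (- 3 / 2)" for m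
    proof -
      have "norm (eta_term (Suc m) s) \<le> norm s * norm (s + 1) * real (Suc m) powr (- Re s - 2)"
        using s by (intro norm_eta_term_Suc_le) auto
      also have "\<dots> \<le> norm s * norm (s + 1) * real (Suc m) powr (- 3 / 2)"
      proof (intro mult_left_mono powr_mono)
        show "- Re s - 2 \<le> - 3 / 2" using s by (simp add: field_simps)
      qed auto
      finally show ?thesis .
    qed
    have sm: "summable (\<lambda>m. norm s * norm (s + 1) * real (Suc m) powr (- 3 / 2))"
      by (intro summable_mult sZ)
    have "norm (\<Sum>m. eta_term (Suc m) s) \<le> (\<Sum>m. norm s * norm (s + 1) * real (Suc m) powr (- 3 / 2))"
      by (rule norm_suminf_le) (use n sm in auto)
    also have "\<dots> = norm s * norm (s + 1) * Z"
      unfolding Z_def by (rule suminf_mult[OF sZ])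
    also have "\<dots> \<le> (1 + norm s) * (1 + norm s) * Z"
      using norm_triangle_ineq[of s 1] Z0 by (intro mult_right_mono mult_mono) (auto simp: add_ac)
    finally have 1: "norm (\<Sum>m. eta_term (Suc m) s) \<le> (1 + norm s) ^ 2 * Z"
      by (simp add: power2_eq_square)
    have "norm (eta_term 0 s) = norm (2 powr (- s) - 2 :: complex)"
      by (simp add: eta_term_def)
    also have "\<dots> \<le> norm (2 powr (- s) :: complex) + 2"
      using norm_triangle_ineq4[of "2 powr (- s) :: complex" 2] by simp
    also have "norm (2 powr (- s) :: complex) = 2 powr (- Re s)"
      using norm_of_nat_powr[of 2 "- s"] by simp
    also have "2 powr (- Re s) \<le> 2 powr 1"
      using s by (intro powr_mono) auto
    finally have "norm (eta_term 0 s) \<le> 4" by simp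
    also have "4 \<le> 4 * (1 + norm s) ^ 2"
      using one_le_power[of "1 + norm s" 2] by simp
    finally have 2: "norm (eta_term 0 s) \<le> 4 * (1 + norm s) ^ 2" .
    have "norm (eta s) = norm (eta_term 0 s + (\<Sum>m. eta_term (Suc m) s)) / 2"
    proof -
      have "eta s = - (eta_term 0 s + (\<Sum>m. eta_term (Suc m) s)) / 2"
        using s by (simp add: eta_eq_entire eta_entire_def eta_ser_def)
      then show ?thesis by (simp only: norm_divide norm_minus_cancel) simp
    qed
    also have "\<dots> \<le> (norm (eta_term 0 s) + norm (\<Sum>m. eta_term (Suc m) s)) / 2"
      by (intro divide_right_mono norm_triangle_ineq) auto
    also have "\<dots> \<le> (4 * (1 + norm s) ^ 2 + (1 + norm s) ^ 2 * Z) / 1"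
      using 1 2 Z0 by (intro frac_le add_mono) auto
    finally show ?thesis by (simp add: algebra_simps)
  qed
  moreover have "4 + Z > 0" using Z0 by simp
  ultimately show ?thesis using that by blast
qed

section \<open>The Gamma function in the right half plane\<close>

text \<open>In the product formula for \<open>Gamma\<close> the ratio becomes a product of factors
  \<open>(a + k) / sqrt ((a + k)^2 + t^2)\<close>, each increasing in \<open>a\<close>. This
  transports estimates from the line \<open>Re w = 1\<close> into the half plane and replaces
  Stirling's formula.\<close>

lemma norm_Gamma_ratio_mono:
  fixes x y t :: real
  assumes "0 < x" "x \<le> y"
  shows "norm (Gamma (Complex x t)) / Gamma x \<le> norm (Gamma (Complex y t)) / Gamma y"
proof (rule LIMSEQ_le)
  have lim: "(\<lambda>n. norm (Gamma_series (Complex a t) n) / Gamma_series a n) \<longlonglongrightarrow> norm (Gamma (Complex a t)) / Gamma a" if "a > 0" for a :: real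
  proof -
    have "Gamma a > 0" using that by simp
    then have "Gamma a \<noteq> 0" by linarith
    then show ?thesis by (intro tendsto_intros)
  qed
  show "(\<lambda>n. norm (Gamma_series (Complex x t) n) / Gamma_series x n) \<longlonglongrightarrow> norm (Gamma (Complex x t)) / Gamma x"
       "(\<lambda>n. norm (Gamma_series (Complex y t) n) / Gamma_series y n) \<longlonglongrightarrow> norm (Gamma (Complex y t)) / Gamma y"
    using assms by (auto intro!: lim)
  have eq: "norm (Gamma_series (Complex a t) n) / Gamma_series a n = (\<Prod>k=0..<Suc n. (a + real k) / sqrt ((a + real k)\<^sup>2 + t\<^sup>2))" if "a > 0" for a n
  proof -
    have "norm (pochhammer (Complex a t) (Suc n)) = (\<Prod>k=0..<Suc n. sqrt ((a + real k)\<^sup>2 + t\<^sup>2))"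
      unfolding pochhammer_prod prod_norm[symmetric] by (intro prod.cong refl) (simp add: cmod_def)
    moreover have "pochhammer a (Suc n) = (\<Prod>k=0..<Suc n. a + real k)"
      unfolding pochhammer_prod by simp
    moreover have "norm (exp (Complex a t * of_real (ln (real n)))) = exp (a * ln (real n))"
      by simp
    ultimately show ?thesis
      using that by (simp add: Gamma_series_def norm_mult norm_divide prod_dividef del: prod.op_ivl_Suc)
  qed
  show "\<exists>N. \<forall>n\<ge>N. norm (Gamma_series (Complex x t) n) / Gamma_series x n \<le> norm (Gamma_series (Complex y t) n) / Gamma_series y n"
  proof (intro exI allI impI)
    fix n :: nat
    have "(x + real k) / sqrt ((x + real k)\<^sup>2 + t\<^sup>2) \<le> (y + real k) / sqrt ((y + real k)\<^sup>2 + t\<^sup>2)" for k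
    proof -
      define u v where "u = x + real k" and "v = y + real k"
      have uv: "0 < u" "u \<le> v" using assms by (auto simp: u_def v_def)
      have "u\<^sup>2 * (v\<^sup>2 + t\<^sup>2) \<le> v\<^sup>2 * (u\<^sup>2 + t\<^sup>2)"
      proof -
        have "u\<^sup>2 \<le> v\<^sup>2" using uv by (intro power_mono) auto
        then have "u\<^sup>2 * t\<^sup>2 \<le> v\<^sup>2 * t\<^sup>2" by (rule mult_right_mono) auto
        then show ?thesis by (simp add: algebra_simps)
      qed
      then have "sqrt (u\<^sup>2 * (v\<^sup>2 + t\<^sup>2)) \<le> sqrt (v\<^sup>2 * (u\<^sup>2 + t\<^sup>2))" by simp
      then have "u * sqrt (v\<^sup>2 + t\<^sup>2) \<le> v * sqrt (u\<^sup>2 + t\<^sup>2)"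
        using uv by (simp add: real_sqrt_mult)
      moreover have "sqrt (u\<^sup>2 + t\<^sup>2) > 0" "sqrt (v\<^sup>2 + t\<^sup>2) > 0"
        using uv by (auto intro!: add_pos_nonneg)
      ultimately have "u / sqrt (u\<^sup>2 + t\<^sup>2) \<le> v / sqrt (v\<^sup>2 + t\<^sup>2)"
        by (simp add: divide_le_eq pos_le_divide_eq mult.commute)
      then show ?thesis by (simp add: u_def v_def)
    qed
    then show "norm (Gamma_series (Complex x t) n) / Gamma_series x n \<le> norm (Gamma_series (Complex y t) n) / Gamma_series y n"
      using assms by (subst (1 2) eq) (auto intro!: prod_mono divide_nonneg_nonneg simp del: prod.op_ivl_Suc)
  qed
qed

text \<open>With \<open>z = \<i> * t\<close> the squared norm is
  \<open>Gamma (1 + z) * Gamma (1 - z)\<close>, the two factors being conjugate, and reflection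
  evaluates it.\<close>

lemma norm_Gamma_1_plus_imag:
  fixes t :: real
  assumes "t > 0"
  shows "(norm (Gamma (Complex 1 t)))\<^sup>2 = pi * t / sinh (pi * t)"
proof -
  define z where "z = \<i> * complex_of_real t"
  have z: "z \<notin> \<int>\<^sub>\<le>\<^sub>0" using assms by (auto simp: z_def complex_eq_iff elim!: nonpos_Ints_cases)
  have "complex_of_real ((norm (Gamma (Complex 1 t)))\<^sup>2) = Gamma (Complex 1 t) * cnj (Gamma (Complex 1 t))"
    by (rule complex_norm_square)
  also have "cnj (Gamma (Complex 1 t)) = Gamma (1 - z)"
  proof -
    have "cnj (Complex 1 t) = 1 - z" by (simp add: z_def complex_eq_iff)
    then show ?thesis by (simp only: cnj_Gamma)
  qed
  also have G1: "Gamma (Complex 1 t) = z * Gamma z"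
  proof -
    have "Complex 1 t = z + 1" by (simp add: z_def complex_eq_iff)
    then show ?thesis using Gamma_plus1[OF z] by simp
  qed
  also have "z * Gamma z * Gamma (1 - z) = z * (of_real pi / sin (of_real pi * z))"
    using Gamma_reflection_complex[of z] by (simp add: mult.assoc)
  also have "sin (of_real pi * z) = \<i> * of_real (sinh (pi * t))"
    by (simp add: z_def complex_eq_iff Re_sin Im_sin sinh_field_def)
  also have "z * (of_real pi / (\<i> * of_real (sinh (pi * t)))) = of_real (pi * t / sinh (pi * t))"
    using assms by (simp add: z_def)
  finally show ?thesis by (simp only: of_real_eq_iff G1)
qed

text \<open>For \<open>t > 0\<close> and \<open>x = pi * t\<close> the square of the product is
  exactly \<open>2 * x / (1 - exp (- 2 * x))\<close>, which lies between \<open>1\<close> and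
  \<open>1 + 2 * x\<close>. Negative \<open>t\<close> follows by conjugation; the constant
  \<open>8\<close> is generous.\<close>

lemma norm_Gamma_1_plus_imag_bounds:
  fixes t :: real
  shows "1 \<le> norm (Gamma (Complex 1 t)) * exp (pi * \<bar>t\<bar> / 2)"
    and "norm (Gamma (Complex 1 t)) * exp (pi * \<bar>t\<bar> / 2) \<le> 8 * (1 + \<bar>t\<bar>)"
proof -
  have pos: "1 \<le> (norm (Gamma (Complex 1 t)) * exp (pi * t / 2))\<^sup>2 \<and> (norm (Gamma (Complex 1 t)) * exp (pi * t / 2))\<^sup>2 \<le> (8 * (1 + t))\<^sup>2" if t: "t > 0" for t
  proof -
    define x where "x = pi * t"
    have x: "x > 0" using t by (simp add: x_def)
    have "(norm (Gamma (Complex 1 t)) * exp (pi * t / 2))\<^sup>2 = x / sinh x * exp x"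
      using norm_Gamma_1_plus_imag[OF t] by (simp add: power_mult_distrib x_def power2_eq_square[of "exp _"] exp_add[symmetric])
    also have "\<dots> = 2 * x / (1 - exp (- 2 * x))"
    proof -
      have "1 - exp (- 2 * x) > 0" using x by simp
      have "sinh x = exp x * (1 - exp (- 2 * x)) / 2"
        by (simp add: sinh_field_def right_diff_distrib exp_add[symmetric])
      then have "x / sinh x * exp x = x / (exp x * (1 - exp (- 2 * x)) / 2) * exp x" by (simp only:)
      moreover have "x / (e * q / 2) * e = 2 * x / q" if "e > 0" "q > 0" for e q :: real
        using that by simp
      from this[of "exp x" "1 - exp (- 2 * x)"] have "x / (exp x * (1 - exp (- 2 * x)) / 2) * exp x = 2 * x / (1 - exp (- 2 * x))"
        using \<open>1 - exp (- 2 * x) > 0\<close> by simp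
      ultimately show ?thesis by (simp only:)
    qed
    finally have eq: "(norm (Gamma (Complex 1 t)) * exp (pi * t / 2))\<^sup>2 = 2 * x / (1 - exp (- 2 * x))" .
    have p: "1 - exp (- 2 * x) > 0" using x by simp
    have "1 - exp (- 2 * x) \<le> 2 * x" using exp_ge_add_one_self[of "- 2 * x"] by simp
    then have 1: "1 \<le> 2 * x / (1 - exp (- 2 * x))" using p by simp
    have "2 * x / (1 - exp (- 2 * x)) \<le> 1 + 2 * x"
    proof -
      have "(1 + 2 * x) * exp (- 2 * x) \<le> exp (2 * x) * exp (- 2 * x)"
        using exp_ge_add_one_self[of "2 * x"] by (intro mult_right_mono) auto
      also have "\<dots> = 1" by (simp add: exp_add[symmetric])
      finally have "(1 + 2 * x) * exp (- 2 * x) \<le> 1" .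
      then have "2 * x \<le> (1 + 2 * x) * (1 - exp (- 2 * x))" by (simp add: algebra_simps)
      then show ?thesis using p by (simp add: pos_divide_le_eq)
    qed
    also have "\<dots> \<le> (8 * (1 + t))\<^sup>2"
    proof -
      have "x \<le> 4 * t" using pi_less_4 t by (simp add: x_def)
      then have "1 + 2 * x \<le> 64 * 1 + 128 * t" using t by simp
      also have "\<dots> \<le> (8 * (1 + t))\<^sup>2" by (simp add: power2_eq_square algebra_simps)
      finally show ?thesis .
    qed
    finally show ?thesis using eq 1 by simp
  qed
  have pos': "1 \<le> norm (Gamma (Complex 1 t)) * exp (pi * t / 2) \<and> norm (Gamma (Complex 1 t)) * exp (pi * t / 2) \<le> 8 * (1 + t)" if t: "t > 0" for t
    using pos[OF t] t power2_le_imp_le[of 1 "norm (Gamma (Complex 1 t)) * exp (pi * t / 2)"]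
      power2_le_imp_le[of "norm (Gamma (Complex 1 t)) * exp (pi * t / 2)" "8 * (1 + t)"] by simp
  have cnj: "norm (Gamma (Complex 1 (- t))) = norm (Gamma (Complex 1 t))" for t
  proof -
    have "Complex 1 (- t) = cnj (Complex 1 t)" by (simp add: complex_eq_iff)
    then show ?thesis by (simp only: cnj_Gamma[symmetric] complex_mod_cnj)
  qed
  consider "t > 0" | "t < 0" | "t = 0" by linarith
  then have "1 \<le> norm (Gamma (Complex 1 t)) * exp (pi * \<bar>t\<bar> / 2) \<and> norm (Gamma (Complex 1 t)) * exp (pi * \<bar>t\<bar> / 2) \<le> 8 * (1 + \<bar>t\<bar>)"
  proof cases
    case 1 then show ?thesis using pos'[of t] by simp
  next
    case 2 then show ?thesis using pos'[of "- t"] cnj[of t] by simp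
  next
    case 3
    have "Complex 1 0 = 1" by (simp add: complex_eq_iff)
    then show ?thesis using 3 by simp
  qed
  then show "1 \<le> norm (Gamma (Complex 1 t)) * exp (pi * \<bar>t\<bar> / 2)"
    "norm (Gamma (Complex 1 t)) * exp (pi * \<bar>t\<bar> / 2) \<le> 8 * (1 + \<bar>t\<bar>)" by auto
qed

lemma norm_Gamma_lower:
  assumes "Re w \<ge> 1"
  shows "Gamma (Re w) \<le> norm (Gamma w) * exp (pi * \<bar>Im w\<bar> / 2)"
proof -
  have w: "Complex (Re w) (Im w) = w" by (simp add: complex_eq_iff)
  have g: "Gamma (Re w) > 0" using assms by (intro Gamma_real_pos) auto
  have "1 \<le> norm (Gamma (Complex 1 (Im w))) * exp (pi * \<bar>Im w\<bar> / 2)"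
    by (rule norm_Gamma_1_plus_imag_bounds)
  also have "norm (Gamma (Complex 1 (Im w))) \<le> norm (Gamma w) / Gamma (Re w)"
    using norm_Gamma_ratio_mono[of 1 "Re w" "Im w"] assms by (simp add: w)
  finally have "1 \<le> norm (Gamma w) / Gamma (Re w) * exp (pi * \<bar>Im w\<bar> / 2)"
    by simp
  then show ?thesis using g by (simp add: field_simps)
qed

text \<open>Monotonicity in the real part reduces to \<open>Re w = m + 1\<close>; from there a
  Pochhammer product of \<open>m\<close> factors, each at most a constant times
  \<open>1 + \<bar>Im w\<bar>\<close>, leads back to the line \<open>Re w = 1\<close>.\<close>

lemma norm_Gamma_upper:
  fixes m :: nat
  obtains C where "C > 0" "\<And>w. 1 \<le> Re w \<Longrightarrow> Re w \<le> real m + 1 \<Longrightarrow>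
     norm (Gamma w) * exp (pi * \<bar>Im w\<bar> / 2) \<le> C * (1 + \<bar>Im w\<bar>) ^ (m + 1)"
proof -
  have "continuous_on {1..real m + 1} (Gamma :: real \<Rightarrow> real)"
    by (intro continuous_on_Gamma) (auto elim!: nonpos_Ints_cases)
  then have "compact (Gamma ` {1..real m + 1})"
    by (rule compact_continuous_image) auto
  then obtain B where "\<And>x. x \<in> Gamma ` {1..real m + 1} \<Longrightarrow> norm x \<le> B"
    using compact_imp_bounded bounded_iff by metis
  then have B: "Gamma x \<le> B" if "1 \<le> x" "x \<le> real m + 1" for x
    using that by (metis abs_le_D1 atLeastAtMost_iff imageI real_norm_def)
  have B1: "B \<ge> 1" using B[of 1] by simp
  have "norm (Gamma w) * exp (pi * \<bar>Im w\<bar> / 2) \<le> (B * (real m + 1) ^ m * 8) * (1 + \<bar>Im w\<bar>) ^ (m + 1)"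
    if w: "1 \<le> Re w" "Re w \<le> real m + 1" for w
  proof -
    define t where "t = Im w"
    have wc: "Complex (Re w) t = w" by (simp add: complex_eq_iff t_def)
    have g: "Gamma (Re w) > 0" using w by (intro Gamma_real_pos) auto
    have gm: "Gamma (real m + 1) \<ge> 1" using Gamma_fact[of m, where 'a = real] by (simp add: add_ac fact_ge_1)
    have "norm (Gamma w) / Gamma (Re w) \<le> norm (Gamma (Complex (real m + 1) t)) / Gamma (real m + 1)"
      using norm_Gamma_ratio_mono[of "Re w" "real m + 1" t] w by (simp add: wc)
    also have "\<dots> \<le> norm (Gamma (Complex (real m + 1) t)) / 1"
      using gm by (intro divide_left_mono) auto
    finally have "norm (Gamma w) \<le> norm (Gamma (Complex (real m + 1) t)) * Gamma (Re w)"
      using g by (simp add: field_simps)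
    also have "\<dots> \<le> norm (Gamma (Complex (real m + 1) t)) * B"
      using B w by (intro mult_left_mono) auto
    also have "Complex (real m + 1) t = Complex 1 t + of_nat m" by (simp add: complex_eq_iff)
    also have "Gamma (Complex 1 t + of_nat m) = pochhammer (Complex 1 t) m * Gamma (Complex 1 t)"
    proof -
      have n: "Complex 1 t \<notin> \<int>\<^sub>\<le>\<^sub>0" by (auto elim!: nonpos_Ints_cases simp: complex_eq_iff)
      then have "Gamma (Complex 1 t) \<noteq> 0" by (simp add: Gamma_eq_zero_iff)
      then show ?thesis using pochhammer_Gamma[OF n, of m] by simp
    qed
    finally have 1: "norm (Gamma w) \<le> norm (pochhammer (Complex 1 t) m) * norm (Gamma (Complex 1 t)) * B"
      by (simp add: norm_mult)
    have "norm (pochhammer (Complex 1 t) m) \<le> ((real m + 1) * (1 + \<bar>t\<bar>)) ^ m"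
    proof -
      have "norm (pochhammer (Complex 1 t) m) = (\<Prod>k=0..<m. norm (Complex 1 t + of_nat k))"
        unfolding pochhammer_prod prod_norm[symmetric] ..
      also have "\<dots> \<le> (\<Prod>k=0..<m. (real m + 1) * (1 + \<bar>t\<bar>))"
      proof (intro prod_mono conjI)
        fix k assume "k \<in> {0..<m}"
        then have k: "real k + 1 \<le> real m + 1" by simp
        have "norm (Complex 1 t + of_nat k) \<le> \<bar>1 + real k\<bar> + \<bar>t\<bar>"
          using cmod_le[of "Complex 1 t + of_nat k"] by simp
        also have "\<dots> \<le> (real m + 1) + (real m + 1) * \<bar>t\<bar>"
          using k by (intro add_mono) (auto simp: mult_le_cancel_right1 algebra_simps)
        finally show "norm (Complex 1 t + of_nat k) \<le> (real m + 1) * (1 + \<bar>t\<bar>)"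
          by (simp add: algebra_simps)
      qed auto
      finally show ?thesis by simp
    qed
    note 2 = this norm_Gamma_1_plus_imag_bounds(2)[of t]
    have "norm (Gamma w) * exp (pi * \<bar>t\<bar> / 2) \<le> norm (pochhammer (Complex 1 t) m) * (norm (Gamma (Complex 1 t)) * exp (pi * \<bar>t\<bar> / 2)) * B"
      using mult_right_mono[OF 1, of "exp (pi * \<bar>t\<bar> / 2)"] by (simp add: mult_ac)
    also have "\<dots> \<le> ((real m + 1) * (1 + \<bar>t\<bar>)) ^ m * (8 * (1 + \<bar>t\<bar>)) * B"
    proof (rule mult_right_mono)
      show "norm (pochhammer (Complex 1 t) m) * (norm (Gamma (Complex 1 t)) * exp (pi * \<bar>t\<bar> / 2)) \<le> ((real m + 1) * (1 + \<bar>t\<bar>)) ^ m * (8 * (1 + \<bar>t\<bar>))"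
        by (rule mult_mono[OF 2]) auto
    qed (use B1 in auto)
    also have "\<dots> = (B * (real m + 1) ^ m * 8) * (1 + \<bar>t\<bar>) ^ (m + 1)"
      by (simp add: power_mult_distrib)
    finally show ?thesis by (simp add: t_def)
  qed
  moreover have "B * (real m + 1) ^ m * 8 > 0" using B1 by simp
  ultimately show ?thesis using that by blast
qed

text \<open>The limit formulas are compared term by term: the real part of
  \<open>inverse (w + n)\<close> is at most \<open>inverse (Re w + n)\<close>. Hence growth along
  the real axis holds uniformly in \<open>Im w\<close>.\<close>

lemma Digamma_Re_ge:
  assumes "Re w > 0"
  shows "Digamma (Re w) \<le> Re (Digamma w)"
proof (rule LIMSEQ_le)
  have "Re w \<noteq> 0" "w \<noteq> 0" using assms by auto
  show "(\<lambda>m. of_real (ln (real m)) - (\<Sum>n<m. inverse (Re w + of_nat n))) \<longlonglongrightarrow> Digamma (Re w)"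
    by (rule Digamma_LIMSEQ) fact
  show "(\<lambda>m. Re (of_real (ln (real m)) - (\<Sum>n<m. inverse (w + of_nat n)))) \<longlonglongrightarrow> Re (Digamma w)"
    by (intro tendsto_Re Digamma_LIMSEQ) fact
  have "Re (inverse (w + of_nat n)) \<le> inverse (Re w + real n)" for n
  proof -
    define u where "u = Re w + real n"
    have u: "u > 0" using assms by (simp add: u_def)
    have "Re (inverse (w + of_nat n)) = u / (u\<^sup>2 + (Im w)\<^sup>2)" by (simp add: u_def)
    also have "\<dots> \<le> u / u\<^sup>2" using u by (intro divide_left_mono mult_pos_pos add_pos_nonneg) auto
    also have "\<dots> = inverse u" using u by (simp add: power2_eq_square divide_inverse)
    finally show ?thesis by (simp add: u_def)
  qed
  then have "(\<Sum>n<m. Re (inverse (w + of_nat n))) \<le> (\<Sum>n<m. inverse (Re w + real n))" for m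
    by (rule sum_mono)
  then show "\<exists>N. \<forall>n\<ge>N. of_real (ln (real n)) - (\<Sum>n<n. inverse (Re w + of_nat n)) \<le> Re (of_real (ln (real n)) - (\<Sum>n<n. inverse (w + of_nat n)))"
    by (auto simp del: inverse_complex.sel)
qed

lemma Digamma_real_ge:
  fixes M :: real
  obtains a where "a \<ge> 1" "\<And>x. x \<ge> a \<Longrightarrow> Digamma (x :: real) \<ge> M"
proof -
  have "filterlim (\<lambda>n. harm n :: real) at_top sequentially" by (rule harm_at_top)
  then have "eventually (\<lambda>n. harm n \<ge> M + euler_mascheroni) sequentially"
    by (auto simp: filterlim_at_top)
  then obtain n where n: "harm n \<ge> M + euler_mascheroni" by (auto simp: eventually_sequentially)
  show ?thesis
  proof (rule that)
    show "real (Suc n) \<ge> 1" by simp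
    fix x assume "x \<ge> real (Suc n)"
    then have "Digamma (real (Suc n)) \<le> Digamma x" by (intro Digamma_real_mono) auto
    moreover have "Digamma (real (Suc n)) = harm n - euler_mascheroni"
      using Digamma_of_nat[of n, where 'a = real] by simp
    ultimately show "M \<le> Digamma x" using n by simp
  qed
qed

lemma Digamma_complex_ge:
  fixes M :: real
  obtains a where "a \<ge> 1" "\<And>w. Re w \<ge> a \<Longrightarrow> Re (Digamma w) \<ge> M"
proof -
  obtain a where a: "a \<ge> 1" "\<And>x. x \<ge> a \<Longrightarrow> Digamma (x :: real) \<ge> M" using Digamma_real_ge[of M] by blast
  have "Re (Digamma w) \<ge> M" if "Re w \<ge> a" for w
    using a(2)[OF that] Digamma_Re_ge[of w] a(1) that by linarith
  then show ?thesis using that a by blast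
qed

lemma norm_trigamma_le:
  obtains C :: real where "C > 0" "\<And>w :: complex. Re w \<ge> 1 \<Longrightarrow> norm (Polygamma 1 w) \<le> C"
proof -
  have sm: "(\<lambda>k. 1 / (real k + 1)\<^sup>2) sums (pi\<^sup>2 / 6)" using inverse_squares_sums by (simp add: add_ac)
  then have s: "summable (\<lambda>k. 1 / (real k + 1)\<^sup>2)" by (rule sums_summable)
  have "norm (Polygamma 1 w) \<le> pi\<^sup>2 / 6" if "Re w \<ge> 1" for w :: complex
  proof -
    have "norm (\<Sum>k. inverse ((w + of_nat k) ^ 2)) \<le> (\<Sum>k. 1 / (real k + 1)\<^sup>2)"
    proof (rule norm_suminf_le[OF _ s])
      fix k
      have "real k + 1 \<le> Re (w + of_nat k)" using that by simp
      also have "\<dots> \<le> norm (w + of_nat k)" by (rule complex_Re_le_cmod)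
      finally have "inverse (norm (w + of_nat k) ^ 2) \<le> inverse ((real k + 1) ^ 2)"
        by (intro le_imp_inverse_le power_mono) auto
      then show "norm (inverse ((w + of_nat k) ^ 2)) \<le> 1 / (real k + 1)\<^sup>2"
        by (simp add: norm_inverse norm_power divide_inverse)
    qed
    then show ?thesis using sums_unique[OF sm] by (simp add: Polygamma_def numeral_2_eq_2)
  qed
  then show ?thesis using that[of "pi\<^sup>2 / 6"] by simp
qed

text \<open>Once \<open>Digamma\<close> exceeds \<open>ln b + 1\<close>, the function
  \<open>ln_Gamma x - x * ln b - x\<close> no longer decreases, so \<open>Gamma x\<close> outgrows
  \<open>b powr x\<close> at least by a factor of order \<open>exp x\<close>.\<close>

lemma Gamma_real_superexponential:
  fixes b :: real
  assumes "b > 0"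
  obtains a where "a \<ge> 1" "\<And>x. x \<ge> a \<Longrightarrow> Gamma x \<ge> M * b powr x"
proof -
  obtain a0 where a0: "a0 \<ge> 1" "\<And>x. x \<ge> a0 \<Longrightarrow> Digamma (x :: real) \<ge> ln b + 1"
    using Digamma_real_ge[of "ln b + 1"] by blast
  define f where "f = (\<lambda>x. ln_Gamma x - x * ln b - x)"
  have mono: "f a0 \<le> f x" if "x \<ge> a0" for x
  proof (rule DERIV_nonneg_imp_nondecreasing[OF that])
    fix y assume "a0 \<le> y" "y \<le> x"
    then have "(f has_real_derivative (Digamma y - ln b - 1)) (at y)" "Digamma y - ln b - 1 \<ge> 0"
      using a0(1) a0(2)[of y] by (auto simp: f_def intro!: derivative_eq_intros)
    then show "\<exists>d. (f has_real_derivative d) (at y) \<and> 0 \<le> d" by blast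
  qed
  define a where "a = max a0 (ln (\<bar>M\<bar> + 1) - f a0)"
  have "Gamma x \<ge> M * b powr x" if "x \<ge> a" for x
  proof -
    have x: "x \<ge> a0" "x \<ge> ln (\<bar>M\<bar> + 1) - f a0" using that by (auto simp: a_def)
    have "ln (\<bar>M\<bar> + 1) + x * ln b \<le> ln_Gamma x"
      using mono[OF x(1)] x(2) by (simp add: f_def)
    then have "exp (ln (\<bar>M\<bar> + 1) + x * ln b) \<le> exp (ln_Gamma x)" by simp
    also have "exp (ln_Gamma x) = Gamma x" using x a0 by (subst Gamma_real_pos_exp) auto
    also have "exp (ln (\<bar>M\<bar> + 1) + x * ln b) = (\<bar>M\<bar> + 1) * b powr x"
      using assms by (simp add: exp_add powr_def)
    finally have "(\<bar>M\<bar> + 1) * b powr x \<le> Gamma x" .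
    moreover have "M * b powr x \<le> (\<bar>M\<bar> + 1) * b powr x" by (intro mult_right_mono) auto
    ultimately show ?thesis by linarith
  qed
  moreover have "a \<ge> 1" using a0 by (simp add: a_def)
  ultimately show ?thesis using that by blast
qed

section \<open>Variation of the argument\<close>

text \<open>
  Near the segment, \<open>L\<close> is a primitive of the logarithmic derivative of \<open>f\<close>, so the bound is one on the
  imaginary part of its integral along the segment.
\<close>
definition arg_variation_le :: "(complex \<Rightarrow> complex) \<Rightarrow> complex \<Rightarrow> complex \<Rightarrow> real \<Rightarrow> bool" where
  "arg_variation_le f a b B \<longleftrightarrow> (\<exists>U L c. open U \<and> closed_segment a b \<subseteq> U \<and> L holomorphic_on U \<and> c \<noteq> 0 \<and>
     (\<forall>z\<in>U. f z = c * exp (L z)) \<and> \<bar>Im (L b - L a)\<bar> \<le> B)"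

lemma arg_variation_leI:
  assumes "open U" "closed_segment a b \<subseteq> U" "L holomorphic_on U" "c \<noteq> 0"
    "\<And>z. z \<in> U \<Longrightarrow> f z = c * exp (L z)" "\<bar>Im (L b - L a)\<bar> \<le> B"
  shows "arg_variation_le f a b B"
  using assms unfolding arg_variation_le_def by blast

lemma arg_variation_le_mono:
  "arg_variation_le f a b B \<Longrightarrow> B \<le> C \<Longrightarrow> arg_variation_le f a b C"
  unfolding arg_variation_le_def by (meson order_trans)

lemma arg_variation_le_cong:
  assumes "arg_variation_le g a b B" "open V" "closed_segment a b \<subseteq> V" "\<And>z. z \<in> V \<Longrightarrow> f z = g z"
  shows "arg_variation_le f a b B"
proof -
  obtain U L c where "open U" "closed_segment a b \<subseteq> U" "L holomorphic_on U" "c \<noteq> 0"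
    "\<And>z. z \<in> U \<Longrightarrow> g z = c * exp (L z)" "\<bar>Im (L b - L a)\<bar> \<le> B"
    using assms(1) unfolding arg_variation_le_def by blast
  then show ?thesis using assms
    by (intro arg_variation_leI[of "U \<inter> V" a b L c]) (auto intro: holomorphic_on_subset)
qed

lemma arg_variation_le_const: "k \<noteq> 0 \<Longrightarrow> arg_variation_le (\<lambda>z. k) a b 0"
  by (rule arg_variation_leI[of UNIV _ _ "\<lambda>_. 0" k]) auto

lemma arg_variation_le_mult:
  assumes "arg_variation_le f a b B" "arg_variation_le g a b C"
  shows "arg_variation_le (\<lambda>z. f z * g z) a b (B + C)"
proof -
  obtain U L c where 1: "open U" "closed_segment a b \<subseteq> U" "L holomorphic_on U" "c \<noteq> 0"
    "\<And>z. z \<in> U \<Longrightarrow> f z = c * exp (L z)" "\<bar>Im (L b - L a)\<bar> \<le> B"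
    using assms(1) unfolding arg_variation_le_def by blast
  obtain U' L' c' where 2: "open U'" "closed_segment a b \<subseteq> U'" "L' holomorphic_on U'" "c' \<noteq> 0"
    "\<And>z. z \<in> U' \<Longrightarrow> g z = c' * exp (L' z)" "\<bar>Im (L' b - L' a)\<bar> \<le> C"
    using assms(2) unfolding arg_variation_le_def by blast
  show ?thesis
  proof (rule arg_variation_leI[of "U \<inter> U'" a b "\<lambda>z. L z + L' z" "c * c'"])
    show "(\<lambda>z. L z + L' z) holomorphic_on (U \<inter> U')"
      using 1 2 by (intro holomorphic_on_add) (auto intro: holomorphic_on_subset)
    show "\<bar>Im (L b + L' b - (L a + L' a))\<bar> \<le> B + C"
      using 1(6) 2(6) by simp
    show "f z * g z = c * c' * exp (L z + L' z)" if "z \<in> U \<inter> U'" for z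
      using 1(5)[of z] 2(5)[of z] that by (simp add: exp_add)
  qed (use 1 2 in auto)
qed

lemma arg_variation_le_inverse:
  assumes "arg_variation_le f a b B"
  shows "arg_variation_le (\<lambda>z. inverse (f z)) a b B"
proof -
  obtain U L c where 1: "open U" "closed_segment a b \<subseteq> U" "L holomorphic_on U" "c \<noteq> 0"
    "\<And>z. z \<in> U \<Longrightarrow> f z = c * exp (L z)" "\<bar>Im (L b - L a)\<bar> \<le> B"
    using assms(1) unfolding arg_variation_le_def by blast
  show ?thesis
    by (rule arg_variation_leI[of U a b "\<lambda>z. - L z" "inverse c"])
       (use 1 in \<open>auto intro: holomorphic_intros simp: exp_minus\<close>)
qed

lemma arg_variation_le_power:
  assumes "arg_variation_le f a b B"
  shows "arg_variation_le (\<lambda>z. f z ^ n) a b (real n * B)"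
proof (induction n)
  case 0
  show ?case using arg_variation_le_const[of 1] by simp
next
  case (Suc n)
  show ?case using arg_variation_le_mult[OF assms Suc] by (simp add: algebra_simps)
qed

lemma arg_variation_le_prod:
  assumes "finite A" "\<And>x. x \<in> A \<Longrightarrow> arg_variation_le (f x) a b (B x)"
  shows "arg_variation_le (\<lambda>z. \<Prod>x\<in>A. f x z) a b (\<Sum>x\<in>A. B x)"
  using assms
proof (induction A rule: finite_induct)
  case empty
  show ?case using arg_variation_le_const[of 1] by simp
next
  case (insert x A)
  then show ?case using arg_variation_le_mult[of "f x" a b "B x" "\<lambda>z. \<Prod>x\<in>A. f x z" "\<Sum>x\<in>A. B x"] by simp
qed

text \<open>After rotation by \<open>c\<close> the values stay in the right half plane near the
  segment, where the principal logarithm is holomorphic and its imaginary part lies within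
  \<open>pi / 2\<close> of \<open>0\<close>.\<close>

lemma arg_variation_le_halfplane:
  assumes "open S" "closed_segment a b \<subseteq> S" "f holomorphic_on S" "c \<noteq> 0"
    and pos: "\<And>z. z \<in> closed_segment a b \<Longrightarrow> Re (c * f z) > 0"
  shows "arg_variation_le f a b pi"
proof -
  define U where "U = S \<inter> (\<lambda>z. c * f z) -` {w. Re w > 0}"
  have "continuous_on S (\<lambda>z. c * f z)"
    using assms by (intro holomorphic_on_imp_continuous_on holomorphic_intros)
  then have op: "open U" unfolding U_def
    using assms by (intro continuous_open_preimage open_halfspace_Re_gt)
  have U: "z \<in> S" "Re (c * f z) > 0" if "z \<in> U" for z using that by (auto simp: U_def)
  have nz: "c * f z \<notin> \<real>\<^sub>\<le>\<^sub>0" if "z \<in> U" for z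
    using U[OF that] by (auto simp: complex_nonpos_Reals_iff)
  have seg: "closed_segment a b \<subseteq> U" using assms by (auto simp: U_def)
  have half: "\<bar>Im (Ln (c * f z))\<bar> < pi / 2" if "z \<in> U" for z
  proof -
    have "c * f z \<noteq> 0" using U[OF that] by auto
    then show ?thesis using Re_Ln_pos_lt[of "c * f z"] U[OF that] by auto
  qed
  show ?thesis
  proof (rule arg_variation_leI[of U a b "\<lambda>z. Ln (c * f z)" "inverse c"])
    show "(\<lambda>z. Ln (c * f z)) holomorphic_on U"
      using nz by (intro holomorphic_intros holomorphic_on_subset[OF assms(3)]) (auto simp: U_def)
    show "f z = inverse c * exp (Ln (c * f z))" if "z \<in> U" for z
    proof -
      have "c * f z \<noteq> 0" using U[OF that] by auto
      then show ?thesis using assms(4) by (simp add: exp_Ln)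
    qed
    have "a \<in> U" "b \<in> U" using seg by auto
    then show "\<bar>Im (Ln (c * f b) - Ln (c * f a))\<bar> \<le> pi"
      using half[of a] half[of b] by simp
  qed (use op seg assms in auto)
qed

text \<open>Seen from a point off a horizontal segment, the segment lies in an open half plane; the
  rotation depends on whether the point is below, above, or on the same line to the left or
  right.\<close>

lemma arg_variation_le_linear:
  assumes "Im a = Im b" "p \<notin> closed_segment a b"
  shows "arg_variation_le (\<lambda>z. z - p) a b pi"
proof -
  have seg: "z \<in> closed_segment a b \<longleftrightarrow> Im z = Im a \<and> Re z \<in> closed_segment (Re a) (Re b)" for z
    using closed_segment_same_Im[OF assms(1)] by auto
  have "\<exists>c. c \<noteq> 0 \<and> (\<forall>z\<in>closed_segment a b. Re (c * (z - p)) > 0)"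
  proof -
    consider "Im p < Im a" | "Im p > Im a" | "Im p = Im a" by linarith
    then show ?thesis
    proof cases
      case 1
      then show ?thesis by (intro exI[of _ "- \<i>"]) (auto simp: seg)
    next
      case 2
      then show ?thesis by (intro exI[of _ "\<i>"]) (auto simp: seg)
    next
      case 3
      then have "Re p \<notin> closed_segment (Re a) (Re b)" using assms seg by auto
      then consider "Re p < min (Re a) (Re b)" | "Re p > max (Re a) (Re b)"
        by (auto simp: closed_segment_eq_real_ivl split: if_splits)
      then show ?thesis
      proof cases
        case 1
        then show ?thesis by (intro exI[of _ 1]) (auto simp: seg closed_segment_eq_real_ivl split: if_splits)
      next
        case 2
        then show ?thesis by (intro exI[of _ "- 1"]) (auto simp: seg closed_segment_eq_real_ivl split: if_splits)
      qed
    qed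
  qed
  then obtain c where "c \<noteq> 0" "\<And>z. z \<in> closed_segment a b \<Longrightarrow> Re (c * (z - p)) > 0" by blast
  then show ?thesis
    by (intro arg_variation_le_halfplane[of UNIV _ _ _ c]) (auto intro!: holomorphic_intros)
qed

lemma arg_variation_le_contour_integral:
  assumes "arg_variation_le f a b B"
  shows "(\<lambda>z. deriv f z / f z) contour_integrable_on linepath a b"
    and "\<bar>Im (contour_integral (linepath a b) (\<lambda>z. deriv f z / f z))\<bar> \<le> B"
proof -
  obtain U L c where 1: "open U" "closed_segment a b \<subseteq> U" "L holomorphic_on U" "c \<noteq> 0"
    "\<And>z. z \<in> U \<Longrightarrow> f z = c * exp (L z)" "\<bar>Im (L b - L a)\<bar> \<le> B"
    using assms(1) unfolding arg_variation_le_def by blast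
  have L: "(L has_field_derivative deriv f z / f z) (at z within U)" if "z \<in> U" for z
  proof -
    have dL: "(L has_field_derivative deriv L z) (at z)"
      using 1 that by (auto intro: holomorphic_derivI)
    have "((\<lambda>z. c * exp (L z)) has_field_derivative c * (exp (L z) * deriv L z)) (at z)"
      by (rule DERIV_cmult[OF DERIV_chain'[OF dL DERIV_exp, THEN DERIV_cong]]) simp
    then have "(f has_field_derivative c * (exp (L z) * deriv L z)) (at z)"
      by (rule has_field_derivative_transform_within_open[OF _ 1(1) that]) (use 1 in auto)
    then have "deriv f z = c * (exp (L z) * deriv L z)" by (rule DERIV_imp_deriv)
    then have "deriv f z / f z = deriv L z" using 1(4) 1(5)[OF that] by simp
    then show ?thesis using dL by (simp add: has_field_derivative_at_within)
  qed
  have "((\<lambda>z. deriv f z / f z) has_contour_integral (L (pathfinish (linepath a b)) - L (pathstart (linepath a b)))) (linepath a b)"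
    by (rule contour_integral_primitive[of U]) (use L 1 in auto)
  then have *: "((\<lambda>z. deriv f z / f z) has_contour_integral (L b - L a)) (linepath a b)" by simp
  then show "(\<lambda>z. deriv f z / f z) contour_integrable_on linepath a b"
    by (rule has_contour_integral_integrable)
  from * show "\<bar>Im (contour_integral (linepath a b) (\<lambda>z. deriv f z / f z))\<bar> \<le> B"
    using 1(6) by (simp add: contour_integral_unique)
qed

section \<open>Argument estimates in a disc\<close>

lemma Borel_Caratheodory:
  assumes h: "h holomorphic_on ball z0 R" and h0: "h z0 = 0"
    and A: "\<And>z. z \<in> ball z0 R \<Longrightarrow> Re (h z) < A"
    and r: "r < R" and z: "z \<in> cball z0 r"
  shows "norm (h z) \<le> 2 * A * r / (R - r)"
proof -
  have "dist z0 z \<le> r" using z by simp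
  then have r0: "0 \<le> r" "R > 0" using zero_le_dist[of z0 z] r by linarith+
  have A0: "A > 0" using A[of z0] h0 r0 by simp
  define g where "g = (\<lambda>w. h (z0 + of_real R * w))"
  \<comment> \<open>The Moebius map \<open>u / (2 * A - u)\<close> takes the half plane
    \<open>Re u < A\<close> into the unit disc and fixes \<open>0\<close>, so the Schwarz lemma
    applies to \<open>\<phi>\<close>.\<close>
  define \<phi> where "\<phi> = (\<lambda>w. g w / (2 * of_real A - g w))"
  have inb: "z0 + of_real R * w \<in> ball z0 R" if "norm w < 1" for w
    using that r0 by (simp add: dist_norm norm_mult)
  have g: "g holomorphic_on ball 0 1"
  proof -
    have "(h \<circ> (\<lambda>w. z0 + of_real R * w)) holomorphic_on ball 0 1"
      by (rule holomorphic_on_compose_gen[OF _ h]) (use inb in \<open>auto intro!: holomorphic_intros\<close>)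
    then show ?thesis by (simp add: g_def o_def)
  qed
  have gA: "Re (g w) < A" if "norm w < 1" for w
    using A[OF inb[OF that]] by (simp add: g_def)
  have nz: "2 * of_real A - g w \<noteq> 0" if "norm w < 1" for w
  proof
    assume "2 * of_real A - g w = 0"
    then have "Re (2 * of_real A - g w) = Re 0" by (simp only:)
    then show False using gA[OF that] A0 by simp
  qed
  have less: "norm (g w) < norm (2 * of_real A - g w)" if "norm w < 1" for w
  proof -
    have "(norm (2 * of_real A - g w))\<^sup>2 = (2 * A - Re (g w))\<^sup>2 + (Im (g w))\<^sup>2"
      by (simp add: cmod_power2)
    also have "\<dots> = (norm (g w))\<^sup>2 + 4 * A * (A - Re (g w))"
      unfolding cmod_power2 by (simp add: power2_eq_square algebra_simps)
    finally have "(norm (g w))\<^sup>2 < (norm (2 * of_real A - g w))\<^sup>2"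
      using gA[OF that] A0 by simp
    then show ?thesis by (rule power2_less_imp_less) auto
  qed
  define w where "w = (z - z0) / of_real R"
  have w: "z = z0 + of_real R * w" "norm w \<le> r / R" "norm w < 1"
    using z r r0 by (auto simp: w_def norm_divide dist_norm norm_minus_commute divide_right_mono)
  have "norm (\<phi> w) \<le> norm w"
  proof (rule Schwarz_Lemma(1))
    show "\<phi> holomorphic_on ball 0 1" unfolding \<phi>_def using nz by (intro holomorphic_intros g) auto
    show "\<phi> 0 = 0" by (simp add: \<phi>_def g_def h0)
    show "norm (\<phi> z) < 1" if "norm z < 1" for z
      using less[OF that] nz[OF that] by (simp add: \<phi>_def norm_divide)
  qed fact
  then have "norm (\<phi> w) \<le> r / R" using w by linarith
  then have "norm (g w) \<le> r / R * norm (2 * of_real A - g w)"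
    using nz[OF w(3)] by (simp add: \<phi>_def norm_divide field_simps)
  also have "\<dots> \<le> r / R * (2 * A + norm (g w))"
    using r0 A0 norm_triangle_ineq4[of "2 * of_real A" "g w"]
    by (intro mult_left_mono) (auto simp: norm_mult)
  finally have "R * norm (g w) \<le> r * (2 * A + norm (g w))"
    using r0 by (simp add: field_simps)
  then have "(R - r) * norm (g w) \<le> 2 * A * r" by (simp add: algebra_simps)
  then have "norm (g w) \<le> 2 * A * r / (R - r)" using r by (simp add: field_simps)
  then show ?thesis by (simp add: g_def w)
qed

lemma finite_zeros_in_compact:
  assumes "f holomorphic_on S" "open S" "connected S" "compact K" "K \<subseteq> S" "z0 \<in> S" "f z0 \<noteq> 0"
  shows "finite {z\<in>K. f z = 0}"
proof (cases "f constant_on S")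
  case True
  then have "f z \<noteq> 0" if "z \<in> S" for z using assms that by (auto simp: constant_on_def)
  then have "{z\<in>K. f z = 0} = {}" using assms by auto
  then show ?thesis by (simp only: finite.emptyI)
next
  case False
  then show ?thesis using assms by (intro holomorphic_compact_finite_zeros) auto
qed

lemma zorder_prod_linear_powers:
  assumes "finite Z"
  shows "zorder (\<lambda>z. \<Prod>p\<in>Z. (z - p) ^ m p) q = (if q \<in> Z then int (m q) else 0)"
proof (rule zorder_eqI[where S = UNIV and g = "\<lambda>z. \<Prod>p\<in>Z - {q}. (z - p) ^ m p"])
  show "(\<lambda>z. \<Prod>p\<in>Z - {q}. (z - p) ^ m p) holomorphic_on UNIV" by (intro holomorphic_intros)
  show "(\<Prod>p\<in>Z - {q}. (q - p) ^ m p) \<noteq> 0" using assms by (auto simp: prod_zero_iff)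
  show "(\<Prod>p\<in>Z. (w - p) ^ m p) = (\<Prod>p\<in>Z - {q}. (w - p) ^ m p) * (w - q) powi (if q \<in> Z then int (m q) else 0)" for w
    using assms by (auto simp: prod.remove)
qed auto

lemma zorder_pos_at_zero:
  assumes "f holomorphic_on S" "open S" "connected S" "z \<in> S" "f z = 0" "z0 \<in> S" "f z0 \<noteq> 0"
  shows "zorder f z > 0"
proof -
  have "eventually (\<lambda>w. f w \<noteq> 0 \<and> w \<in> S) (at z)"
    by (rule non_zero_neighbour_alt[where ?\<beta> = z0]) (use assms in auto)
  then have "frequently (\<lambda>w. f w \<noteq> 0) (at z)"
    by (intro eventually_frequently) (auto elim: eventually_mono)
  then show ?thesis using zorder_pos_iff[of f S z] assms by auto
qed

text \<open>All zeros in the open ball of radius \<open>r2\<close> are divided out first, since the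
  factorization theorem wants matching zeros on the whole ball; those farther out than
  \<open>r1\<close> are then multiplied back into \<open>G\<close>. So \<open>Z\<close> contains
  only zeros near the centre, as the later comparison of distances requires, while \<open>G\<close>
  is still defined on the larger ball.\<close>

lemma factor_zeros_in_disc:
  assumes f: "f holomorphic_on ball z0 R" and nz: "f z0 \<noteq> 0" and r: "0 < r1" "r1 < r2" "r2 < R"
  defines "Z \<equiv> {p\<in>cball z0 r1. f p = 0}"
  obtains G where "finite Z" "G holomorphic_on ball z0 r2" "\<And>z. z \<in> cball z0 r1 \<Longrightarrow> G z \<noteq> 0"
    "\<And>z. z \<in> ball z0 r2 \<Longrightarrow> f z = G z * (\<Prod>p\<in>Z. (z - p) ^ nat (zorder f p))"
proof -
  define W where "W = {p\<in>ball z0 r2. f p = 0}"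
  have "finite {p\<in>cball z0 r2. f p = 0}"
    by (rule finite_zeros_in_compact[OF f, of _ z0]) (use r nz in auto)
  then have finW: "finite W" by (rule finite_subset[rotated]) (auto simp: W_def)
  have ZW: "Z \<subseteq> W" using r by (auto simp: Z_def W_def)
  then have finZ: "finite Z" using finW finite_subset by blast
  define m where "m = (\<lambda>p. nat (zorder f p))"
  have mpos: "zorder f p > 0" if "p \<in> W" for p
    by (rule zorder_pos_at_zero[OF f, of _ z0]) (use that nz r in \<open>auto simp: W_def\<close>)
  define P where "P = (\<lambda>z. \<Prod>p\<in>W. (z - p) ^ m p)"
  have hf: "f holomorphic_on ball z0 r2" by (rule holomorphic_on_subset[OF f]) (use r in auto)
  have P0: "P z = 0 \<longleftrightarrow> z \<in> W" for z
    using finW mpos by (auto simp: P_def prod_zero_iff m_def)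
  obtain g where g: "g holomorphic_on ball z0 r2" "\<And>z. z \<in> ball z0 r2 \<Longrightarrow> g z \<noteq> 0" "\<And>z. z \<in> ball z0 r2 \<Longrightarrow> f z = g z * P z"
  proof (rule holomorphic_zorder_factorization[of f "ball z0 r2" P])
    show "P holomorphic_on ball z0 r2" unfolding P_def by (intro holomorphic_intros)
    show "P z = 0 \<longleftrightarrow> f z = 0" if "z \<in> ball z0 r2" for z using that by (simp add: P0 W_def)
    show "zorder P z = zorder f z" if "z \<in> ball z0 r2" for z
    proof (cases "z \<in> W")
      case True
      then show ?thesis unfolding P_def using zorder_prod_linear_powers[OF finW, of m z] mpos[of z] by (simp add: m_def)
    next
      case False
      then have "f z \<noteq> 0" using that by (simp add: W_def)
      moreover have "f analytic_on {z}" using hf that by (auto simp: analytic_at intro!: exI[of _ "ball z0 r2"])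
      ultimately have "zorder f z = 0" by (intro zorder_eq_0I)
      then show ?thesis unfolding P_def using zorder_prod_linear_powers[OF finW, of m z] False by simp
    qed
  qed (use hf in auto)
  define G where "G = (\<lambda>z. g z * (\<Prod>p\<in>W - Z. (z - p) ^ m p))"
  show ?thesis
  proof (rule that[of G])
    show "G holomorphic_on ball z0 r2" unfolding G_def by (intro holomorphic_intros g)
    show "G z \<noteq> 0" if "z \<in> cball z0 r1" for z
    proof -
      have "z \<in> ball z0 r2" using that r by auto
      moreover have "z \<notin> W - Z" using that by (auto simp: W_def Z_def)
      ultimately show ?thesis using g(2)[of z] finW by (auto simp: G_def prod_zero_iff)
    qed
    show "f z = G z * (\<Prod>p\<in>Z. (z - p) ^ nat (zorder f p))" if "z \<in> ball z0 r2" for z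
      using g(3)[OF that] prod.subset_diff[OF ZW finW, of "\<lambda>p. (z - p) ^ m p"]
      by (simp add: G_def P_def m_def)
  qed fact
qed

text \<open>A form of Jensen's inequality with explicit radii. A zero within \<open>2 * r\<close> of
  the centre is at distance at least \<open>4 * r\<close> from the circle of radius
  \<open>6 * r\<close>, so dividing it out gains a factor \<open>2\<close> and the number
  \<open>n\<close> of these zeros satisfies \<open>2 ^ n \<le> M / m\<close>. Each of them
  contributes at most \<open>pi\<close> to the variation, in total at most \<open>6\<close> times
  the logarithm; the zero-free rest has a logarithm bounded by Borel-Caratheodory with radii
  \<open>r\<close> and \<open>2 * r\<close>, which contributes the other \<open>4\<close>.\<close>

lemma arg_variation_le_disc:
  fixes f :: "complex \<Rightarrow> complex"
  assumes f: "f holomorphic_on ball z0 (8 * r)" and r: "r > 0"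
    and M: "\<And>z. z \<in> ball z0 (8 * r) \<Longrightarrow> norm (f z) \<le> M"
    and m: "0 < m" "m \<le> norm (f z0)"
    and ab: "a \<in> cball z0 r" "b \<in> cball z0 r" "Im a = Im b"
    and fnz: "\<And>z. z \<in> closed_segment a b \<Longrightarrow> f z \<noteq> 0"
  shows "arg_variation_le f a b (10 * ln (2 * M / m))"
proof -
  define Z where "Z = {p\<in>cball z0 (2 * r). f p = 0}"
  have nz: "f z0 \<noteq> 0" using m by auto
  have mM: "m \<le> M" using M[of z0] m r by simp
  define k where "k = (\<lambda>p. nat (zorder f p))"
  define n where "n = (\<Sum>p\<in>Z. k p)"
  obtain G where G: "finite Z" "G holomorphic_on ball z0 (7 * r)" "\<And>z. z \<in> cball z0 (2 * r) \<Longrightarrow> G z \<noteq> 0"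
    "\<And>z. z \<in> ball z0 (7 * r) \<Longrightarrow> f z = G z * (\<Prod>p\<in>Z. (z - p) ^ k p)"
    using factor_zeros_in_disc[OF f nz, of "2 * r" "7 * r"] r unfolding Z_def k_def by auto
  \<comment> \<open>The bound on the circle passes to the inside by the maximum principle;
    \<open>G\<close> is holomorphic on the slightly larger ball of radius
    \<open>7 * r\<close>.\<close>
  have fr: "norm (G z) \<le> M / (4 * r) ^ n" if "z \<in> frontier (cball z0 (6 * r))" for z
  proof -
    have z: "dist z0 z = 6 * r" using that r by (simp add: frontier_cball sphere_def)
    have "norm (f z) = norm (G z) * (\<Prod>p\<in>Z. norm (z - p) ^ k p)"
      using G(4)[of z] z r by (simp add: norm_mult prod_norm[symmetric] norm_power)
    moreover have "(\<Prod>p\<in>Z. norm (z - p) ^ k p) \<ge> (\<Prod>p\<in>Z. (4 * r) ^ k p)"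
    proof (intro prod_mono conjI power_mono)
      fix p assume "p \<in> Z"
      then have "dist z0 p \<le> 2 * r" by (simp add: Z_def)
      moreover have "dist z0 z \<le> dist z0 p + dist p z" by (rule dist_triangle)
      ultimately show "4 * r \<le> norm (z - p)" using z by (simp add: dist_norm norm_minus_commute)
    qed (use r in auto)
    moreover have "(\<Prod>p\<in>Z. (4 * r) ^ k p) = (4 * r) ^ n" by (simp add: power_sum n_def)
    ultimately have "norm (G z) * (4 * r) ^ n \<le> norm (f z)"
      by (metis mult_left_mono norm_ge_zero)
    also have "\<dots> \<le> M" using M[of z] z r by simp
    finally show ?thesis using r by (simp add: field_simps)
  qed
  have GM: "norm (G z) \<le> M / (4 * r) ^ n" if "z \<in> cball z0 (6 * r)" for z
  proof (rule maximum_modulus_frontier[of G "cball z0 (6 * r)"])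
    show "G holomorphic_on interior (cball z0 (6 * r))"
      by (rule holomorphic_on_subset[OF G(2)]) (use r in auto)
    show "continuous_on (closure (cball z0 (6 * r))) G"
      by (rule continuous_on_subset[OF holomorphic_on_imp_continuous_on[OF G(2)]]) (use r in auto)
  qed (use fr that in auto)
  have Gm: "m / (2 * r) ^ n \<le> norm (G z0)"
  proof -
    have "norm (f z0) = norm (G z0) * (\<Prod>p\<in>Z. norm (z0 - p) ^ k p)"
      using G(4)[of z0] r by (simp add: norm_mult prod_norm[symmetric] norm_power)
    also have "\<dots> \<le> norm (G z0) * (\<Prod>p\<in>Z. (2 * r) ^ k p)"
      by (intro mult_left_mono prod_mono conjI power_mono) (auto simp: Z_def dist_norm)
    also have "(\<Prod>p\<in>Z. (2 * r) ^ k p) = (2 * r) ^ n" by (simp add: power_sum n_def)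
    finally have "m \<le> norm (G z0) * (2 * r) ^ n" using m by linarith
    then show ?thesis using r by (simp add: field_simps)
  qed
  have "m / (2 * r) ^ n \<le> M / (4 * r) ^ n" using Gm GM[of z0] r by simp
  then have "m * (4 * r) ^ n \<le> M * (2 * r) ^ n" using r by (simp add: field_simps)
  moreover have "(4 * r) ^ n = 2 ^ n * (2 * r) ^ n"
  proof -
    have "4 * r = 2 * (2 * r)" by simp
    then show ?thesis by (simp only: power_mult_distrib)
  qed
  ultimately have "(m * 2 ^ n) * (2 * r) ^ n \<le> M * (2 * r) ^ n" by (simp only: mult.assoc)
  then have 2: "m * 2 ^ n \<le> M" using r by simp
  then have "2 ^ n \<le> M / m" using m by (simp add: field_simps)
  then have "ln (2 ^ n) \<le> ln (M / m)" using m mM by (subst ln_le_cancel_iff) auto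
  then have "real n * ln 2 \<le> ln (M / m)" by (simp add: ln_realpow)
  moreover have "real n * (2 / 3) \<le> real n * ln 2" using ln2_ge_two_thirds by (intro mult_left_mono) auto
  ultimately have n1: "real n \<le> 3 / 2 * ln (M / m)" by simp
  \<comment> \<open>The extra factor \<open>2\<close> makes the bound for \<open>Re (h0 z)\<close>
    strict, as Borel-Caratheodory demands.\<close>
  define A where "A = ln (2 * M / m)"
  have MA: "0 \<le> ln (M / m)" "ln (M / m) \<le> A" using m mM by (auto simp: A_def field_simps)
  have nA: "real n \<le> 3 / 2 * A" using n1 MA by linarith
  have seg: "closed_segment a b \<subseteq> cball z0 r"
    using ab by (intro closed_segment_subset) auto
  have Gnz: "G z \<noteq> 0" if "z \<in> ball z0 (2 * r)" for z using G(3)[of z] that by simp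
  have hG: "G holomorphic_on ball z0 (2 * r)" by (rule holomorphic_on_subset[OF G(2)]) (use r in auto)
  obtain h where h: "h holomorphic_on ball z0 (2 * r)" "\<And>z. z \<in> ball z0 (2 * r) \<Longrightarrow> exp (h z) = G z"
    using holomorphic_logarithm_exists[OF _ _ hG Gnz, of z0] r by auto
  define h0 where "h0 = (\<lambda>z. h z - h z0)"
  have h0: "G z = G z0 * exp (h0 z)" if "z \<in> ball z0 (2 * r)" for z
    using h(2)[OF that] h(2)[of z0] Gnz[of z0] r by (simp add: h0_def exp_diff)
  have ReA: "Re (h0 z) < A" if "z \<in> ball z0 (2 * r)" for z
  proof -
    have "m / (2 * r) ^ n * exp (Re (h0 z)) \<le> norm (G z0) * exp (Re (h0 z))"
      by (intro mult_right_mono Gm) auto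
    also have "\<dots> = norm (G z)" using h0[OF that] by (simp add: norm_mult)
    also have "\<dots> \<le> M / (4 * r) ^ n" by (rule GM) (use that r in auto)
    also have "\<dots> \<le> M / (2 * r) ^ n" using r m mM by (intro divide_left_mono power_mono mult_pos_pos) auto
    finally have "exp (Re (h0 z)) \<le> M / m" using r m by (simp add: field_simps)
    also have "\<dots> < 2 * M / m" using m mM by (simp add: field_simps)
    also have "\<dots> = exp A" using m mM by (simp add: A_def)
    finally show ?thesis by simp
  qed
  have bc: "norm (h0 z) \<le> 2 * A" if "z \<in> cball z0 r" for z
  proof -
    have "norm (h0 z) \<le> 2 * A * r / (2 * r - r)"
    proof (rule Borel_Caratheodory[of h0 z0])
      show "h0 holomorphic_on ball z0 (2 * r)" unfolding h0_def by (intro holomorphic_intros h)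
    qed (use ReA r that in \<open>auto simp: h0_def\<close>)
    then show ?thesis using r by simp
  qed
  have aG: "arg_variation_le G a b (4 * A)"
  proof (rule arg_variation_leI[of "ball z0 (2 * r)" a b h0 "G z0"])
    show "closed_segment a b \<subseteq> ball z0 (2 * r)" using seg r by force
    show "h0 holomorphic_on ball z0 (2 * r)" unfolding h0_def by (intro holomorphic_intros h)
    show "G z0 \<noteq> 0" using r by (intro Gnz) auto
    have "\<bar>Im (h0 b - h0 a)\<bar> \<le> norm (h0 b - h0 a)" by (rule abs_Im_le_cmod)
    also have "\<dots> \<le> norm (h0 b) + norm (h0 a)" by (rule norm_triangle_ineq4)
    also have "\<dots> \<le> 4 * A" using bc[OF ab(1)] bc[OF ab(2)] by simp
    finally show "\<bar>Im (h0 b - h0 a)\<bar> \<le> 4 * A" .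
  qed (use h0 in auto)
  have aP: "arg_variation_le (\<lambda>z. \<Prod>p\<in>Z. (z - p) ^ k p) a b (\<Sum>p\<in>Z. real (k p) * pi)"
  proof (rule arg_variation_le_prod[OF G(1)])
    fix p assume "p \<in> Z"
    then have "p \<notin> closed_segment a b" using fnz by (auto simp: Z_def)
    then show "arg_variation_le (\<lambda>z. (z - p) ^ k p) a b (real (k p) * pi)"
      by (intro arg_variation_le_power arg_variation_le_linear ab)
  qed
  have "arg_variation_le f a b (4 * A + (\<Sum>p\<in>Z. real (k p) * pi))"
    by (rule arg_variation_le_cong[OF arg_variation_le_mult[OF aG aP], of "ball z0 (7 * r)"])
       (use G(4) seg r in force)+
  moreover have "4 * A + (\<Sum>p\<in>Z. real (k p) * pi) \<le> 10 * A"
  proof -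
    have "(\<Sum>p\<in>Z. real (k p) * pi) = real n * pi" by (simp add: n_def sum_distrib_right)
    also have "\<dots> \<le> (3 / 2 * A) * 4" using nA MA pi_less_4 by (intro mult_mono) auto
    finally show ?thesis by simp
  qed
  ultimately show ?thesis
    unfolding A_def by (rule arg_variation_le_mono)
qed

section \<open>The argument principle on a rectangle\<close>

definition side_arg :: "(complex \<Rightarrow> complex) \<Rightarrow> complex \<Rightarrow> complex \<Rightarrow> real" where
  "side_arg f a b = Im (contour_integral (linepath a b) (\<lambda>z. deriv f z / f z))"

text \<open>The imaginary part of the argument principle, split into the four sides; every zero
  inside has winding number \<open>1\<close> and positive order. Holomorphy is asked for in the
  upper half plane only, so that \<open>zeta\<close> qualifies despite its pole.\<close>

lemma zero_count_rectangle:
  assumes f: "f holomorphic_on {s. Im s > 0}" and z0: "Im z0 > 0" "f z0 \<noteq> 0"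
    and xy: "x1 < x2" "0 < y1" "y1 < y2"
    and nz: "\<And>z. z \<in> cbox (Complex x1 y1) (Complex x2 y2) - box (Complex x1 y1) (Complex x2 y2) \<Longrightarrow> f z \<noteq> 0"
  shows "2 * pi * real (zero_count f (box (Complex x1 y1) (Complex x2 y2))) =
     side_arg f (Complex x1 y1) (Complex x2 y1) + side_arg f (Complex x2 y1) (Complex x2 y2)
     + side_arg f (Complex x2 y2) (Complex x1 y2) + side_arg f (Complex x1 y2) (Complex x1 y1)"
proof -
  define a b where "a = Complex x1 y1" and "b = Complex x2 y2"
  \<comment> \<open>An open neighbourhood of the closed rectangle; its lower edge is at
    \<open>y1 / 2\<close> so that its closure \<open>K\<close> stays in the upper half plane, where
    it contains finitely many zeros.\<close>
  define S where "S = box (Complex (x1 - 1) (y1 / 2)) (Complex (x2 + 1) (y2 + 1))"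
  define K where "K = cbox (Complex (x1 - 1) (y1 / 2)) (Complex (x2 + 1) (y2 + 1))"
  let ?H = "{s. Im s > 0}"
  let ?h = "\<lambda>z. deriv f z / f z"
  have opH: "open ?H" by (rule open_halfspace_Im_gt)
  have conH: "connected ?H" by (intro convex_connected convex_halfspace_Im_gt)
  have KH: "K \<subseteq> ?H" using xy by (auto simp: K_def in_cbox_complex_iff)
  have finK: "finite {z\<in>K. f z = 0}"
    by (rule finite_zeros_in_compact[OF f opH conH _ KH, of z0]) (use z0 in \<open>auto simp: K_def\<close>)
  have SK: "S \<subseteq> K" by (auto simp: S_def K_def intro: less_imp_le simp: in_box_complex_iff in_cbox_complex_iff)
  have le: "Re a \<le> Re b" "Im a \<le> Im b" using xy by (auto simp: a_def b_def)
  have pim: "path_image (rectpath a b) = cbox a b - box a b"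
    by (rule path_image_rectpath_cbox_minus_box[OF le])
  have cS: "cbox a b \<subseteq> S" using xy by (auto simp: a_def b_def S_def in_box_complex_iff in_cbox_complex_iff)
  have fS: "f holomorphic_on S" using f SK KH by (auto intro: holomorphic_on_subset)
  define pz where "pz = {w\<in>S. f w = 0 \<or> w \<in> ({}::complex set)}"
  have fpz: "finite pz" by (rule finite_subset[OF _ finK]) (use SK in \<open>auto simp: pz_def\<close>)
  have "contour_integral (rectpath a b) (\<lambda>x. deriv f x * 1 / f x) = 2 * pi * \<i> *
          (\<Sum>p\<in>pz. winding_number (rectpath a b) p * 1 * zorder f p)"
    unfolding pz_def
  proof (rule argument_principle[of S f "{}" "\<lambda>_. 1"])
    show "open S" unfolding S_def by (rule open_box)
    show "connected S" unfolding S_def by (intro convex_connected convex_box)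
    show "valid_path (rectpath a b)" by simp
    show "path_image (rectpath a b) \<subseteq> S - {w \<in> S. f w = 0 \<or> w \<in> {}}"
      using pim cS nz by (auto simp: a_def b_def)
    show "\<forall>z. z \<notin> S \<longrightarrow> winding_number (rectpath a b) z = 0"
      using winding_number_rectpath_outside[OF le] cS by blast
    show "finite {w \<in> S. f w = 0 \<or> w \<in> {}}" using fpz by (simp add: pz_def)
  qed (use fS in auto)
  also have "(\<Sum>p\<in>pz. winding_number (rectpath a b) p * 1 * zorder f p) = (\<Sum>p\<in>zeros_in f (box a b). of_nat (nat (zorder f p)))"
  proof (rule sum.mono_neutral_cong_right[OF fpz])
    show "zeros_in f (box a b) \<subseteq> pz"
      using cS box_subset_cbox[of a b] by (auto simp: zeros_in_def pz_def)
    show "\<forall>p\<in>pz - zeros_in f (box a b). winding_number (rectpath a b) p * 1 * zorder f p = 0"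
    proof
      fix p assume p: "p \<in> pz - zeros_in f (box a b)"
      then have "f p = 0" "p \<notin> box a b" by (auto simp: pz_def zeros_in_def)
      then have "p \<notin> cbox a b" using nz by (auto simp: a_def b_def)
      then show "winding_number (rectpath a b) p * 1 * zorder f p = 0"
        using winding_number_rectpath_outside[OF le] by simp
    qed
    fix p assume p: "p \<in> zeros_in f (box a b)"
    then have "p \<in> S" using cS box_subset_cbox[of a b] by (auto simp: zeros_in_def)
    then have "p \<in> ?H" using SK KH by blast
    then have "zorder f p > 0"
      by (intro zorder_pos_at_zero[OF f opH conH _ _ _ z0(2)]) (use p z0 in \<open>auto simp: zeros_in_def\<close>)
    then show "winding_number (rectpath a b) p * 1 * zorder f p = of_nat (nat (zorder f p))"
      using winding_number_rectpath[of p a b] p by (simp add: zeros_in_def)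
  qed
  also have "\<dots> = of_nat (zero_count f (box a b))" by (simp add: zero_count_def)
  finally have 1: "contour_integral (rectpath a b) ?h = 2 * pi * \<i> * of_nat (zero_count f (box a b))" by simp
  have side: "?h contour_integrable_on linepath p q" if "closed_segment p q \<subseteq> cbox a b - box a b" for p q
  proof (rule contour_integrable_continuous_linepath)
    have sub: "closed_segment p q \<subseteq> ?H" using that cS SK KH by blast
    have "deriv f holomorphic_on ?H" by (intro holomorphic_deriv f opH)
    then show "continuous_on (closed_segment p q) ?h"
      using f sub that nz
      by (intro continuous_intros holomorphic_on_imp_continuous_on) (auto intro: holomorphic_on_subset simp: a_def b_def)
  qed
  have segs: "closed_segment a (Complex (Re b) (Im a)) \<subseteq> cbox a b - box a b" "closed_segment (Complex (Re b) (Im a)) b \<subseteq> cbox a b - box a b"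
     "closed_segment b (Complex (Re a) (Im b)) \<subseteq> cbox a b - box a b" "closed_segment (Complex (Re a) (Im b)) a \<subseteq> cbox a b - box a b"
    using le by (auto simp: in_box_complex_iff in_cbox_complex_iff closed_segment_same_Im closed_segment_same_Re closed_segment_eq_real_ivl split: if_splits)
  have "contour_integral (rectpath a b) ?h = contour_integral (linepath a (Complex (Re b) (Im a))) ?h
      + contour_integral (linepath (Complex (Re b) (Im a)) b) ?h
      + contour_integral (linepath b (Complex (Re a) (Im b))) ?h + contour_integral (linepath (Complex (Re a) (Im b)) a) ?h"
    unfolding rectpath_def Let_def using segs[THEN side]
    by (simp add: contour_integral_join contour_integrable_join valid_path_join)
  then have "Im (2 * pi * \<i> * of_nat (zero_count f (box a b))) = side_arg f a (Complex (Re b) (Im a)) + side_arg f (Complex (Re b) (Im a)) b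
      + side_arg f b (Complex (Re a) (Im b)) + side_arg f (Complex (Re a) (Im b)) a"
    unfolding 1 side_arg_def by simp
  then show ?thesis by (simp add: a_def b_def)
qed

lemma side_arg_le: "arg_variation_le f a b B \<Longrightarrow> \<bar>side_arg f a b\<bar> \<le> B"
  unfolding side_arg_def by (rule arg_variation_le_contour_integral)

text \<open>Logarithmic derivatives add up, so a bound for the quotient \<open>q\<close> is enough.
  Neither variation is bounded separately, which matters on the left side, where both are
  large.\<close>

lemma side_arg_mult_diff_le:
  assumes "open S" "closed_segment a b \<subseteq> S" "g holomorphic_on S" "\<And>z. z \<in> S \<Longrightarrow> g z \<noteq> 0"
    and fg: "\<And>z. z \<in> S \<Longrightarrow> f z = g z * q z" and q: "arg_variation_le q a b B" and hq: "q holomorphic_on S"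
    and qnz: "\<And>z. z \<in> S \<Longrightarrow> q z \<noteq> 0"
  shows "\<bar>side_arg f a b - side_arg g a b\<bar> \<le> B"
proof -
  have cong: "deriv f z / f z = deriv g z / g z + deriv q z / q z" if "z \<in> S" for z
  proof -
    have "((\<lambda>z. g z * q z) has_field_derivative deriv g z * q z + deriv q z * g z) (at z)"
      by (rule DERIV_mult) (use assms that in \<open>auto intro: holomorphic_derivI\<close>)
    then have "(f has_field_derivative deriv g z * q z + deriv q z * g z) (at z)"
      by (rule has_field_derivative_transform_within_open[OF _ assms(1) that]) (use fg in auto)
    then have "deriv f z = deriv g z * q z + deriv q z * g z" by (rule DERIV_imp_deriv)
    then show ?thesis using fg[OF that] assms(4)[OF that] qnz[OF that] by (simp add: add_divide_distrib)
  qed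
  have int: "(\<lambda>z. deriv h z / h z) contour_integrable_on linepath a b" if "h holomorphic_on S" "\<And>z. z \<in> S \<Longrightarrow> h z \<noteq> 0" for h
  proof (rule contour_integrable_continuous_linepath)
    have "deriv h holomorphic_on S" by (intro holomorphic_deriv that assms)
    then show "continuous_on (closed_segment a b) (\<lambda>z. deriv h z / h z)"
      using that assms(2) by (intro continuous_intros holomorphic_on_imp_continuous_on) (auto intro: holomorphic_on_subset)
  qed
  have "contour_integral (linepath a b) (\<lambda>z. deriv f z / f z) = contour_integral (linepath a b) (\<lambda>z. deriv g z / g z + deriv q z / q z)"
    by (rule contour_integral_cong) (use cong assms(2) in auto)
  also have "\<dots> = contour_integral (linepath a b) (\<lambda>z. deriv g z / g z) + contour_integral (linepath a b) (\<lambda>z. deriv q z / q z)"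
    by (rule contour_integral_add) (use int assms in auto)
  finally have "side_arg f a b - side_arg g a b = side_arg q a b" by (simp add: side_arg_def)
  then show ?thesis using side_arg_le[OF q] by simp
qed

section \<open>Zero-free regions of zeta\<close>

lemma norm_powr_neg_summable_on:
  assumes "Re s > 1"
  shows "(\<lambda>n::nat. norm (of_nat n powr (- s) :: complex)) summable_on UNIV"
proof (rule norm_summable_imp_summable_on)
  have "summable (\<lambda>n. norm (of_nat (Suc n) powr (- s) :: complex))"
  proof (rule summable_cong[THEN iffD2])
    show "\<forall>\<^sub>F n in sequentially. norm (of_nat (Suc n) powr (- s) :: complex) = real (Suc n) powr (- Re s)"
      by (intro always_eventually allI, subst norm_of_nat_powr) auto
    show "summable (\<lambda>m. real (Suc m) powr (- Re s))" using assms by (intro summable_Suc_powr) auto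
  qed
  then have "summable (\<lambda>n. norm (of_nat n powr (- s) :: complex))" by (subst (asm) summable_Suc_iff)
  then show "summable (\<lambda>n. norm (norm (of_nat n powr (- s) :: complex)))" by simp
qed

lemma powr_neg_summable_on:
  assumes "Re s > 1"
  shows "(\<lambda>n::nat. of_nat n powr (- s) :: complex) summable_on A"
  by (rule summable_on_subset_banach[OF abs_summable_summable[OF norm_powr_neg_summable_on[OF assms]]]) simp

text \<open>The index \<open>0\<close> is harmless because \<open>0 powr (- s) = 0\<close>;
  including it makes the sieving below a matter of subsets of the natural numbers.\<close>

lemma zeta_infsum:
  assumes "Re s > 1"
  shows "(\<Sum>\<^sub>\<infinity>n::nat. of_nat n powr (- s)) = zeta s"
proof -
  have "((\<lambda>n::nat. of_nat n powr (- s)) has_sum (\<Sum>\<^sub>\<infinity>n::nat. of_nat n powr (- s))) UNIV"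
    using powr_neg_summable_on[OF assms] by (rule has_sum_infsum)
  then have "(\<lambda>n::nat. of_nat n powr (- s)) sums (\<Sum>\<^sub>\<infinity>n::nat. of_nat n powr (- s))"
    by (rule has_sum_imp_sums)
  moreover have "(\<lambda>n::nat. of_nat n powr (- s)) sums (zeta s + of_nat 0 powr (- s))"
    by (rule sums_Suc) (rule zeta_sums[OF assms])
  ultimately show ?thesis by (simp add: sums_unique2)
qed

text \<open>When a prime \<open>q\<close> is added, the numbers to be removed from the sifted set
  \<open>?X\<close> are exactly \<open>q\<close> times \<open>?X\<close>, since no prime of
  \<open>A\<close> divides \<open>q\<close>. Their sum is \<open>q powr (- s)\<close> times the sum
  over \<open>?X\<close>.\<close>

lemma zeta_sieve:
  assumes s: "Re s > 1" and A: "finite A" "\<And>p. p \<in> A \<Longrightarrow> prime (p::nat)"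
  shows "(\<Sum>\<^sub>\<infinity>n\<in>{n. \<forall>p\<in>A. \<not> p dvd n}. of_nat n powr (- s)) = zeta s * (\<Prod>p\<in>A. 1 - of_nat p powr (- s))"
  using A
proof (induction A rule: finite_induct)
  case empty
  then show ?case using zeta_infsum[OF s] by simp
next
  case (insert q A)
  let ?f = "\<lambda>n::nat. of_nat n powr (- s) :: complex"
  let ?X = "{n. \<forall>p\<in>A. \<not> p dvd n}" and ?Y = "{n. \<forall>p\<in>insert q A. \<not> p dvd n}"
  have q: "prime q" using insert by auto
  have split: "?X = ?Y \<union> (\<lambda>m. q * m) ` ?X"
  proof (intro equalityI subsetI)
    fix n assume n: "n \<in> ?X"
    show "n \<in> ?Y \<union> (\<lambda>m. q * m) ` ?X"
    proof (cases "q dvd n")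
      case True
      then obtain m where m: "n = q * m" by (elim dvdE)
      then have "m \<in> ?X" using n by (auto dest: dvd_mult)
      then show ?thesis using m by blast
    qed (use n in auto)
  next
    fix n assume n: "n \<in> ?Y \<union> (\<lambda>m. q * m) ` ?X"
    then show "n \<in> ?X"
    proof
      assume "n \<in> (\<lambda>m. q * m) ` ?X"
      then obtain m where m: "n = q * m" "m \<in> ?X" by blast
      have "\<not> p dvd n" if "p \<in> A" for p
      proof
        assume "p dvd n"
        have pp: "prime p" using that insert.prems by auto
        then have "p dvd q \<or> p dvd m" using \<open>p dvd n\<close> m by (simp add: prime_dvd_mult_iff)
        moreover have "\<not> p dvd q"
          using pp q that insert.hyps by (metis primes_dvd_imp_eq)
        ultimately show False using m that by auto
      qed
      then show ?thesis by auto
    qed auto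
  qed
  have disj: "?Y \<inter> (\<lambda>m. q * m) ` ?X = {}" by auto
  have "infsum ?f ?X = infsum ?f (?Y \<union> (\<lambda>m. q * m) ` ?X)" using split by simp
  also have "\<dots> = infsum ?f ?Y + infsum ?f ((\<lambda>m. q * m) ` ?X)"
    by (intro infsum_Un_disjoint powr_neg_summable_on s disj)
  also have "infsum ?f ((\<lambda>m. q * m) ` ?X) = infsum (?f \<circ> (\<lambda>m. q * m)) ?X"
    by (rule infsum_reindex) (use q in \<open>auto simp: inj_on_def\<close>)
  also have "?f \<circ> (\<lambda>m. q * m) = (\<lambda>m. of_nat q powr (- s) * ?f m)"
    using of_nat_mult_powr_complex[of q _ "- s"] by (auto simp: fun_eq_iff)
  also have "infsum (\<lambda>m. of_nat q powr (- s) * ?f m) ?X = of_nat q powr (- s) * infsum ?f ?X"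
    by (rule infsum_cmult_right') 
  finally have "infsum ?f ?Y = (1 - of_nat q powr (- s)) * infsum ?f ?X"
    by (simp add: algebra_simps)
  then show ?case using insert by simp
qed

text \<open>Stated with the finite products on the side of \<open>zeta\<close>, so that
  \<open>zeta s \<noteq> 0\<close> is immediate and no infinite product is formed. After sieving by
  the primes up to \<open>N \<ge> 2\<close> only the index \<open>1\<close> and indices above
  \<open>N\<close> survive, and the latter form the tail of a convergent series.\<close>

lemma zeta_euler_product_tendsto:
  assumes s: "Re s > 1"
  shows "(\<lambda>N. zeta s * (\<Prod>p | prime p \<and> p \<le> N. 1 - of_nat p powr (- s))) \<longlonglongrightarrow> 1"
proof -
  let ?f = "\<lambda>n::nat. of_nat n powr (- s) :: complex"
  define X where "X = (\<lambda>N. {n. \<forall>p\<in>{p. prime p \<and> p \<le> N}. \<not> p dvd (n::nat)})"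
  have fin: "finite {p::nat. prime p \<and> p \<le> N}" for N by (rule finite_subset[of _ "{..N}"]) auto
  have eq: "zeta s * (\<Prod>p | prime p \<and> p \<le> N. 1 - of_nat p powr (- s)) = infsum ?f (X N)" for N
    using zeta_sieve[OF s fin, of N] by (simp add: X_def)
  have sm: "summable (\<lambda>n. norm (?f n))"
    using norm_powr_neg_summable_on[OF s] by (subst (asm) summable_on_UNIV_nonneg_real_iff) auto
  have bound: "norm (infsum ?f (X N) - 1) \<le> (\<Sum>n. norm (?f (n + (N + 1))))" if N: "N \<ge> 2" for N
  proof -
    have X1: "1 \<in> X N" by (auto simp: X_def)
    have "infsum ?f (insert 1 (X N - {1})) = ?f 1 + infsum ?f (X N - {1})"
      by (rule infsum_insert) (auto intro: powr_neg_summable_on s)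
    then have "infsum ?f (X N) - 1 = infsum ?f (X N - {1})" using X1 by (simp add: insert_absorb)
    also have "norm \<dots> \<le> infsum (\<lambda>n. norm (?f n)) (X N - {1})"
      by (rule norm_infsum_bound) (rule summable_on_subset_banach[OF norm_powr_neg_summable_on[OF s]], simp)
    also have "\<dots> \<le> infsum (\<lambda>n. norm (?f n)) {N + 1..}"
    proof (rule infsum_mono_neutral)
      show "norm (?f x) \<le> 0" if "x \<in> (X N - {1}) - {N + 1..}" for x
      proof -
        have "x = 0"
        proof (rule ccontr)
          assume "x \<noteq> 0"
          with that have "x \<noteq> 1" "x \<le> N" by auto
          then obtain p where p: "prime p" "p dvd x" using prime_factor_nat by blast
          then have "p \<le> N" using \<open>x \<noteq> 0\<close> \<open>x \<le> N\<close> by (meson dvd_imp_le neq0_conv order_trans)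
          then show False using p that by (auto simp: X_def)
        qed
        then show ?thesis by simp
      qed
    qed (auto intro!: summable_on_subset_banach[OF norm_powr_neg_summable_on[OF s]])
    also have "\<dots> = infsum ((\<lambda>n. norm (?f n)) \<circ> (\<lambda>n. n + (N + 1))) UNIV"
    proof -
      have "(\<lambda>n. n + (N + 1)) ` UNIV = {N + 1..}"
      proof (intro equalityI subsetI)
        fix x assume "x \<in> {N + 1..}"
        then show "x \<in> (\<lambda>n. n + (N + 1)) ` UNIV" by (intro image_eqI[of _ _ "x - (N + 1)"]) auto
      qed auto
      moreover have "infsum (\<lambda>n. norm (?f n)) ((\<lambda>n. n + (N + 1)) ` UNIV) = infsum ((\<lambda>n. norm (?f n)) \<circ> (\<lambda>n. n + (N + 1))) UNIV"
        by (rule infsum_reindex) (auto simp: inj_on_def)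
      ultimately show ?thesis by simp
    qed
    also have "\<dots> = (\<Sum>n. norm (?f (n + (N + 1))))"
    proof -
      have "(\<lambda>n. norm (?f (n + (N + 1)))) sums (\<Sum>n. norm (?f (n + (N + 1))))"
        using summable_ignore_initial_segment[OF sm, of "N + 1"] by (rule summable_sums)
      then have "((\<lambda>n. norm (?f (n + (N + 1)))) has_sum (\<Sum>n. norm (?f (n + (N + 1))))) UNIV"
        by (intro norm_summable_imp_has_sum) (auto simp: sums_iff)
      then show ?thesis by (simp add: infsumI o_def)
    qed
    finally show ?thesis .
  qed
  have "(\<lambda>N. \<Sum>n. norm (?f (n + N))) \<longlonglongrightarrow> 0"
    using suminf_exist_split2[OF sm] .
  then have "(\<lambda>N. \<Sum>n. norm (?f (n + (N + 1)))) \<longlonglongrightarrow> 0"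
    by (rule filterlim_compose) (rule filterlim_add_const_nat_at_top)
  then have "(\<lambda>N. infsum ?f (X N) - 1) \<longlonglongrightarrow> 0"
    by (rule Lim_null_comparison[rotated]) (use bound in \<open>auto intro!: eventually_sequentiallyI[of 2]\<close>)
  then have "(\<lambda>N. infsum ?f (X N)) \<longlonglongrightarrow> 1" by (simp add: LIM_zero_iff)
  then show ?thesis by (simp add: eq)
qed

text \<open>Taking logarithms, each coefficient becomes \<open>3 + 4 Re u + Re (u\<^sup>2) = 2 (1 + Re u)\<^sup>2\<close> with \<open>|u| = 1\<close>.\<close>
lemma mertens_factor_le_1:
  fixes r :: real and z :: complex
  assumes "0 < r" "r < 1" "norm z = 1"
  shows "norm (1 - of_real r :: complex) ^ 3 * norm (1 - of_real r * z) ^ 4 * norm (1 - of_real r * z\<^sup>2) \<le> 1"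
proof -
  have ser: "(\<lambda>n. r ^ n / real n * Re (w ^ n)) sums (- ln (norm (1 - of_real r * w)))" if "norm w = 1" for w :: complex
  proof -
    have n: "norm (- (of_real r * w)) < 1" using assms that by (simp add: norm_mult)
    have nz: "1 - of_real r * w \<noteq> 0"
    proof
      assume "1 - of_real r * w = 0"
      then have "norm (of_real r * w) = norm (1::complex)" by simp
      then show False using assms that by (simp add: norm_mult)
    qed
    have "(\<lambda>n. Re ((-1) ^ Suc n / of_nat n * (- (of_real r * w)) ^ n)) sums Re (ln (1 + - (of_real r * w)))"
      by (intro sums_Re Ln_series n)
    then have "(\<lambda>n. - Re ((-1) ^ Suc n / of_nat n * (- (of_real r * w)) ^ n)) sums (- Re (ln (1 + - (of_real r * w))))"
      by (rule sums_minus)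
    also have "Re (ln (1 + - (of_real r * w))) = ln (norm (1 - of_real r * w))"
      using nz by simp
    also have "(\<lambda>n. - Re ((-1) ^ Suc n / of_nat n * (- (of_real r * w)) ^ n)) = (\<lambda>n. r ^ n / real n * Re (w ^ n))"
    proof
      fix n
      have "(- (of_real r * w)) ^ n = (-1) ^ n * (of_real (r ^ n) * w ^ n)"
        by (subst power_minus) (simp add: power_mult_distrib)
      then have "(-1) ^ Suc n / of_nat n * (- (of_real r * w)) ^ n = - ((-1) ^ n * (-1) ^ n) * (of_real (r ^ n / real n) * w ^ n)"
        by simp
      also have "(-1) ^ n * (-1) ^ n = (1::complex)" by (simp add: power_mult_distrib[symmetric])
      finally show "- Re ((-1) ^ Suc n / of_nat n * (- (of_real r * w)) ^ n) = r ^ n / real n * Re (w ^ n)"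
        by (simp del: of_real_divide of_real_power)
    qed
    finally show ?thesis .
  qed
  have pos: "norm (1 - of_real r * w) > 0" if "norm w = 1" for w :: complex
  proof -
    have "1 - of_real r * w \<noteq> 0"
    proof
      assume "1 - of_real r * w = 0"
      then have "norm (of_real r * w) = norm (1::complex)" by simp
      then show False using assms that by (simp add: norm_mult)
    qed
    then show ?thesis by simp
  qed
  have z2: "norm (z\<^sup>2) = 1" using assms by (simp add: norm_power)
  let ?S = "3 * (- ln (norm (1 - of_real r * 1 :: complex))) + 4 * (- ln (norm (1 - of_real r * z))) + (- ln (norm (1 - of_real r * z\<^sup>2)))"
  have S: "(\<lambda>n. 3 * (r ^ n / real n * Re (1 ^ n)) + 4 * (r ^ n / real n * Re (z ^ n)) + r ^ n / real n * Re ((z\<^sup>2) ^ n)) sums ?S"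
    by (intro sums_add sums_mult ser) (use assms z2 in auto)
  have nn: "0 \<le> 3 * (r ^ n / real n * Re (1 ^ n)) + 4 * (r ^ n / real n * Re (z ^ n)) + r ^ n / real n * Re ((z\<^sup>2) ^ n)" for n
  proof -
    define u where "u = z ^ n"
    have "norm u = 1" using assms by (simp add: u_def norm_power)
    then have "(Re u)\<^sup>2 + (Im u)\<^sup>2 = 1" using cmod_power2[of u] by simp
    then have "Re (u\<^sup>2) = 2 * (Re u)\<^sup>2 - 1" by (simp add: power2_eq_square)
    then have "3 + 4 * Re u + Re (u\<^sup>2) = 2 * (1 + Re u)\<^sup>2" by (simp add: power2_eq_square algebra_simps)
    moreover have "(z\<^sup>2) ^ n = u\<^sup>2" by (simp add: u_def power_mult[symmetric] mult.commute)
    moreover define c where "c = r ^ n / real n"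
    moreover have "3 * (c * 1) + 4 * (c * Re u) + c * Re (u\<^sup>2) = c * (3 + 4 * Re u + Re (u\<^sup>2))"
      by (simp only: distrib_left mult.left_commute mult_1_right mult.commute)
    ultimately have "3 * (r ^ n / real n * Re (1 ^ n)) + 4 * (r ^ n / real n * Re (z ^ n)) + r ^ n / real n * Re ((z\<^sup>2) ^ n) = r ^ n / real n * (2 * (1 + Re u)\<^sup>2)"
      by (simp only: u_def[symmetric] power_one one_complex.sel)
    then show ?thesis using assms by simp
  qed
  have "0 \<le> ?S" by (rule sums_le[OF nn sums_zero S])
  then have "3 * ln (norm (1 - of_real r * 1 :: complex)) + 4 * ln (norm (1 - of_real r * z)) + ln (norm (1 - of_real r * z\<^sup>2)) \<le> 0" by simp
  moreover have "ln (norm (1 - of_real r * 1 :: complex) ^ 3 * norm (1 - of_real r * z) ^ 4 * norm (1 - of_real r * z\<^sup>2))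
     = 3 * ln (norm (1 - of_real r * 1 :: complex)) + 4 * ln (norm (1 - of_real r * z)) + ln (norm (1 - of_real r * z\<^sup>2))"
    using pos[of 1] pos[of z] pos[of "z\<^sup>2"] assms z2 by (simp add: ln_mult ln_realpow)
  ultimately have le: "ln (norm (1 - of_real r * 1 :: complex) ^ 3 * norm (1 - of_real r * z) ^ 4 * norm (1 - of_real r * z\<^sup>2)) \<le> 0"
    by linarith
  have "0 < norm (1 - of_real r * 1 :: complex) ^ 3 * norm (1 - of_real r * z) ^ 4 * norm (1 - of_real r * z\<^sup>2)"
    using pos[of 1] pos[of z] pos[of "z\<^sup>2"] assms z2 by (intro mult_pos_pos zero_less_power) auto
  then show ?thesis using le by (simp add: ln_le_zero_iff)
qed

text \<open>The inequality for a single prime, with \<open>r = p powr (- x)\<close> and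
  \<open>z = p powr (- \<i> * t)\<close>, is multiplied over the primes up to \<open>N\<close>.
  Since each value of \<open>zeta\<close> times its finite product tends to \<open>1\<close>, the
  limit in \<open>N\<close> gives the claim.\<close>

lemma zeta_mertens_ge_1:
  fixes x t :: real
  assumes "x > 1"
  shows "norm (zeta (of_real x)) ^ 3 * norm (zeta (Complex x t)) ^ 4 * norm (zeta (Complex x (2 * t))) \<ge> 1"
proof -
  define P where "P = (\<lambda>s N. \<Prod>p | prime p \<and> p \<le> N. 1 - of_nat p powr (- s) :: complex)"
  have lim: "(\<lambda>N. norm (zeta s * P s N)) \<longlonglongrightarrow> 1" if "Re s > 1" for s
    using tendsto_norm[OF zeta_euler_product_tendsto[OF that]] by (simp add: P_def)
  define F where "F = (\<lambda>N. norm (zeta (of_real x) * P (of_real x) N) ^ 3 * norm (zeta (Complex x t) * P (Complex x t) N) ^ 4 * norm (zeta (Complex x (2 * t)) * P (Complex x (2 * t)) N))"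
  have "F \<longlonglongrightarrow> 1 ^ 3 * 1 ^ 4 * 1"
    unfolding F_def by (intro tendsto_intros lim) (use assms in auto)
  then have "F \<longlonglongrightarrow> 1" by simp
  moreover have "F N \<le> norm (zeta (of_real x)) ^ 3 * norm (zeta (Complex x t)) ^ 4 * norm (zeta (Complex x (2 * t)))" for N
  proof -
    have "norm (P (of_real x) N) ^ 3 * norm (P (Complex x t) N) ^ 4 * norm (P (Complex x (2 * t)) N) =
      (\<Prod>p | prime p \<and> p \<le> N. norm (1 - of_nat p powr (- of_real x) :: complex) ^ 3 * norm (1 - of_nat p powr (- Complex x t) :: complex) ^ 4 * norm (1 - of_nat p powr (- Complex x (2 * t)) :: complex))"
      by (simp add: P_def prod_norm[symmetric] prod_power_distrib prod.distrib)
    also have "\<dots> \<le> 1"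
    proof (rule prod_le_1)
      fix p :: nat assume "p \<in> {p. prime p \<and> p \<le> N}"
      then have p: "p > 1" using prime_gt_1_nat by auto
      define r where "r = real p powr (- x)"
      define z where "z = (of_nat p powr (- \<i> * of_real t) :: complex)"
      have r: "0 < r" "r < 1" using p assms by (auto simp: r_def powr_less_one)
      have z: "norm z = 1" unfolding z_def using norm_of_nat_powr[of p "- \<i> * of_real t"] p by simp
      have e0: "of_nat p powr (- of_real x) = (of_real r :: complex)"
        unfolding r_def using powr_of_real[of "real p" "- x"] p by simp
      have e1: "of_nat p powr (- Complex x t) = of_real r * z"
      proof -
        have "- Complex x t = - of_real x + - \<i> * of_real t" by (simp add: complex_eq_iff)
        then show ?thesis by (simp only: powr_add e0 z_def)
      qed
      have e2: "of_nat p powr (- Complex x (2 * t)) = of_real r * z\<^sup>2"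
      proof -
        have "- Complex x (2 * t) = - of_real x + (- \<i> * of_real t + - \<i> * of_real t)" by (simp add: complex_eq_iff)
        then show ?thesis by (simp only: powr_add e0 z_def power2_eq_square)
      qed
      show "0 \<le> norm (1 - of_nat p powr (- of_real x) :: complex) ^ 3 * norm (1 - of_nat p powr (- Complex x t) :: complex) ^ 4 * norm (1 - of_nat p powr (- Complex x (2 * t)) :: complex) \<and>
        norm (1 - of_nat p powr (- of_real x) :: complex) ^ 3 * norm (1 - of_nat p powr (- Complex x t) :: complex) ^ 4 * norm (1 - of_nat p powr (- Complex x (2 * t)) :: complex) \<le> 1"
        unfolding e0 e1 e2 using mertens_factor_le_1[OF r z] by simp
    qed
    finally have "norm (P (of_real x) N) ^ 3 * norm (P (Complex x t) N) ^ 4 * norm (P (Complex x (2 * t)) N) \<le> 1" .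
    from mult_left_mono[OF this, of "norm (zeta (of_real x)) ^ 3 * norm (zeta (Complex x t)) ^ 4 * norm (zeta (Complex x (2 * t)))"]
    show ?thesis by (simp add: F_def norm_mult power_mult_distrib mult_ac)
  qed
  ultimately show ?thesis by (intro LIMSEQ_le_const2) auto
qed

text \<open>The continuation has at \<open>1\<close> only the singular part
  \<open>1 / (s - 1)\<close>; the series added to it is bounded by inverse squares, uniformly for
  real \<open>s\<close> between \<open>1\<close> and \<open>2\<close>.\<close>

lemma zeta_real_bound:
  obtains C :: real where "\<And>x. 0 < x \<Longrightarrow> x \<le> 1 \<Longrightarrow> x * norm (zeta (of_real (1 + x))) \<le> C"
proof -
  define Z where "Z = (\<Sum>n. real (Suc n) powr (- 2))"
  have sZ: "summable (\<lambda>n. real (Suc n) powr (- 2))" by (rule summable_Suc_powr) simp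
  have Z0: "Z \<ge> 0" unfolding Z_def by (intro suminf_nonneg sZ) auto
  have "x * norm (zeta (of_real (1 + x))) \<le> 1 + 2 * Z" if x: "0 < x" "x \<le> 1" for x
  proof -
    let ?s = "of_real (1 + x) :: complex"
    have s1: "?s \<noteq> 1" using x by (simp add: complex_eq_iff)
    have "norm (\<Sum>n. zeta_term n ?s) \<le> (\<Sum>n. 2 * real (Suc n) powr (- 2))"
    proof (rule norm_suminf_le)
      fix n
      have "norm (zeta_term n ?s) \<le> norm ?s * real (Suc n) powr (- Re ?s - 1)"
        by (rule norm_zeta_term_le) (use x s1 in auto)
      also have "\<dots> \<le> 2 * real (Suc n) powr (- 2)"
        using x by (intro mult_mono powr_mono) (auto simp del: of_real_add)
      finally show "norm (zeta_term n ?s) \<le> 2 * real (Suc n) powr (- 2)" .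
    qed (intro summable_mult sZ)
    also have "\<dots> = 2 * Z" unfolding Z_def by (rule suminf_mult[OF sZ])
    finally have 1: "norm (\<Sum>n. zeta_term n ?s) \<le> 2 * Z" .
    have "zeta ?s = 1 / (?s - 1) + (\<Sum>n. zeta_term n ?s)"
      using x s1 by (simp add: zeta_eq_ext zeta_ext_def zeta_ser_def del: of_real_add)
    then have "norm (zeta ?s) \<le> norm (1 / (?s - 1)) + norm (\<Sum>n. zeta_term n ?s)"
      by (simp only: norm_triangle_ineq)
    also have "norm (1 / (?s - 1)) = 1 / x" using x by (simp add: norm_divide)
    finally have "norm (zeta ?s) \<le> 1 / x + 2 * Z" using 1 by linarith
    then have "x * norm (zeta ?s) \<le> x * (1 / x + 2 * Z)" using x by (intro mult_left_mono) auto
    also have "\<dots> = 1 + x * (2 * Z)" using x by (simp add: algebra_simps)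
    also have "\<dots> \<le> 1 + 1 * (2 * Z)" using x Z0 by (intro add_left_mono mult_right_mono) auto
    finally show ?thesis by simp
  qed
  then show ?thesis using that by blast
qed

text \<open>At abscissa \<open>1 + x\<close> the cube in \<open>zeta_mertens_ge_1\<close> is of
  order at most \<open>x^(-3)\<close>, while a zero at \<open>1 + \<i> * t\<close> would make the
  fourth power of order \<open>x^4\<close>. The third factor stays bounded because
  \<open>1 + 2 * \<i> * t\<close> is not the pole. The product would thus tend to \<open>0\<close>
  with \<open>x\<close>, although it is at least \<open>1\<close>.\<close>

lemma zeta_nonzero_on_line_1:
  fixes t :: real
  assumes t: "t \<noteq> 0"
  shows "zeta (Complex 1 t) \<noteq> 0"
proof
  assume z0: "zeta (Complex 1 t) = 0"
  obtain C where C: "\<And>x. 0 < x \<Longrightarrow> x \<le> 1 \<Longrightarrow> x * norm (zeta (of_real (1 + x))) \<le> C" by (rule zeta_real_bound) blast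
  have lim0: "((\<lambda>x. of_real x :: complex) \<longlongrightarrow> 0) (at_right 0)"
    by (intro tendsto_eq_intros) auto
  have ne: "Complex 1 u \<noteq> 1" if "u \<noteq> 0" for u using that by (simp add: complex_eq_iff)
  have dz: "(zeta has_field_derivative deriv zeta (Complex 1 u)) (at (Complex 1 u))" if "u \<noteq> 0" for u
    by (rule holomorphic_derivI[of zeta "- {1}"]) (use ne[OF that] holomorphic_zeta[of "- {1}"] in auto)
  have q: "((\<lambda>x. zeta (Complex (1 + x) t) / of_real x) \<longlongrightarrow> deriv zeta (Complex 1 t)) (at_right 0)"
  proof -
    have "((\<lambda>h. (zeta (Complex 1 t + h) - zeta (Complex 1 t)) / h) \<longlongrightarrow> deriv zeta (Complex 1 t)) (at 0)"
      using dz[OF t] by (simp add: DERIV_def)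
    moreover have "filterlim (\<lambda>x. of_real x :: complex) (at 0) (at_right 0)"
      using lim0 by (auto simp: filterlim_at eventually_at_right_less intro: eventually_mono[OF eventually_at_right_less[of 0]])
    ultimately have "((\<lambda>x. (zeta (Complex 1 t + of_real x) - zeta (Complex 1 t)) / of_real x) \<longlongrightarrow> deriv zeta (Complex 1 t)) (at_right (0::real))"
      by (rule filterlim_compose)
    moreover have "Complex 1 t + of_real x = Complex (1 + x) t" for x by (simp add: complex_eq_iff)
    ultimately show ?thesis by (simp add: z0)
  qed
  have c: "((\<lambda>x. zeta (Complex (1 + x) (2 * t))) \<longlongrightarrow> zeta (Complex 1 (2 * t))) (at_right 0)"
  proof -
    have "isCont zeta (Complex 1 (2 * t))" using dz[of "2 * t"] t by (auto intro: DERIV_isCont)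
    moreover have "((\<lambda>x. Complex 1 (2 * t) + of_real x) \<longlongrightarrow> Complex 1 (2 * t) + 0) (at_right (0::real))"
      by (intro tendsto_intros lim0)
    ultimately have "((\<lambda>x. zeta (Complex 1 (2 * t) + of_real x)) \<longlongrightarrow> zeta (Complex 1 (2 * t))) (at_right (0::real))"
      by (intro isCont_tendsto_compose[of _ zeta]) auto
    moreover have "Complex 1 (2 * t) + of_real x = Complex (1 + x) (2 * t)" for x by (simp add: complex_eq_iff)
    ultimately show ?thesis by simp
  qed
  have "((\<lambda>x. C ^ 3 * norm (zeta (Complex (1 + x) t) / of_real x) ^ 4 * norm (zeta (Complex (1 + x) (2 * t))) * x) \<longlongrightarrow>
      C ^ 3 * norm (deriv zeta (Complex 1 t)) ^ 4 * norm (zeta (Complex 1 (2 * t))) * 0) (at_right 0)"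
    by (intro tendsto_intros q c)
  moreover have "eventually (\<lambda>x. 1 \<le> C ^ 3 * norm (zeta (Complex (1 + x) t) / of_real x) ^ 4 * norm (zeta (Complex (1 + x) (2 * t))) * x) (at_right (0::real))"
  proof -
    have "eventually (\<lambda>x. x \<in> {0<..<1}) (at_right (0::real))"
      by (rule eventually_at_right_real) simp
    then show ?thesis
    proof eventually_elim
      case (elim x)
      then have x: "0 < x" "x \<le> 1" by auto
      have "1 \<le> norm (zeta (of_real (1 + x))) ^ 3 * norm (zeta (Complex (1 + x) t)) ^ 4 * norm (zeta (Complex (1 + x) (2 * t)))"
        by (rule zeta_mertens_ge_1) (use x in auto)
      also have "\<dots> = (x * norm (zeta (of_real (1 + x)))) ^ 3 * (norm (zeta (Complex (1 + x) t) / of_real x) ^ 4 * norm (zeta (Complex (1 + x) (2 * t))) * x)"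
        using x by (simp add: norm_divide power_divide power_mult_distrib power4_eq_xxxx power3_eq_cube field_simps)
      also have "\<dots> \<le> C ^ 3 * (norm (zeta (Complex (1 + x) t) / of_real x) ^ 4 * norm (zeta (Complex (1 + x) (2 * t))) * x)"
        using x C[OF x] by (intro mult_right_mono power_mono) auto
      finally show ?case by (simp only: mult.assoc)
    qed
  qed
  ultimately have "(1::real) \<le> C ^ 3 * norm (deriv zeta (Complex 1 t)) ^ 4 * norm (zeta (Complex 1 (2 * t))) * 0"
    by (intro tendsto_lowerbound) auto
  then show False by simp
qed

lemma zeta_nonzero_Re_ge_1:
  assumes "Re s \<ge> 1" "s \<noteq> 1"
  shows "zeta s \<noteq> 0"
proof (cases "Re s = 1")
  case True
  then have "s = Complex 1 (Im s)" "Im s \<noteq> 0" using assms by (auto simp: complex_eq_iff)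
  then show ?thesis using zeta_nonzero_on_line_1 by metis
next
  case False
  then have s: "Re s > 1" using assms by simp
  show ?thesis
  proof
    assume "zeta s = 0"
    then have "(\<lambda>N. zeta s * (\<Prod>p | prime p \<and> p \<le> N. 1 - of_nat p powr (- s))) = (\<lambda>N. 0)" by simp
    then show False using zeta_euler_product_tendsto[OF s] LIMSEQ_unique[of "\<lambda>_. 0::complex" 0 1] by simp
  qed
qed

section \<open>The derivatives of eta in the left half plane\<close>

lemma holomorphic_eta_deriv: "eta_deriv k holomorphic_on A"
proof -
  have "(deriv ^^ k) eta holomorphic_on UNIV" by (intro holomorphic_higher_deriv holomorphic_eta) auto
  then have "(deriv ^^ k) eta holomorphic_on A" by (rule holomorphic_on_subset) auto
  then show ?thesis by (auto simp: eta_deriv_def intro!: holomorphic_intros holomorphic_eta)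
qed

lemma deriv_eta_deriv: "(eta_deriv k has_field_derivative eta_deriv (Suc k) s) (at s)"
proof (cases "k = 0")
  case True
  have "(eta has_field_derivative deriv eta s) (at s)"
    by (rule holomorphic_derivI[OF holomorphic_eta[of UNIV]]) auto
  then show ?thesis using True by (auto simp: eta_deriv_def intro!: derivative_eq_intros)
next
  case False
  have "(eta_deriv k has_field_derivative deriv (eta_deriv k) s) (at s)"
    by (rule holomorphic_derivI[OF holomorphic_eta_deriv[of k UNIV]]) auto
  then show ?thesis using False by (simp add: eta_deriv_def)
qed

lemma eta_cnj: "eta (cnj s) = cnj (eta s)"
proof -
  have "(cnj \<circ> eta \<circ> cnj) s = eta s"
  proof (rule analytic_continuation_open[where f = "cnj \<circ> eta \<circ> cnj" and g = eta and s = "{s. Re s > 0}" and s' = UNIV])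
    show "open {s. Re s > 0}" by (rule open_halfspace_Re_gt)
    have "1 \<in> {s. Re s > 0}" by simp
    then show "{s. Re s > 0} \<noteq> {}" by blast
    show "cnj \<circ> eta \<circ> cnj holomorphic_on UNIV"
      by (intro holomorphic_on_compose_cnj_cnj holomorphic_eta) auto
    fix z :: complex assume z: "z \<in> {s. Re s > 0}"
    have "(\<lambda>n. cnj ((-1) ^ n * of_nat (Suc n) powr (- cnj z))) sums cnj (eta (cnj z))"
      by (intro sums_cnj[THEN iffD2] eta_sums) (use z in auto)
    also have "(\<lambda>n. cnj ((-1) ^ n * of_nat (Suc n) powr (- cnj z))) = (\<lambda>n. (-1) ^ n * of_nat (Suc n) powr (- z))"
      by (auto simp: fun_eq_iff cnj_powr)
    finally show "(cnj \<circ> eta \<circ> cnj) z = eta z"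
      using sums_unique2[OF _ eta_sums[of z]] z by simp
  qed (use holomorphic_eta in auto)
  from this have "cnj (eta (cnj s)) = eta s" by simp
  then show ?thesis by (metis complex_cnj_cnj)
qed

lemma eta_deriv_cnj: "eta_deriv k (cnj s) = cnj (eta_deriv k s)"
proof (induction k arbitrary: s)
  case 0
  show ?case by (simp add: eta_deriv_def eta_cnj)
next
  case (Suc k)
  have "((cnj \<circ> eta_deriv k \<circ> cnj) has_field_derivative cnj (eta_deriv (Suc k) s)) (at (cnj s))"
    using has_field_derivative_cnj_cnj[of "eta_deriv k" "eta_deriv (Suc k) s" "cnj s"] deriv_eta_deriv[of k s] by simp
  also have "cnj \<circ> eta_deriv k \<circ> cnj = eta_deriv k" by (auto simp: fun_eq_iff Suc)
  finally show ?case by (rule DERIV_unique[OF deriv_eta_deriv])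
qed

text \<open>The form in which Cauchy's inequality is used from here on: a derivative costs no
  constant, only a margin of \<open>1\<close> in the domain.\<close>

lemma norm_deriv_le_unit_disc:
  assumes "f holomorphic_on S" "open S" "cball w 1 \<subseteq> S" "\<And>z. z \<in> cball w 1 \<Longrightarrow> norm (f z) \<le> B"
  shows "norm (deriv f w) \<le> B"
proof -
  have "norm ((deriv ^^ 1) f w) \<le> fact 1 * B / 1 ^ 1"
  proof (rule Cauchy_inequality)
    show "f holomorphic_on ball w 1" using assms by (meson ball_subset_cball holomorphic_on_subset)
    show "continuous_on (cball w 1) f"
      using assms by (meson holomorphic_on_imp_continuous_on holomorphic_on_subset)
    show "norm (f x) \<le> B" if "norm (w - x) = 1" for x
      using that assms(4)[of x] by (simp add: dist_norm)
  qed simp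
  then show ?thesis by simp
qed

lemma norm_cos_le_exp_Im: "norm (cos (z::complex)) \<le> exp \<bar>Im z\<bar>"
proof -
  have "norm (cos z) = norm (exp (\<i> * z) + exp (- (\<i> * z))) / 2"
    by (simp add: cos_exp_eq norm_divide)
  also have "\<dots> \<le> (exp (- Im z) + exp (Im z)) / 2"
    using norm_triangle_ineq[of "exp (\<i> * z)" "exp (- (\<i> * z))"] by simp
  also have "\<dots> \<le> (exp \<bar>Im z\<bar> + exp \<bar>Im z\<bar>) / 2" by (intro divide_right_mono add_mono) auto
  finally show ?thesis by simp
qed

lemma norm_cos_half_pi_le: "norm (cos (of_real pi * w / 2 :: complex)) \<le> exp (pi * \<bar>Im w\<bar> / 2)"
  using norm_cos_le_exp_Im[of "of_real pi * w / 2"] by (simp add: abs_mult)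

lemma inverse_squares_sums': "(\<lambda>n. real (Suc n) powr (- 2)) sums (pi\<^sup>2 / 6)"
proof -
  have "real (Suc n) powr (- 2) = 1 / real ((n + 1)\<^sup>2)" for n
    by (subst powr_minus) (simp add: divide_inverse add_ac)
  then show ?thesis using inverse_squares_sums by (simp only:)
qed

lemma norm_odd_zeta_minus_1:
  assumes "Re w \<ge> 4"
  shows "norm (odd_zeta w - 1) \<le> 1 / 2"
proof -
  have "(\<lambda>n. of_nat (2 * Suc n + 1) powr (- w)) sums (odd_zeta w - 1)"
    using odd_zeta_sums[of w] assms by (subst sums_Suc_iff) simp
  then have eq: "odd_zeta w - 1 = (\<Sum>n. of_nat (2 * Suc n + 1) powr (- w))" by (rule sums_unique)
  have "norm (odd_zeta w - 1) \<le> (\<Sum>n. 1 / 9 * real (Suc n) powr (- 2))"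
    unfolding eq
  proof (rule norm_suminf_le)
    show "summable (\<lambda>n. 1 / 9 * real (Suc n) powr (- 2))"
      by (intro summable_mult sums_summable[OF inverse_squares_sums'])
    fix n
    have "norm (of_nat (2 * Suc n + 1) powr (- w) :: complex) = real (2 * Suc n + 1) powr (- Re w)"
      by (subst norm_of_nat_powr) auto
    also have "\<dots> \<le> real (2 * Suc n + 1) powr (- 2 + - 2)"
      using assms by (intro powr_mono) auto
    also have "\<dots> = real (2 * Suc n + 1) powr (- 2) * real (2 * Suc n + 1) powr (- 2)"
      by (rule powr_add)
    also have "\<dots> \<le> 3 powr (- 2) * real (Suc n) powr (- 2)"
      by (intro mult_mono powr_mono2') auto
    also have "3 powr (- 2) = (1 / 9 :: real)" by (subst powr_minus) simp
    finally show "norm (of_nat (2 * Suc n + 1) powr (- w) :: complex) \<le> 1 / 9 * real (Suc n) powr (- 2)" .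
  qed
  also have "\<dots> = 1 / 9 * (pi\<^sup>2 / 6)"
    using sums_unique[OF sums_mult[OF inverse_squares_sums', of "1 / 9"]] by simp
  also have "\<dots> \<le> 1 / 9 * (4\<^sup>2 / 6)" using pi_less_4 by (intro mult_left_mono divide_right_mono power_mono) auto
  finally show ?thesis by simp
qed

lemma odd_zeta_bounds:
  assumes "Re w \<ge> 4"
  shows "norm (odd_zeta w) \<ge> 1 / 2" "norm (odd_zeta w) \<le> 2"
  using norm_odd_zeta_minus_1[OF assms] norm_triangle_ineq3[of "odd_zeta w" 1] by auto

lemma norm_odd_zeta_le:
  assumes "Re w \<ge> 3 / 2"
  shows "norm (odd_zeta w) \<le> (\<Sum>n. real (Suc n) powr (- 3 / 2))"
  unfolding odd_zeta_def
proof (rule norm_suminf_le)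
  show "summable (\<lambda>n. real (Suc n) powr (- 3 / 2))" by (rule summable_Suc_powr) simp
  fix n
  have "norm (of_nat (2 * n + 1) powr (- w) :: complex) \<le> real (Suc n) powr (- Re w)"
    by (rule norm_odd_zeta_term_le) (use assms in auto)
  also have "\<dots> \<le> real (Suc n) powr (- 3 / 2)"
    using assms by (intro powr_mono) (auto simp: field_simps)
  finally show "norm (of_nat (2 * n + 1) powr (- w) :: complex) \<le> real (Suc n) powr (- 3 / 2)" .
qed

section \<open>The factors of the functional equation\<close>

definition refl_L :: "complex \<Rightarrow> complex" where
  "refl_L w = - 2 * of_real pi powr (- w) * Gamma w"

text \<open>The logarithmic derivative of \<open>refl_L\<close>. Its real part tends to infinity
  with \<open>Re w\<close>, uniformly in \<open>Im w\<close>, so in repeated differentiation of the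
  functional equation the terms that differentiate \<open>refl_L\<close> dominate.\<close>

definition refl_lam :: "complex \<Rightarrow> complex" where
  "refl_lam w = Digamma w - of_real (ln pi)"

text \<open>The part of \<open>eta_refl\<close> whose derivative is no larger than the function's
  own bound \<open>exp (pi * \<bar>Im w\<bar> / 2)\<close>, up to a constant. This exponential
  offsets the vertical decay of \<open>Gamma\<close> in \<open>refl_L\<close>.\<close>

definition refl_P :: "complex \<Rightarrow> complex" where
  "refl_P w = cos (of_real pi * w / 2) * odd_zeta w"

lemma eta_refl_eq: "eta_refl w = refl_L w * refl_P w"
  by (simp add: eta_refl_def refl_L_def refl_P_def)

lemma refl_L_nonzero: "Re w > 0 \<Longrightarrow> refl_L w \<noteq> 0"
  by (auto simp: refl_L_def Gamma_eq_zero_iff dest: Re_pos_not_nonpos_Int)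

lemma refl_L_deriv:
  assumes "Re w > 0"
  shows "(refl_L has_field_derivative refl_lam w * refl_L w) (at w)"
proof -
  have n: "w \<notin> \<int>\<^sub>\<le>\<^sub>0" by (rule Re_pos_not_nonpos_Int) fact
  have e: "refl_L = (\<lambda>w. - 2 * exp (- w * of_real (ln pi)) * Gamma w)"
    by (simp add: fun_eq_iff refl_L_def powr_def Ln_of_real)
  show ?thesis
    unfolding e using n by (auto intro!: derivative_eq_intros simp: refl_lam_def algebra_simps)
qed

lemma holomorphic_refl_lam: "A \<subseteq> {w. Re w > 0} \<Longrightarrow> refl_lam holomorphic_on A"
  unfolding refl_lam_def[abs_def] using Re_pos_not_nonpos_Int by (intro holomorphic_intros) auto

lemma refl_lam_deriv:
  assumes "Re w > 0"
  shows "(refl_lam has_field_derivative Polygamma 1 w) (at w)"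
  unfolding refl_lam_def[abs_def] using Re_pos_not_nonpos_Int[OF assms]
  by (auto intro!: derivative_eq_intros)

lemma refl_lam_large:
  obtains a where "a \<ge> 1" "\<And>w. Re w \<ge> a \<Longrightarrow> Re (refl_lam w) \<ge> M"
proof -
  obtain a where "a \<ge> 1" "\<And>w. Re w \<ge> a \<Longrightarrow> Re (Digamma w) \<ge> M + ln pi"
    using Digamma_complex_ge[of "M + ln pi"] by blast
  then show ?thesis by (intro that[of a]) (auto simp: refl_lam_def algebra_simps)
qed

text \<open>\<open>Gamma\<close> on the real axis outgrows \<open>pi powr x\<close>, and the weight
  compensates its decay in the vertical direction. This disposes of the constant \<open>1\<close>
  subtracted from \<open>eta\<close> when \<open>k = 0\<close>.\<close>

lemma refl_L_large:
  obtains a where "a \<ge> 1" "\<And>w. Re w \<ge> a \<Longrightarrow> norm (refl_L w) * exp (pi * \<bar>Im w\<bar> / 2) \<ge> M"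
proof -
  obtain a where a: "a \<ge> 1" "\<And>x. x \<ge> a \<Longrightarrow> Gamma x \<ge> M * pi powr x"
    using Gamma_real_superexponential[of pi M] by auto
  have "norm (refl_L w) * exp (pi * \<bar>Im w\<bar> / 2) \<ge> M" if w: "Re w \<ge> a" for w
  proof -
    have "M * pi powr Re w \<le> Gamma (Re w)" by (rule a(2)) fact
    also have "\<dots> \<le> norm (Gamma w) * exp (pi * \<bar>Im w\<bar> / 2)"
      by (rule norm_Gamma_lower) (use a w in auto)
    finally have "M \<le> pi powr (- Re w) * (norm (Gamma w) * exp (pi * \<bar>Im w\<bar> / 2))"
      by (simp add: powr_minus field_simps)
    also have "\<dots> \<le> 2 * (pi powr (- Re w) * (norm (Gamma w) * exp (pi * \<bar>Im w\<bar> / 2)))" by simp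
    also have "\<dots> = norm (refl_L w) * exp (pi * \<bar>Im w\<bar> / 2)"
      by (simp add: refl_L_def norm_mult norm_powr_real_powr)
    finally show ?thesis .
  qed
  then show ?thesis using a that by blast
qed

lemma holomorphic_refl_P: "A \<subseteq> {w. Re w > 1} \<Longrightarrow> refl_P holomorphic_on A"
  unfolding refl_P_def[abs_def]
  by (intro holomorphic_intros holomorphic_on_subset[OF holomorphic_odd_zeta]) auto

lemma norm_refl_P_le:
  assumes "Re w \<ge> 4"
  shows "norm (refl_P w) \<le> 2 * exp (pi * \<bar>Im w\<bar> / 2)"
proof -
  have "norm (refl_P w) = norm (cos (of_real pi * w / 2)) * norm (odd_zeta w)" by (simp add: refl_P_def norm_mult)
  also have "\<dots> \<le> exp (pi * \<bar>Im w\<bar> / 2) * 2"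
    using norm_cos_half_pi_le odd_zeta_bounds[OF assms] by (intro mult_mono) auto
  finally show ?thesis by simp
qed

text \<open>A shift of the imaginary part by \<open>1\<close> costs at most
  \<open>exp (pi / 2) \<le> exp 2\<close>, and \<open>exp 2 \<le> 3^2\<close>.\<close>

lemma exp_half_pi_Im_shift:
  assumes "z \<in> cball w 1"
  shows "exp (pi * \<bar>Im z\<bar> / 2) \<le> 9 * exp (pi * \<bar>Im w\<bar> / 2)"
proof -
  have "\<bar>Im z - Im w\<bar> \<le> 1"
    using assms abs_Im_le_cmod[of "z - w"] by (simp add: dist_norm norm_minus_commute)
  then have "pi * \<bar>Im z\<bar> \<le> pi * (\<bar>Im w\<bar> + 1)" by (intro mult_left_mono) auto
  then have "pi * \<bar>Im z\<bar> / 2 \<le> pi * \<bar>Im w\<bar> / 2 + 2" using pi_less_4 by (simp add: algebra_simps)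
  then have "exp (pi * \<bar>Im z\<bar> / 2) \<le> exp (pi * \<bar>Im w\<bar> / 2 + 2)" by simp
  also have "\<dots> = exp (pi * \<bar>Im w\<bar> / 2) * exp 2" by (rule exp_add)
  also have "exp (2::real) \<le> 9"
  proof -
    have "exp (2::real) = exp 1 ^ 2" by (simp add: exp_of_nat_mult[symmetric])
    also have "\<dots> \<le> 3 ^ 2" using exp_le by (intro power_mono) auto
    finally show ?thesis by simp
  qed
  finally show ?thesis by simp
qed

text \<open>
  Since \<open>refl_L' = refl_lam * refl_L\<close>, each differentiation produces a factor \<open>refl_lam\<close>; the other terms are
  smaller by the factor \<open>1 / refl_lam\<close>, which tends to \<open>0\<close> as \<open>Re w\<close> grows. For \<open>k = 0\<close> the remainder is
  \<open>- 1 / refl_L\<close>, coming from the constant in \<open>eta - 1\<close>.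
\<close>
lemma eta_deriv_left:
  fixes \<epsilon> :: real
  assumes "\<epsilon> > 0"
  shows "\<exists>a R. a \<ge> 4 \<and> R holomorphic_on {w. Re w > a} \<and>
    (\<forall>w. Re w > a \<longrightarrow> Re (refl_lam w) \<ge> 1 \<and>
       eta_deriv k (1 - w) = (-1) ^ k * refl_L w * refl_lam w ^ k * (refl_P w + R w) \<and>
       norm (R w) \<le> \<epsilon> * exp (pi * \<bar>Im w\<bar> / 2))"
  using assms
proof (induction k arbitrary: \<epsilon>)
  case 0
  obtain a where a: "a \<ge> 1" "\<And>w. Re w \<ge> a \<Longrightarrow> norm (refl_L w) * exp (pi * \<bar>Im w\<bar> / 2) \<ge> 1 / \<epsilon>"
    using refl_L_large[of "1 / \<epsilon>"] by blast
  obtain b where b: "b \<ge> 1" "\<And>w. Re w \<ge> b \<Longrightarrow> Re (refl_lam w) \<ge> 1"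
    using refl_lam_large[of 1] by blast
  define c where "c = max 4 (max a b)"
  have c: "c \<ge> 4" "c \<ge> a" "c \<ge> b" by (auto simp: c_def)
  show ?case
  proof (rule exI[of _ c], rule exI[of _ "\<lambda>w. - 1 / refl_L w"], intro conjI allI impI)
    have "refl_L holomorphic_on {w. Re w > 0}"
      using refl_L_deriv by (intro holomorphic_onI) (auto simp: field_differentiable_def intro: has_field_derivative_at_within)
    then show "(\<lambda>w. - 1 / refl_L w) holomorphic_on {w. Re w > c}"
      using c refl_L_nonzero by (intro holomorphic_intros) (auto intro: holomorphic_on_subset)
    fix w assume w: "Re w > c"
    have L: "refl_L w \<noteq> 0" by (rule refl_L_nonzero) (use w c in auto)
    show "Re (refl_lam w) \<ge> 1" by (rule b(2)) (use w c in auto)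
    have "eta (1 - w) = refl_L w * refl_P w"
      using eta_reflection[of w] w c by (simp add: eta_refl_eq)
    then show "eta_deriv 0 (1 - w) = (- 1) ^ 0 * refl_L w * refl_lam w ^ 0 * (refl_P w + - 1 / refl_L w)"
      using L by (simp add: eta_deriv_def field_simps)
    have "norm (refl_L w) * exp (pi * \<bar>Im w\<bar> / 2) \<ge> 1 / \<epsilon>" by (rule a(2)) (use w c in auto)
    then show "norm (- 1 / refl_L w) \<le> \<epsilon> * exp (pi * \<bar>Im w\<bar> / 2)"
      using L 0 by (simp add: norm_divide field_simps)
  qed (use c in auto)
next
  case (Suc k)
  obtain a R where a: "a \<ge> 4" and R: "R holomorphic_on {w. Re w > a}"
    and aR: "\<And>w. Re w > a \<Longrightarrow> Re (refl_lam w) \<ge> 1"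
       "\<And>w. Re w > a \<Longrightarrow> eta_deriv k (1 - w) = (-1) ^ k * refl_L w * refl_lam w ^ k * (refl_P w + R w)"
       "\<And>w. Re w > a \<Longrightarrow> norm (R w) \<le> \<epsilon> / 2 * exp (pi * \<bar>Im w\<bar> / 2)"
    using Suc.IH[of "\<epsilon> / 2"] Suc.prems by auto
  obtain C where C: "C > 0" "\<And>w :: complex. Re w \<ge> 1 \<Longrightarrow> norm (Polygamma 1 w) \<le> C"
    using norm_trigamma_le by blast
  define H where "H = {w. Re w > a}"
  have opH: "open H" unfolding H_def by (rule open_halfspace_Re_gt)
  define T where "T = (\<lambda>w. refl_P w + R w)"
  have hT: "T holomorphic_on H"
    unfolding T_def H_def using R a by (intro holomorphic_intros holomorphic_refl_P) auto
  define B where "B = 2 + \<epsilon> / 2"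
  have B: "B > 0" using Suc.prems by (simp add: B_def)
  have TB: "norm (T w) \<le> B * exp (pi * \<bar>Im w\<bar> / 2)" if "w \<in> H" for w
  proof -
    have "norm (T w) \<le> norm (refl_P w) + norm (R w)" unfolding T_def by (rule norm_triangle_ineq)
    also have "\<dots> \<le> 2 * exp (pi * \<bar>Im w\<bar> / 2) + \<epsilon> / 2 * exp (pi * \<bar>Im w\<bar> / 2)"
      using that a by (intro add_mono norm_refl_P_le aR) (auto simp: H_def)
    finally show ?thesis by (simp add: B_def algebra_simps)
  qed
  \<comment> \<open>With \<open>refl_lam\<close> at least this large, the new error \<open>Q\<close>
    takes at most the other half of \<open>\<epsilon>\<close>. The term
    \<open>real k * C * B\<close> comes from differentiating the power of \<open>refl_lam\<close>,
    and \<open>9 * B\<close> from \<open>deriv T\<close> by Cauchy's inequality.\<close>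
  define M where "M = max 1 (2 * (real k * C * B + 9 * B) / \<epsilon>)"
  obtain b where b: "b \<ge> 1" "\<And>w. Re w \<ge> b \<Longrightarrow> Re (refl_lam w) \<ge> M"
    using refl_lam_large[of M] by blast
  \<comment> \<open>The margin \<open>1\<close> makes room for the unit disc around \<open>w\<close>
    inside \<open>H\<close>.\<close>
  define c where "c = max (a + 1) b"
  have c: "c \<ge> a + 1" "c \<ge> b" "c \<ge> 4" using a by (auto simp: c_def)
  define Q where "Q = (\<lambda>w. (of_nat k * Polygamma 1 w * T w / refl_lam w + deriv T w) / refl_lam w)"
  define R' where "R' = (\<lambda>w. R w + Q w)"
  have lamnz: "refl_lam w \<noteq> 0" if "Re w > a" for w using aR(1)[OF that] by auto
  show ?case
  proof (rule exI[of _ c], rule exI[of _ R'], intro conjI allI impI)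
    show "c \<ge> 4" by fact
    show "R' holomorphic_on {w. Re w > c}"
    proof -
      have 1: "R holomorphic_on {w. Re w > c}" by (rule holomorphic_on_subset[OF R]) (use c in auto)
      have 2: "T holomorphic_on {w. Re w > c}" by (rule holomorphic_on_subset[OF hT]) (use c in \<open>auto simp: H_def\<close>)
      have "deriv T holomorphic_on H" by (intro holomorphic_deriv hT opH)
      then have 3: "deriv T holomorphic_on {w. Re w > c}" by (rule holomorphic_on_subset) (use c in \<open>auto simp: H_def\<close>)
      have 4: "refl_lam holomorphic_on {w. Re w > c}" by (rule holomorphic_refl_lam) (use c in auto)
      have 5: "Polygamma 1 holomorphic_on {w. Re w > c}"
        by (rule holomorphic_on_Polygamma) (use c in \<open>auto elim!: nonpos_Ints_cases\<close>)
      show ?thesis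
        unfolding R'_def Q_def
        by (intro holomorphic_on_add holomorphic_on_divide holomorphic_on_mult holomorphic_on_const 1 2 3 4 5)
           (use lamnz c in auto)
    qed
    fix w assume w: "Re w > c"
    have wa: "Re w > a" "Re w > 0" "w \<in> H" using w c a by (auto simp: H_def)
    show "Re (refl_lam w) \<ge> 1" by (rule aR) fact
    note nz = lamnz[OF wa(1)]
    have dT: "(T has_field_derivative deriv T w) (at w)" by (rule holomorphic_derivI[OF hT opH]) fact
    have "((\<lambda>w. (-1) ^ k * (refl_L w * (refl_lam w ^ k * T w))) has_field_derivative
       (-1) ^ k * (refl_lam w * refl_L w * (refl_lam w ^ k * T w) + ((of_nat k * (Polygamma 1 w * refl_lam w ^ (k - Suc 0))) * T w + deriv T w * refl_lam w ^ k) * refl_L w)) (at w)"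
      by (intro DERIV_cmult DERIV_mult refl_L_deriv dT DERIV_power refl_lam_deriv wa)
    then have 1: "((\<lambda>w. eta_deriv k (1 - w)) has_field_derivative
       (-1) ^ k * (refl_lam w * refl_L w * (refl_lam w ^ k * T w) + ((of_nat k * (Polygamma 1 w * refl_lam w ^ (k - Suc 0))) * T w + deriv T w * refl_lam w ^ k) * refl_L w)) (at w)"
      by (rule has_field_derivative_transform_within_open[OF _ opH wa(3)])
         (use aR(2) in \<open>auto simp: H_def T_def mult_ac\<close>)
    have 2: "((\<lambda>w. eta_deriv k (1 - w)) has_field_derivative eta_deriv (Suc k) (1 - w) * (- 1)) (at w)"
      by (rule DERIV_chain2[OF deriv_eta_deriv]) (auto intro!: derivative_eq_intros)
    \<comment> \<open>The truncated exponent \<open>k - Suc 0\<close> is harmless: for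
      \<open>k = 0\<close> both sides vanish.\<close>
    have 3: "of_nat k * (Polygamma 1 w * refl_lam w ^ (k - Suc 0)) = of_nat k * Polygamma 1 w * refl_lam w ^ k / refl_lam w"
      using nz by (cases k) auto
    have neg: "y = - x" if "y * (- 1) = x" for x y :: complex using that by auto
    have "eta_deriv (Suc k) (1 - w) = - ((-1) ^ k * (refl_lam w * refl_L w * (refl_lam w ^ k * T w) + ((of_nat k * Polygamma 1 w * refl_lam w ^ k / refl_lam w) * T w + deriv T w * refl_lam w ^ k) * refl_L w))"
      using neg[OF DERIV_unique[OF 2 1]] unfolding 3 .
    also have "\<dots> = (-1) ^ Suc k * refl_L w * refl_lam w ^ Suc k * (T w + Q w)"
      using nz by (simp add: Q_def field_simps)
    finally show "eta_deriv (Suc k) (1 - w) = (-1) ^ Suc k * refl_L w * refl_lam w ^ Suc k * (refl_P w + R' w)"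
      by (simp add: T_def R'_def add.assoc)
    define E where "E = exp (pi * \<bar>Im w\<bar> / 2)"
    have E: "E > 0" by (simp add: E_def)
    have lamM: "norm (refl_lam w) \<ge> M" using b(2)[of w] complex_Re_le_cmod[of "refl_lam w"] w c by auto
    then have lam1: "norm (refl_lam w) \<ge> 1" by (simp add: M_def)
    have dTB: "norm (deriv T w) \<le> B * (9 * E)"
    proof (rule norm_deriv_le_unit_disc[OF hT opH])
      show "cball w 1 \<subseteq> H"
      proof
        fix z assume "z \<in> cball w 1"
        then have "\<bar>Re (w - z)\<bar> \<le> 1" using abs_Re_le_cmod[of "w - z"] by (simp add: dist_norm)
        then show "z \<in> H" using w c by (simp add: H_def)
      qed
      fix z assume z: "z \<in> cball w 1"
      then have "z \<in> H" using \<open>cball w 1 \<subseteq> H\<close> by blast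
      then have "norm (T z) \<le> B * exp (pi * \<bar>Im z\<bar> / 2)" by (rule TB)
      also have "\<dots> \<le> B * (9 * E)" unfolding E_def using B by (intro mult_left_mono exp_half_pi_Im_shift z) auto
      finally show "norm (T z) \<le> B * (9 * E)" .
    qed
    have "norm (of_nat k * Polygamma 1 w * T w / refl_lam w) \<le> real k * C * (B * E) / 1"
      unfolding norm_divide norm_mult
      using C(2)[of w] TB[OF wa(3)] lam1 w c C(1) B E by (intro frac_le mult_mono) (auto simp: E_def)
    then have "norm (of_nat k * Polygamma 1 w * T w / refl_lam w + deriv T w) \<le> real k * C * (B * E) + B * (9 * E)"
      using dTB norm_triangle_ineq[of "of_nat k * Polygamma 1 w * T w / refl_lam w" "deriv T w"] by simp
    also have "\<dots> = (real k * C * B + 9 * B) * E" by (simp add: algebra_simps)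
    finally have "norm (Q w) \<le> (real k * C * B + 9 * B) * E / norm (refl_lam w)"
      unfolding Q_def norm_divide[of _ "refl_lam w"] by (rule divide_right_mono) auto
    also have "\<dots> \<le> \<epsilon> / 2 * E"
    proof -
      have "2 * (real k * C * B + 9 * B) / \<epsilon> \<le> norm (refl_lam w)" using lamM by (simp add: M_def)
      then have "real k * C * B + 9 * B \<le> \<epsilon> / 2 * norm (refl_lam w)" using Suc.prems by (simp add: field_simps)
      then have "(real k * C * B + 9 * B) * E \<le> (\<epsilon> / 2 * norm (refl_lam w)) * E" using E by (intro mult_right_mono) auto
      moreover have "norm (refl_lam w) > 0" using lam1 by linarith
      ultimately show ?thesis by (subst pos_divide_le_eq) (simp_all only: mult_ac)
    qed
    finally have "norm (Q w) \<le> \<epsilon> / 2 * E" .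
    moreover have "norm (R w) \<le> \<epsilon> / 2 * E" unfolding E_def by (rule aR) fact
    ultimately have "norm (R' w) \<le> \<epsilon> / 2 * E + \<epsilon> / 2 * E"
      unfolding R'_def using norm_triangle_ineq[of "R w" "Q w"] by linarith
    then show "norm (R' w) \<le> \<epsilon> * exp (pi * \<bar>Im w\<bar> / 2)" by (simp add: E_def)
  qed
qed

section \<open>Location of the zeros in the left half plane\<close>

lemma cos_half_pi_nonzero:
  assumes "Im w \<noteq> 0"
  shows "cos (of_real pi * w / 2) \<noteq> 0"
proof
  assume "cos (of_real pi * w / 2) = 0"
  then obtain n where "of_real pi * w / 2 = of_real (real_of_int n * pi) + of_real pi / 2"
    unfolding cos_eq_0 by blast
  then have "Im (of_real pi * w / 2) = Im (of_real (real_of_int n * pi) + of_real pi / 2)" by (simp only:)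
  then show False using assms by simp
qed

lemma refl_P_nonzero:
  assumes "Re w > 1" "Im w \<noteq> 0"
  shows "refl_P w \<noteq> 0"
proof -
  have "cos (of_real pi * w / 2) \<noteq> 0" by (rule cos_half_pi_nonzero) fact
  moreover have "odd_zeta w \<noteq> 0"
  proof -
    have "1 - 2 powr (- w) \<noteq> (0::complex)"
    proof -
      have "norm (2 powr (- w) :: complex) = 2 powr (- Re w)" using norm_of_nat_powr[of 2 "- w"] by simp
      also have "\<dots> < 1" using assms by (simp add: powr_less_one)
      finally show ?thesis by auto
    qed
    moreover have "zeta w \<noteq> 0" using assms by (intro zeta_nonzero_Re_ge_1) auto
    ultimately show ?thesis using odd_zeta_conv_zeta[of w] assms by simp
  qed
  ultimately show ?thesis by (simp add: refl_P_def)
qed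

text \<open>The functional equation is known so far for \<open>Re s < 0\<close>, and the line
  \<open>Re s = 0\<close> is needed as well. With \<open>(1 - 2 powr (- w)) * zeta w\<close> in
  place of \<open>odd_zeta w\<close> it continues to \<open>Re w > 0\<close>,
  \<open>w \<noteq> 1\<close>, and for \<open>Re w \<ge> 1\<close> off the real axis no factor
  vanishes.\<close>

lemma zeta_nonzero_outside_strip:
  assumes "Im s \<noteq> 0" "Re s \<le> 0"
  shows "zeta s \<noteq> 0"
proof -
  define g where "g = (\<lambda>w. refl_L w * cos (of_real pi * w / 2) * ((1 - 2 powr (- w)) * zeta w))"
  define S where "S = {w. Re w > 0} - {1::complex}"
  have eq: "eta (1 - w) = g w" if "w \<in> S" for w
  proof (rule analytic_continuation_open[where f = "\<lambda>w. eta (1 - w)" and g = g and s = "{w. Re w > 1}" and s' = S])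
    show "open {w. Re w > 1}" by (rule open_halfspace_Re_gt)
    have "2 \<in> {w. Re w > 1}" by simp
    then show "{w. Re w > 1} \<noteq> {}" by blast
    show "open S" unfolding S_def by (intro open_Diff open_halfspace_Re_gt) auto
    show "connected S" unfolding S_def
      by (rule connected_open_delete) (auto intro: open_halfspace_Re_gt convex_connected convex_halfspace_Re_gt)
    have "(eta \<circ> (\<lambda>w. 1 - w)) holomorphic_on S"
      by (rule holomorphic_on_compose) (auto intro!: holomorphic_intros holomorphic_eta)
    then show "(\<lambda>w. eta (1 - w)) holomorphic_on S" by (simp add: o_def)
    have "refl_L holomorphic_on S"
      using refl_L_deriv by (intro holomorphic_onI) (auto simp: S_def field_differentiable_def intro: has_field_derivative_at_within)
    then show "g holomorphic_on S" unfolding g_def by (intro holomorphic_intros holomorphic_zeta) (auto simp: S_def)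
    fix w :: complex assume "w \<in> {w. Re w > 1}"
    then show "eta (1 - w) = g w"
      using eta_reflection[of w] odd_zeta_conv_zeta[of w] by (simp add: g_def eta_refl_eq refl_P_def mult_ac)
  qed (use that in \<open>auto simp: S_def\<close>)
  define w where "w = 1 - s"
  have w: "Re w \<ge> 1" "Im w \<noteq> 0" using assms by (auto simp: w_def)
  then have wS: "w \<in> S" "w \<noteq> 1" by (auto simp: S_def)
  have "eta s = g w" using eq[OF wS(1)] by (simp add: w_def)
  moreover have "g w \<noteq> 0"
  proof -
    have "refl_L w \<noteq> 0" using w by (intro refl_L_nonzero) auto
    moreover have "cos (of_real pi * w / 2) \<noteq> 0" by (rule cos_half_pi_nonzero) fact
    moreover have "1 - 2 powr (- w) \<noteq> (0::complex)"
    proof -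
      have "norm (2 powr (- w) :: complex) = 2 powr (- Re w)" using norm_of_nat_powr[of 2 "- w"] by simp
      also have "\<dots> < 1" using w by (simp add: powr_less_one)
      finally show ?thesis by auto
    qed
    moreover have "zeta w \<noteq> 0" using w wS by (intro zeta_nonzero_Re_ge_1) auto
    ultimately show ?thesis by (simp add: g_def)
  qed
  ultimately have "eta s \<noteq> 0" by simp
  then show ?thesis using eta_conv_zeta[of s] assms by (cases "s = 1") auto
qed

text \<open>The square of the norm of \<open>cos (x + \<i> * y)\<close> is
  \<open>cos x ^ 2 + sinh y ^ 2\<close>. If the norm is small relative to
  \<open>exp \<bar>y\<bar>\<close>, then \<open>y\<close> is bounded and
  \<open>\<bar>sin x\<bar>\<close> is at least \<open>1 / 2\<close>, so the imaginary part, of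
  modulus \<open>\<bar>sin x * sinh y\<bar>\<close>, is at least
  \<open>\<bar>y\<bar> / 4\<close>.\<close>

lemma Im_cos_lower_bound_near_zero:
  fixes x y e :: real
  assumes e: "0 < e" "e \<le> 1 / 500"
    and le: "norm (cos (Complex x y)) \<le> e * exp \<bar>y\<bar>"
  shows "\<bar>Im (cos (Complex x y))\<bar> \<ge> \<bar>y\<bar> / 4" "exp \<bar>y\<bar> \<le> 2"
proof -
  define u where "u = exp \<bar>y\<bar>"
  \<comment> \<open>\<open>S\<close> is \<open>- sinh y\<close> and \<open>C\<close> is
    \<open>cosh y\<close>; the sign comes from the imaginary part of the cosine.\<close>
  define S where "S = (exp (- y) - exp y) / 2"
  define C where "C = (exp y + exp (- y)) / 2"
  have u1: "u \<ge> 1 + \<bar>y\<bar>" unfolding u_def by (rule exp_ge_add_one_self)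
  have u0: "u \<ge> 1" using u1 by simp
  have iu: "1 / u = exp (- \<bar>y\<bar>)" by (simp add: u_def exp_minus divide_inverse)
  have S: "\<bar>S\<bar> = (u - 1 / u) / 2"
  proof (cases "y \<ge> 0")
    case True
    then have "S \<le> 0" by (simp add: S_def)
    then have "\<bar>S\<bar> = - S" by simp
    then show ?thesis unfolding iu using True by (simp add: S_def u_def)
  next
    case False
    then have "S \<ge> 0" by (simp add: S_def)
    then have "\<bar>S\<bar> = S" by simp
    then show ?thesis unfolding iu using False by (simp add: S_def u_def)
  qed
  have CS: "C\<^sup>2 = 1 + S\<^sup>2"
  proof -
    have "p * q = 1 \<Longrightarrow> ((p + q) / 2)\<^sup>2 = 1 + ((q - p) / 2)\<^sup>2" for p q :: real
      by (simp add: power2_eq_square field_simps)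
    moreover have "exp y * exp (- y) = 1" by (simp add: exp_minus)
    ultimately show ?thesis unfolding C_def S_def by blast
  qed
  have R: "Re (cos (Complex x y)) = cos x * C" and I: "Im (cos (Complex x y)) = sin x * S"
    by (simp_all add: Re_cos Im_cos C_def S_def)
  have "(norm (cos (Complex x y)))\<^sup>2 = (cos x)\<^sup>2 * C\<^sup>2 + (sin x)\<^sup>2 * S\<^sup>2"
    unfolding cmod_power2 R I by (simp add: power_mult_distrib)
  also have "\<dots> = (cos x)\<^sup>2 + ((cos x)\<^sup>2 + (sin x)\<^sup>2) * S\<^sup>2"
    unfolding CS by (simp only: ring_distribs mult_1_right add.assoc)
  finally have n: "(norm (cos (Complex x y)))\<^sup>2 = (cos x)\<^sup>2 + S\<^sup>2" by simp
  have sq: "(norm (cos (Complex x y)))\<^sup>2 \<le> (e * u)\<^sup>2" unfolding u_def using le by (intro power_mono) auto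
  then have "S\<^sup>2 \<le> (e * u)\<^sup>2" using n zero_le_power2[of "cos x"] by linarith
  then have "\<bar>S\<bar> \<le> \<bar>e * u\<bar>" by (simp only: abs_le_square_iff)
  then have "\<bar>S\<bar> \<le> e * u" using e u0 by simp
  then have "u - 1 / u \<le> 2 * e * u" unfolding S by simp
  then have "u * u - 1 \<le> 2 * e * (u * u)" using u0 by (simp add: field_simps)
  then have "(1 - 2 * e) * (u * u) \<le> 1" by (simp add: algebra_simps)
  moreover have "(1 / 2) * (u * u) \<le> (1 - 2 * e) * (u * u)" using e by (intro mult_right_mono) auto
  ultimately have uu: "u * u \<le> 2" by simp
  have "u * 1 \<le> u * u" using u0 by (intro mult_left_mono) auto
  then have "u \<le> 2" using uu by linarith
  then show "exp \<bar>y\<bar> \<le> 2" by (simp add: u_def)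
  have "(cos x)\<^sup>2 \<le> (e * u)\<^sup>2" using sq n zero_le_power2[of S] by linarith
  also have "\<dots> = e\<^sup>2 * (u * u)" by (simp add: power2_eq_square)
  also have "\<dots> \<le> (1 / 500)\<^sup>2 * 2" using e uu by (intro mult_mono power_mono) auto
  also have "\<dots> \<le> 3 / 4" by (simp add: power2_eq_square)
  finally have "(1 / 2)\<^sup>2 \<le> (sin x)\<^sup>2" using sin_cos_squared_add[of x] by (simp add: power2_eq_square)
  then have "\<bar>1 / 2 :: real\<bar> \<le> \<bar>sin x\<bar>" by (simp only: abs_le_square_iff)
  then have sx: "1 / 2 \<le> \<bar>sin x\<bar>" by simp
  have "\<bar>y\<bar> / 2 \<le> \<bar>S\<bar>"
  proof -
    have "1 / u \<le> 1" using u0 by simp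
    moreover have "p \<le> 1 \<Longrightarrow> \<bar>y\<bar> / 2 \<le> (u - p) / 2" for p using u1 by simp
    ultimately show ?thesis unfolding S by blast
  qed
  then have "1 / 2 * (\<bar>y\<bar> / 2) \<le> \<bar>sin x\<bar> * \<bar>S\<bar>" using sx by (intro mult_mono) auto
  then show "\<bar>Im (cos (Complex x y))\<bar> \<ge> \<bar>y\<bar> / 4" unfolding I by (simp add: abs_mult)
qed

text \<open>
  At a zero \<open>w\<close>, and hence at \<open>cnj w\<close>, the function \<open>cos (pi w / 2)\<close> equals \<open>- E\<close> with \<open>E\<close> and its derivative small.
  Its values at \<open>w\<close> and \<open>cnj w\<close> differ by a multiple of \<open>Im w\<close> that is too large for this.
\<close>
lemma eta_deriv_zeros_left_real:
  obtains a where "a \<ge> 4" "\<And>w. Re w > a \<Longrightarrow> eta_deriv k (1 - w) = 0 \<Longrightarrow> Im w = 0"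
proof -
  \<comment> \<open>Chosen so that \<open>2 * \<epsilon>\<close> is the threshold
    \<open>1 / 500\<close> of the cosine lemma; the final contradiction also needs
    \<open>72 * \<epsilon> < pi / 4\<close>.\<close>
  define \<epsilon> :: real where "\<epsilon> = 1 / 1000"
  obtain a R where a: "a \<ge> 4" and R: "R holomorphic_on {w. Re w > a}"
    and aR: "\<And>w. Re w > a \<Longrightarrow> Re (refl_lam w) \<ge> 1"
       "\<And>w. Re w > a \<Longrightarrow> eta_deriv k (1 - w) = (-1) ^ k * refl_L w * refl_lam w ^ k * (refl_P w + R w)"
       "\<And>w. Re w > a \<Longrightarrow> norm (R w) \<le> \<epsilon> * exp (pi * \<bar>Im w\<bar> / 2)"
    using eta_deriv_left[of \<epsilon> k] by (auto simp: \<epsilon>_def)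
  define H where "H = {w. Re w > a}"
  have opH: "open H" unfolding H_def by (rule open_halfspace_Re_gt)
  define E where "E = (\<lambda>w. R w / odd_zeta w)"
  have oz: "odd_zeta w \<noteq> 0" if "w \<in> H" for w using odd_zeta_bounds(1)[of w] that a by (auto simp: H_def)
  have hE: "E holomorphic_on H" unfolding E_def
    using R oz a by (intro holomorphic_intros holomorphic_on_subset[OF holomorphic_odd_zeta]) (auto simp: H_def)
  have Eb: "norm (E w) \<le> 2 * \<epsilon> * exp (pi * \<bar>Im w\<bar> / 2)" if "w \<in> H" for w
  proof -
    have "norm (E w) = norm (R w) / norm (odd_zeta w)" by (simp add: E_def norm_divide)
    also have "\<dots> \<le> (\<epsilon> * exp (pi * \<bar>Im w\<bar> / 2)) / (1 / 2)"
      using aR(3)[of w] odd_zeta_bounds(1)[of w] that a by (intro frac_le) (auto simp: H_def \<epsilon>_def)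
    finally show ?thesis by simp
  qed
  have zero: "cos (of_real pi * w / 2) + E w = 0" if "w \<in> H" "eta_deriv k (1 - w) = 0" for w
  proof -
    have "refl_lam w \<noteq> 0" using aR(1)[of w] that by (auto simp: H_def)
    moreover have "refl_L w \<noteq> 0" using that a by (intro refl_L_nonzero) (auto simp: H_def)
    ultimately have "refl_P w + R w = 0" using aR(2)[of w] that by (auto simp: H_def)
    then show ?thesis using oz[OF that(1)] by (simp add: refl_P_def E_def field_simps)
  qed
  have "Im w = 0" if w: "Re w > a + 1" and z: "eta_deriv k (1 - w) = 0" for w
  proof (rule ccontr)
    assume t: "Im w \<noteq> 0"
    define x y where "x = pi * Re w / 2" and "y = pi * Im w / 2"
    have wH: "w \<in> H" "cnj w \<in> H" using w by (auto simp: H_def)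
    have ey: "exp (pi * \<bar>Im w\<bar> / 2) = exp \<bar>y\<bar>" by (simp add: y_def abs_mult)
    have cw: "of_real pi * w / 2 = Complex x y" by (simp add: complex_eq_iff x_def y_def)
    have ccw: "of_real pi * cnj w / 2 = cnj (Complex x y)" by (simp add: complex_eq_iff x_def y_def)
    have cnj: "cos (cnj z) = cnj (cos z)" for z
      by (simp add: complex_eq_iff Re_cos Im_cos field_simps)
    have z1: "cos (Complex x y) = - E w"
      using zero[OF wH(1) z] unfolding cw by (simp add: add_eq_0_iff2)
    have "eta_deriv k (1 - cnj w) = 0" using eta_deriv_cnj[of k "1 - w"] z by simp
    then have z2: "cnj (cos (Complex x y)) = - E (cnj w)"
      using zero[OF wH(2)] unfolding ccw cnj by (simp add: add_eq_0_iff2)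
    have "norm (cos (Complex x y)) \<le> 2 * \<epsilon> * exp \<bar>y\<bar>"
      using Eb[OF wH(1)] unfolding z1 ey by simp
    note aux = Im_cos_lower_bound_near_zero[OF _ _ this]
    have aux: "\<bar>y\<bar> / 4 \<le> \<bar>Im (cos (Complex x y))\<bar>" "exp \<bar>y\<bar> \<le> 2" 
      using aux(1,2) by (auto simp: \<epsilon>_def)
    \<comment> \<open>A convex set containing \<open>w\<close> and \<open>cnj w\<close> in which
      imaginary parts do not exceed that of \<open>w\<close>, so that the exponential stays at most
      \<open>2\<close> throughout.\<close>
    define V where "V = {z. Re z > a + 1 \<and> \<bar>Im z\<bar> \<le> \<bar>Im w\<bar>}"
    have "V = {z. Re z > a + 1} \<inter> {z. Im z \<le> \<bar>Im w\<bar>} \<inter> {z. Im z \<ge> - \<bar>Im w\<bar>}" by (auto simp: V_def)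
    then have cV: "convex V" by (auto intro!: convex_Int convex_halfspace_Re_gt convex_halfspace_Im_le convex_halfspace_Im_ge)
    \<comment> \<open>The constant is \<open>2 * 9 * 2\<close>: the bound for \<open>E\<close>, the
      shift within the unit disc, and the bound for the exponential.\<close>
    have "norm (E w - E (cnj w)) \<le> 36 * \<epsilon> * norm (w - cnj w)"
    proof (rule field_differentiable_bound[OF cV])
      fix z assume zV: "z \<in> V"
      then have zH: "z \<in> H" by (auto simp: V_def H_def)
      show "(E has_field_derivative deriv E z) (at z within V)"
        using holomorphic_derivI[OF hE opH zH] by (rule has_field_derivative_at_within)
      show "norm (deriv E z) \<le> 36 * \<epsilon>"
      proof (rule norm_deriv_le_unit_disc[OF hE opH])
        show sub: "cball z 1 \<subseteq> H"
        proof
          fix v assume "v \<in> cball z 1"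
          then have "\<bar>Re (z - v)\<bar> \<le> 1" using abs_Re_le_cmod[of "z - v"] by (simp add: dist_norm)
          then show "v \<in> H" using zV by (auto simp: H_def V_def)
        qed
        fix v assume v: "v \<in> cball z 1"
        have "norm (E v) \<le> 2 * \<epsilon> * exp (pi * \<bar>Im v\<bar> / 2)" using v sub by (intro Eb) auto
        also have "\<dots> \<le> 2 * \<epsilon> * (9 * exp (pi * \<bar>Im z\<bar> / 2))"
          by (intro mult_left_mono exp_half_pi_Im_shift v) (simp add: \<epsilon>_def)
        also have "\<dots> \<le> 2 * \<epsilon> * (9 * exp (pi * \<bar>Im w\<bar> / 2))"
          using zV by (intro mult_left_mono) (auto simp: \<epsilon>_def V_def)
        also have "\<dots> \<le> 2 * \<epsilon> * (9 * 2)" unfolding ey using aux(2) by (intro mult_left_mono) (auto simp: \<epsilon>_def)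
        finally show "norm (E v) \<le> 36 * \<epsilon>" by simp
      qed
    qed (use w in \<open>auto simp: V_def\<close>)
    also have "norm (w - cnj w) = 2 * \<bar>Im w\<bar>" by (simp add: complex_diff_cnj norm_mult)
    finally have "norm (E w - E (cnj w)) \<le> 72 * \<epsilon> * \<bar>Im w\<bar>" by simp
    moreover have "norm (E w - E (cnj w)) = 2 * \<bar>Im (cos (Complex x y))\<bar>"
    proof -
      have e1: "E w = - cos (Complex x y)" by (simp only: z1 minus_minus)
      have e2: "E (cnj w) = - cnj (cos (Complex x y))" by (simp only: z2 minus_minus)
      have "E w - E (cnj w) = - (cos (Complex x y) - cnj (cos (Complex x y)))"
        unfolding e1 e2 by simp
      also have "\<dots> = - (of_real (2 * Im (cos (Complex x y))) * \<i>)"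
        by (subst complex_diff_cnj) simp
      finally show ?thesis by (simp only: norm_minus_cancel norm_mult norm_of_real norm_ii abs_mult abs_numeral mult_1_right)
    qed
    ultimately have "\<bar>y\<bar> / 2 \<le> 72 * \<epsilon> * \<bar>Im w\<bar>" using aux(1) by simp
    moreover have "\<bar>y\<bar> = pi / 2 * \<bar>Im w\<bar>" by (simp add: y_def abs_mult)
    ultimately have "pi / 4 * \<bar>Im w\<bar> \<le> 72 * \<epsilon> * \<bar>Im w\<bar>" by simp
    then have "pi / 4 \<le> 72 * \<epsilon>" using t by simp
    then show False using pi_ge_two by (simp add: \<epsilon>_def)
  qed
  then show ?thesis using that[of "a + 1"] a by simp
qed

section \<open>The derivatives of eta in the right half plane and in vertical strips\<close>

text \<open>Taking out \<open>3 powr (- (Re s - 2))\<close> leaves a sum dominated by inverse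
  squares. The constant is \<open>3^2\<close> times the bound \<open>2\<close> for
  \<open>pi^2 / 6\<close>.\<close>

lemma eta_tail_bound:
  assumes "Re s \<ge> 2"
  shows "norm (eta s - 1 + 2 powr (- s)) \<le> 18 * 3 powr (- Re s)"
proof -
  have "(\<lambda>n. (-1) ^ Suc (Suc n) * of_nat (Suc (Suc (Suc n))) powr (- s)) sums (eta s - 1 + 2 powr (- s))"
  proof -
    have "(\<lambda>n. (-1) ^ n * of_nat (Suc n) powr (- s)) sums eta s" by (rule eta_sums) (use assms in auto)
    then have "(\<lambda>n. (-1) ^ Suc n * of_nat (Suc (Suc n)) powr (- s)) sums (eta s - 1)"
      by (subst sums_Suc_iff) simp
    then show ?thesis by (subst sums_Suc_iff[of "\<lambda>n. (-1) ^ Suc n * of_nat (Suc (Suc n)) powr (- s)"]) (simp add: numeral_2_eq_2[symmetric])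
  qed
  then have eq: "eta s - 1 + 2 powr (- s) = (\<Sum>n. (-1) ^ Suc (Suc n) * of_nat (Suc (Suc (Suc n))) powr (- s))"
    by (rule sums_unique)
  have "norm (eta s - 1 + 2 powr (- s)) \<le> (\<Sum>n. 9 * 3 powr (- Re s) * real (Suc n) powr (- 2))"
    unfolding eq
  proof (rule norm_suminf_le)
    show "summable (\<lambda>n. 9 * 3 powr (- Re s) * real (Suc n) powr (- 2))"
      by (intro summable_mult sums_summable[OF inverse_squares_sums'])
    fix n
    have "norm ((-1) ^ Suc (Suc n) * of_nat (Suc (Suc (Suc n))) powr (- s) :: complex) = real (Suc (Suc (Suc n))) powr (- Re s)"
      by (simp only: norm_mult norm_power norm_minus_cancel norm_one power_one mult_1_left) (subst norm_of_nat_powr, auto)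
    also have "\<dots> = real (Suc (Suc (Suc n))) powr (- (Re s - 2)) * real (Suc (Suc (Suc n))) powr (- 2)"
      by (subst powr_add[symmetric]) simp
    also have "\<dots> \<le> 3 powr (- (Re s - 2)) * real (Suc n) powr (- 2)"
      using assms by (intro mult_mono powr_mono2') auto
    also have "3 powr (- (Re s - 2)) = 9 * 3 powr (- Re s)"
    proof -
      have "- (Re s - 2) = 2 + - Re s" by simp
      then have "3 powr (- (Re s - 2)) = 3 powr 2 * 3 powr (- Re s)" by (simp only: powr_add)
      then show ?thesis by simp
    qed
    finally show "norm ((-1) ^ Suc (Suc n) * of_nat (Suc (Suc (Suc n))) powr (- s) :: complex) \<le> 9 * 3 powr (- Re s) * real (Suc n) powr (- 2)" .
  qed
  also have "\<dots> = 9 * 3 powr (- Re s) * (pi\<^sup>2 / 6)"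
    using sums_unique[OF sums_mult[OF inverse_squares_sums', of "9 * 3 powr (- Re s)"]] by simp
  also have "\<dots> \<le> 9 * 3 powr (- Re s) * 2"
  proof (rule mult_left_mono)
    have "pi \<le> 3.2" using pi_approx by simp
    then have "pi\<^sup>2 \<le> 3.2\<^sup>2" by (intro power_mono) auto
    then show "pi\<^sup>2 / 6 \<le> 2" by (simp add: power2_eq_square)
  qed auto
  finally show ?thesis by simp
qed

text \<open>The coefficient of \<open>2 powr (- s)\<close> in the Dirichlet series of
  \<open>eta_deriv k\<close>, the leading one because the constant term \<open>1\<close> is gone for
  every \<open>k\<close>.\<close>

definition right_coeff :: "nat \<Rightarrow> complex" where
  "right_coeff k = - ((- of_real (ln 2)) ^ k)"

lemma right_coeff_nonzero: "right_coeff k \<noteq> 0"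
  by (simp add: right_coeff_def)

lemma two_powr_has_field_derivative:
  "((\<lambda>s. 2 powr s) has_field_derivative of_real (ln 2) * 2 powr s) (at s)" for s :: complex
proof -
  have "((\<lambda>s. exp (s * of_real (ln 2))) has_field_derivative of_real (ln 2) * exp (s * of_real (ln 2))) (at s)"
    by (auto intro!: derivative_eq_intros)
  moreover have "(\<lambda>s. 2 powr s) = (\<lambda>s. exp (s * of_real (ln 2)) :: complex)"
  proof
    fix s :: complex
    have "Ln (2::complex) = of_real (ln 2)" using Ln_of_real[of 2] by simp
    then show "2 powr s = exp (s * of_real (ln 2))" by (simp add: powr_def)
  qed
  ultimately show ?thesis by (simp only:)
qed

text \<open>If \<open>u\<close> is the error for \<open>k\<close>, the error for
  \<open>Suc k\<close> is \<open>deriv u - ln 2 * u\<close>, so the decay is inherited through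
  Cauchy's inequality while the half plane recedes by \<open>1\<close>. The rate
  \<open>2 / 3\<close> is that of the third term of the series against the second.\<close>

lemma eta_deriv_right:
  "\<exists>K. \<forall>s. Re s \<ge> 2 + real k \<longrightarrow> norm (eta_deriv k s * 2 powr s - right_coeff k) \<le> K * (2 / 3) powr (Re s)"
proof (induction k)
  case 0
  have "norm (eta_deriv 0 s * 2 powr s - right_coeff 0) \<le> 18 * (2 / 3) powr (Re s)" if "Re s \<ge> 2" for s
  proof -
    have n2: "norm (2 powr s :: complex) = 2 powr (Re s)" using norm_of_nat_powr[of 2 s] by simp
    have "2 powr (- s) * 2 powr s = (1::complex)" by (simp add: powr_minus)
    then have "eta_deriv 0 s * 2 powr s - right_coeff 0 = (eta s - 1 + 2 powr (- s)) * 2 powr s"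
      by (simp add: eta_deriv_def right_coeff_def algebra_simps)
    then have "norm (eta_deriv 0 s * 2 powr s - right_coeff 0) \<le> (18 * 3 powr (- Re s)) * 2 powr (Re s)"
      unfolding norm_mult n2[symmetric] using eta_tail_bound[OF that] by (simp add: norm_mult mult_right_mono)
    also have "\<dots> = 18 * (2 / 3) powr (Re s)" 
    proof -
      have "(2 / 3) powr (Re s) = 2 powr (Re s) / 3 powr (Re s)" by (rule powr_divide)
      moreover have "3 powr (- Re s) = 1 / 3 powr (Re s)" by (rule powr_minus_divide)
      ultimately show ?thesis by simp
    qed
    finally show ?thesis .
  qed
  then show ?case by auto
next
  case (Suc k)
  then obtain K where K: "\<And>s. Re s \<ge> 2 + real k \<Longrightarrow> norm (eta_deriv k s * 2 powr s - right_coeff k) \<le> K * (2 / 3) powr (Re s)"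
    by blast
  define u where "u = (\<lambda>s. eta_deriv k s * 2 powr s - right_coeff k)"
  have K0: "K \<ge> 0"
  proof -
    have "0 \<le> K * (2 / 3) powr (2 + real k)" using K[of "of_real (2 + real k)"] norm_ge_zero order_trans
      by (metis Re_complex_of_real order_refl)
    then show ?thesis by (simp add: zero_le_mult_iff)
  qed
  have hu: "u holomorphic_on UNIV" unfolding u_def by (intro holomorphic_intros holomorphic_eta_deriv)
  have "norm (eta_deriv (Suc k) s * 2 powr s - right_coeff (Suc k)) \<le> (2 * K + K) * (2 / 3) powr (Re s)"
    if s: "Re s \<ge> 2 + real (Suc k)" for s
  proof -
    have "(u has_field_derivative (eta_deriv (Suc k) s * 2 powr s + of_real (ln 2) * 2 powr s * eta_deriv k s) - 0) (at s)"
      unfolding u_def by (intro DERIV_diff DERIV_mult deriv_eta_deriv two_powr_has_field_derivative DERIV_const)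
    then have "deriv u s = eta_deriv (Suc k) s * 2 powr s + of_real (ln 2) * 2 powr s * eta_deriv k s"
      by (simp add: DERIV_imp_deriv)
    then have eq: "eta_deriv (Suc k) s * 2 powr s - right_coeff (Suc k) = deriv u s - of_real (ln 2) * u s"
      by (simp add: u_def right_coeff_def algebra_simps)
    have "norm (deriv u s) \<le> 2 * K * (2 / 3) powr (Re s)"
    proof (rule norm_deriv_le_unit_disc[OF hu])
      fix z assume "z \<in> cball s 1"
      then have "\<bar>Re (s - z)\<bar> \<le> 1" using abs_Re_le_cmod[of "s - z"] by (simp add: dist_norm)
      then have z: "Re z \<ge> Re s - 1" by simp
      have "norm (u z) \<le> K * (2 / 3) powr (Re z)" unfolding u_def by (rule K) (use z s in auto)
      also have "\<dots> \<le> K * (2 / 3) powr (Re s - 1)"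
        using z K0 by (intro mult_left_mono powr_mono') auto
      also have "(2 / 3) powr (Re s - 1) = (3 / 2) * (2 / 3) powr (Re s)" by (simp add: powr_diff)
      also have "K * ((3 / 2) * (2 / 3) powr (Re s)) \<le> K * (2 * (2 / 3) powr (Re s))"
        using K0 by (intro mult_left_mono mult_right_mono) auto
      finally show "norm (u z) \<le> 2 * K * (2 / 3) powr (Re s)" by simp
    qed auto
    moreover have "norm (of_real (ln 2) * u s) \<le> 1 * (K * (2 / 3) powr (Re s))"
      unfolding norm_mult
    proof (intro mult_mono)
      show "norm (u s) \<le> K * (2 / 3) powr (Re s)" unfolding u_def by (rule K) (use s in auto)
      show "norm (complex_of_real (ln 2)) \<le> 1" using ln_2_less_1 by simp
    qed auto
    ultimately show ?thesis
      unfolding eq using norm_triangle_ineq4[of "deriv u s" "of_real (ln 2) * u s"] by (simp add: algebra_simps)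
  qed
  then show ?case by blast
qed

lemma eta_deriv_right_nonzero:
  obtains b where "b \<ge> 4" "\<And>s. Re s \<ge> b \<Longrightarrow> norm (eta_deriv k s * 2 powr s / right_coeff k - 1) \<le> 1 / 2"
proof -
  obtain K where K: "\<And>s. Re s \<ge> 2 + real k \<Longrightarrow> norm (eta_deriv k s * 2 powr s - right_coeff k) \<le> K * (2 / 3) powr (Re s)"
    using eta_deriv_right[of k] by blast
  have c: "norm (right_coeff k) > 0" using right_coeff_nonzero by simp
  have "((\<lambda>x. K * (2 / 3) powr x) \<longlongrightarrow> 0) at_top" by real_asymp
  then have "eventually (\<lambda>x. K * (2 / 3) powr x < norm (right_coeff k) / 2) at_top"
    by (rule order_tendstoD) (use c in auto)
  then obtain b0 where b0: "\<And>x. x \<ge> b0 \<Longrightarrow> K * (2 / 3) powr x < norm (right_coeff k) / 2"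
    by (auto simp: eventually_at_top_linorder)
  define b where "b = max (4 + real k) b0"
  have "norm (eta_deriv k s * 2 powr s / right_coeff k - 1) \<le> 1 / 2" if s: "Re s \<ge> b" for s
  proof -
    have "norm (eta_deriv k s * 2 powr s - right_coeff k) \<le> norm (right_coeff k) / 2"
      using K[of s] b0[of "Re s"] s by (simp add: b_def)
    moreover have "eta_deriv k s * 2 powr s / right_coeff k - 1 = (eta_deriv k s * 2 powr s - right_coeff k) / right_coeff k"
      using c by (simp add: diff_divide_distrib)
    ultimately show ?thesis using c by (simp add: norm_divide field_simps)
  qed
  moreover have "b \<ge> 4" by (simp add: b_def)
  ultimately show ?thesis using that by blast
qed

lemma norm_zeta_minus_1:
  assumes "Re s \<ge> 4"
  shows "norm (zeta s - 1) < 1"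
proof -
  have "(\<lambda>n. of_nat (Suc (Suc n)) powr (- s)) sums (zeta s - 1)"
    using zeta_sums[of s] assms by (subst sums_Suc_iff) simp
  then have eq: "zeta s - 1 = (\<Sum>n. of_nat (Suc (Suc n)) powr (- s))" by (rule sums_unique)
  have "norm (zeta s - 1) \<le> (\<Sum>n. 1 / 4 * real (Suc n) powr (- 2))"
    unfolding eq
  proof (rule norm_suminf_le)
    show "summable (\<lambda>n. 1 / 4 * real (Suc n) powr (- 2))"
      by (intro summable_mult sums_summable[OF inverse_squares_sums'])
    fix n
    have "norm (of_nat (Suc (Suc n)) powr (- s) :: complex) = real (Suc (Suc n)) powr (- Re s)"
      by (subst norm_of_nat_powr) auto
    also have "\<dots> \<le> real (Suc (Suc n)) powr (- 2 + - 2)"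
      using assms by (intro powr_mono) auto
    also have "\<dots> = real (Suc (Suc n)) powr (- 2) * real (Suc (Suc n)) powr (- 2)"
      by (rule powr_add)
    also have "\<dots> \<le> 2 powr (- 2) * real (Suc n) powr (- 2)"
      by (intro mult_mono powr_mono2') auto
    also have "2 powr (- 2) = (1 / 4 :: real)" by (subst powr_minus) simp
    finally show "norm (of_nat (Suc (Suc n)) powr (- s) :: complex) \<le> 1 / 4 * real (Suc n) powr (- 2)" .
  qed
  also have "\<dots> = 1 / 4 * (pi\<^sup>2 / 6)"
    using sums_unique[OF sums_mult[OF inverse_squares_sums', of "1 / 4"]] by simp
  also have "\<dots> \<le> 1 / 4 * (4\<^sup>2 / 6)" using pi_less_4 by (intro mult_left_mono divide_right_mono power_mono) auto
  also have "\<dots> < 1" by simp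
  finally show ?thesis .
qed

text \<open>To the left of \<open>- 1 / 2\<close> the functional equation applies: the exponential
  growth of the cosine is cancelled by the decay of \<open>Gamma\<close>, and a power of the height
  remains. Its exponent depends on the width of the strip.\<close>

lemma eta_strip_bound:
  fixes m :: nat
  obtains C N where "C > 0" "\<And>s. \<bar>Re s\<bar> \<le> real m \<Longrightarrow> norm (eta s) \<le> C * (1 + \<bar>Im s\<bar>) ^ N"
proof -
  obtain C1 where C1: "C1 > 0" "\<And>s. Re s \<ge> -1/2 \<Longrightarrow> norm (eta s) \<le> C1 * (1 + norm s) ^ 2"
    by (rule eta_poly_bound) blast
  obtain C2 where C2: "C2 > 0" "\<And>w. 1 \<le> Re w \<Longrightarrow> Re w \<le> real m + 1 \<Longrightarrow>
     norm (Gamma w) * exp (pi * \<bar>Im w\<bar> / 2) \<le> C2 * (1 + \<bar>Im w\<bar>) ^ (m + 1)"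
    by (rule norm_Gamma_upper[of m]) blast
  define Z where "Z = (\<Sum>n. real (Suc n) powr (- 3 / 2))"
  have Z0: "Z \<ge> 0" unfolding Z_def by (intro suminf_nonneg summable_Suc_powr) auto
  define C where "C = C1 * (1 + real m) ^ 2 + 2 * C2 * Z"
  have Cpos: "C > 0" unfolding C_def using C1 C2 Z0 by (intro add_pos_nonneg mult_pos_pos) auto
  have "norm (eta s) \<le> C * (1 + \<bar>Im s\<bar>) ^ (m + 2)" if s: "\<bar>Re s\<bar> \<le> real m" for s
  proof (cases "Re s \<ge> -1/2")
    case True
    have "norm s \<le> real m + \<bar>Im s\<bar>" using cmod_le[of s] s by linarith
    moreover have "real m * \<bar>Im s\<bar> \<ge> 0" by simp
    moreover have "(1 + real m) * (1 + \<bar>Im s\<bar>) = 1 + real m + \<bar>Im s\<bar> + real m * \<bar>Im s\<bar>"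
      by (simp add: algebra_simps)
    ultimately have "1 + norm s \<le> (1 + real m) * (1 + \<bar>Im s\<bar>)" by linarith
    then have "(1 + norm s) ^ 2 \<le> ((1 + real m) * (1 + \<bar>Im s\<bar>)) ^ 2" by (intro power_mono) auto
    then have "norm (eta s) \<le> C1 * ((1 + real m) * (1 + \<bar>Im s\<bar>)) ^ 2"
      using C1(2)[OF True] C1(1) by (meson less_imp_le mult_left_mono order_trans)
    also have "\<dots> = (C1 * (1 + real m) ^ 2) * (1 + \<bar>Im s\<bar>) ^ 2" by (simp add: power_mult_distrib)
    also have "\<dots> \<le> C * (1 + \<bar>Im s\<bar>) ^ (m + 2)"
      using C1 C2 Z0 by (intro mult_mono power_increasing) (auto simp: C_def)
    finally show ?thesis .
  next
    case False
    define w where "w = 1 - s"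
    have w: "Re w > 3 / 2" "Re w \<le> real m + 1" "\<bar>Im w\<bar> = \<bar>Im s\<bar>" using False s by (auto simp: w_def)
    have "eta s = eta_refl w" using eta_reflection[of w] w by (simp add: w_def)
    then have "norm (eta s) = 2 * pi powr (- Re w) * norm (Gamma w) * norm (cos (of_real pi * w / 2)) * norm (odd_zeta w)"
      by (simp add: eta_refl_def norm_mult norm_powr_real_powr)
    also have "\<dots> \<le> 2 * 1 * norm (Gamma w) * exp (pi * \<bar>Im w\<bar> / 2) * Z"
    proof (intro mult_mono)
      have "pi powr (- Re w) \<le> pi powr 0" using w pi_ge_two by (intro powr_mono) auto
      then show "pi powr (- Re w) \<le> 1" by simp
      show "norm (odd_zeta w) \<le> Z" unfolding Z_def by (rule norm_odd_zeta_le) (use w in auto)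
    qed (use norm_cos_half_pi_le in auto)
    also have "\<dots> = 2 * (norm (Gamma w) * exp (pi * \<bar>Im w\<bar> / 2)) * Z" by simp
    also have "\<dots> \<le> 2 * (C2 * (1 + \<bar>Im w\<bar>) ^ (m + 1)) * Z"
      using Z0 w by (intro mult_right_mono mult_left_mono C2) auto
    also have "\<dots> = (2 * C2 * Z) * (1 + \<bar>Im s\<bar>) ^ (m + 1)" using w by simp
    also have "\<dots> \<le> C * (1 + \<bar>Im s\<bar>) ^ (m + 2)"
      using C1 C2 Z0 by (intro mult_mono power_increasing) (auto simp: C_def)
    finally show ?thesis .
  qed
  then show ?thesis using that[of C "m + 2"] Cpos by blast
qed

text \<open>Cauchy's inequality on unit discs needs a strip wider by \<open>1\<close> for each
  derivative, hence the induction with arbitrary \<open>m\<close>.\<close>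

lemma eta_deriv_strip_bound:
  "\<exists>C>0. \<exists>N. \<forall>s. \<bar>Re s\<bar> \<le> real m \<longrightarrow> norm (eta_deriv k s) \<le> C * (1 + \<bar>Im s\<bar>) ^ N"
proof (induction k arbitrary: m)
  case 0
  obtain C N where C: "C > 0" "\<And>s. \<bar>Re s\<bar> \<le> real m \<Longrightarrow> norm (eta s) \<le> C * (1 + \<bar>Im s\<bar>) ^ N"
    using eta_strip_bound[of m] by blast
  have "norm (eta_deriv 0 s) \<le> (C + 1) * (1 + \<bar>Im s\<bar>) ^ N" if "\<bar>Re s\<bar> \<le> real m" for s
  proof -
    have "norm (eta_deriv 0 s) \<le> norm (eta s) + 1" using norm_triangle_ineq4[of "eta s" 1] by (simp add: eta_deriv_def)
    also have "\<dots> \<le> C * (1 + \<bar>Im s\<bar>) ^ N + (1 + \<bar>Im s\<bar>) ^ N"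
      using C(2)[OF that] by (intro add_mono one_le_power) auto
    finally show ?thesis by (simp add: algebra_simps)
  qed
  then show ?case using C(1) by (intro exI[of _ "C + 1"] conjI exI[of _ N]) auto
next
  case (Suc k)
  obtain C N where C: "C > 0" "\<And>s. \<bar>Re s\<bar> \<le> real (Suc m) \<Longrightarrow> norm (eta_deriv k s) \<le> C * (1 + \<bar>Im s\<bar>) ^ N"
    using Suc[of "Suc m"] by blast
  have "norm (eta_deriv (Suc k) s) \<le> (C * 2 ^ N) * (1 + \<bar>Im s\<bar>) ^ N" if s: "\<bar>Re s\<bar> \<le> real m" for s
  proof -
    have "eta_deriv (Suc k) s = deriv (eta_deriv k) s" using DERIV_imp_deriv[OF deriv_eta_deriv] by simp
    also have "norm \<dots> \<le> (C * 2 ^ N) * (1 + \<bar>Im s\<bar>) ^ N"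
    proof (rule norm_deriv_le_unit_disc[of _ UNIV])
      show "eta_deriv k holomorphic_on UNIV" by (rule holomorphic_eta_deriv)
      fix z assume "z \<in> cball s 1"
      then have "norm (s - z) \<le> 1" by (simp add: dist_norm)
      then have "\<bar>Re (s - z)\<bar> \<le> 1" "\<bar>Im (s - z)\<bar> \<le> 1"
        using abs_Re_le_cmod[of "s - z"] abs_Im_le_cmod[of "s - z"] by auto
      then have z: "\<bar>Re z\<bar> \<le> real (Suc m)" "1 + \<bar>Im z\<bar> \<le> 2 * (1 + \<bar>Im s\<bar>)" using s by auto
      have "norm (eta_deriv k z) \<le> C * (1 + \<bar>Im z\<bar>) ^ N" by (rule C) (rule z)
      also have "\<dots> \<le> C * (2 * (1 + \<bar>Im s\<bar>)) ^ N" using C z by (intro mult_left_mono power_mono) auto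
      finally show "norm (eta_deriv k z) \<le> (C * 2 ^ N) * (1 + \<bar>Im s\<bar>) ^ N" by (simp only: power_mult_distrib mult.assoc)
    qed auto
    finally show ?thesis .
  qed
  then show ?case using C(1) by (intro exI[of _ "C * 2 ^ N"] conjI exI[of _ N]) auto
qed

section \<open>Counting the zeros\<close>

text \<open>The disc estimate is applied around the right end point, where \<open>m0\<close> bounds
  \<open>f\<close> from below at every height. The radius affects only constants, and polynomial
  growth makes the logarithm of the maximum linear in \<open>ln (1 + t)\<close>.\<close>

lemma arg_variation_le_top_side:
  fixes f :: "complex \<Rightarrow> complex" and x1 x2 :: real
  assumes x: "x1 < x2" and f: "f holomorphic_on UNIV"
    and growth: "\<And>m::nat. \<exists>C>0. \<exists>N. \<forall>s. \<bar>Re s\<bar> \<le> real m \<longrightarrow> norm (f s) \<le> C * (1 + \<bar>Im s\<bar>) ^ N"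
    and lower: "0 < m0" "\<And>t. m0 \<le> norm (f (Complex x2 t))"
  obtains K1 K2 where "\<And>t. t > 0 \<Longrightarrow> (\<And>z. z \<in> closed_segment (Complex x2 t) (Complex x1 t) \<Longrightarrow> f z \<noteq> 0) \<Longrightarrow>
     arg_variation_le f (Complex x2 t) (Complex x1 t) (K1 + K2 * ln (1 + t))"
proof -
  define r where "r = x2 - x1"
  have r: "r > 0" using x by (simp add: r_def)
  obtain m :: nat where m: "\<bar>x2\<bar> + 8 * r \<le> real m" using real_arch_simple by blast
  obtain C N where C: "C > 0" "\<And>s. \<bar>Re s\<bar> \<le> real m \<Longrightarrow> norm (f s) \<le> C * (1 + \<bar>Im s\<bar>) ^ N"
    using growth[of m] by blast
  have "arg_variation_le f (Complex x2 t) (Complex x1 t) (10 * (ln (2 * C / m0) + real N * ln (1 + 8 * r)) + 10 * real N * ln (1 + t))"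
    if t: "t > 0" and nz: "\<And>z. z \<in> closed_segment (Complex x2 t) (Complex x1 t) \<Longrightarrow> f z \<noteq> 0" for t
  proof -
    let ?z = "Complex x2 t"
    define M where "M = C * ((1 + 8 * r) * (1 + t)) ^ N"
    have "arg_variation_le f ?z (Complex x1 t) (10 * ln (2 * M / m0))"
    proof (rule arg_variation_le_disc[of f ?z r M m0])
      show "f holomorphic_on ball ?z (8 * r)" using f by (rule holomorphic_on_subset) auto
      fix z assume "z \<in> ball ?z (8 * r)"
      then have "norm (?z - z) < 8 * r" by (simp add: dist_norm)
      then have z: "\<bar>x2 - Re z\<bar> \<le> 8 * r" "\<bar>t - Im z\<bar> \<le> 8 * r"
        using abs_Re_le_cmod[of "?z - z"] abs_Im_le_cmod[of "?z - z"] by auto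
      have "norm (f z) \<le> C * (1 + \<bar>Im z\<bar>) ^ N" by (rule C) (use z m in auto)
      also have "\<dots> \<le> M" unfolding M_def
      proof (intro mult_left_mono power_mono)
        have "1 + \<bar>Im z\<bar> \<le> 1 + t + 8 * r" using z t by auto
        also have "\<dots> \<le> (1 + 8 * r) * (1 + t)" using r t by (simp add: algebra_simps)
        finally show "1 + \<bar>Im z\<bar> \<le> (1 + 8 * r) * (1 + t)" .
      qed (use C in auto)
      finally show "norm (f z) \<le> M" .
    next
      show "Complex x1 t \<in> cball ?z r"
        using x by (simp add: dist_norm r_def cmod_def)
    qed (use r lower nz in auto)
    also have "ln (2 * M / m0) = ln (2 * C / m0 * ((1 + 8 * r) * (1 + t)) ^ N)" by (simp add: M_def mult.assoc)
    also have "\<dots> = ln (2 * C / m0) + ln (((1 + 8 * r) * (1 + t)) ^ N)"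
      using C lower r t by (intro ln_mult_pos) auto
    also have "ln (((1 + 8 * r) * (1 + t)) ^ N) = real N * (ln (1 + 8 * r) + ln (1 + t))"
      using r t by (simp add: ln_realpow ln_mult_pos)
    finally show ?thesis by (simp add: algebra_simps)
  qed
  then show ?thesis by (rule that) auto
qed

text \<open>\<open>S\<close> will hold the heights of zeros. Zeros of height exactly
  \<open>T\<close> are counted, so the interval to be kept free excludes \<open>T\<close> but
  includes \<open>t\<close>, the height of the upper side.\<close>

lemma exists_gap_after:
  fixes S :: "real set"
  assumes "finite S"
  obtains t where "T < t" "t < T + 1" "\<And>y. y \<in> S \<Longrightarrow> \<not> (T < y \<and> y \<le> t)"
proof -
  define W where "W = insert (T + 1) {y\<in>S. y > T}"
  have W: "finite W" "W \<noteq> {}" using assms by (auto simp: W_def)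
  have "Min W \<in> W" using W by (rule Min_in)
  then have gt: "Min W > T" by (auto simp: W_def)
  have le: "Min W \<le> T + 1" using W by (intro Min_le) (auto simp: W_def)
  show ?thesis
  proof (rule that[of "(T + Min W) / 2"])
    fix y assume y: "y \<in> S"
    show "\<not> (T < y \<and> y \<le> (T + Min W) / 2)"
    proof
      assume "T < y \<and> y \<le> (T + Min W) / 2"
      moreover from this have "Min W \<le> y" using W y by (intro Min_le) (auto simp: W_def)
      ultimately show False using gt by auto
    qed
  qed (use gt le in auto)
qed

lemma zorder_mult_nonvanishing:
  assumes "f holomorphic_on UNIV" "f z0 \<noteq> 0" "g holomorphic_on UNIV" "\<And>z. g z \<noteq> 0"
  shows "zorder (\<lambda>z. f z * g z) z = zorder f z"
proof -
  have fa: "f analytic_on {z}" and ga: "g analytic_on {z}"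
    using assms analytic_on_open[of UNIV] by (auto intro: analytic_on_subset)
  have "eventually (\<lambda>w. f w \<noteq> 0 \<and> w \<in> UNIV) (at z)"
    by (rule non_zero_neighbour_alt[where ?\<beta> = z0]) (use assms in auto)
  then have "eventually (\<lambda>w. f w * g w \<noteq> 0) (at z)"
    by eventually_elim (use assms in auto)
  then have "zorder (\<lambda>z. f z * g z) z = zorder f z + zorder g z"
    by (rule zorder_times_analytic[OF fa ga])
  also have "zorder g z = 0" by (rule zorder_eq_0I[OF ga]) (rule assms)
  finally show ?thesis by simp
qed

lemma two_powr_Re: "norm (2 powr s :: complex) = 2 powr (Re s)"
  using norm_of_nat_powr[of 2 s] by simp

text \<open>The common factor \<open>refl_L\<close> is eliminated between the functional equation
  and its \<open>k\<close>-fold derivative. What remains of the quotient is \<open>k\<close> copies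
  of \<open>refl_lam\<close>, the relative error of \<open>refl_P\<close>, and a factor from the
  powers of \<open>2\<close>, each varying by at most \<open>pi\<close>.\<close>

lemma left_side_quotient:
  obtains c where "c \<ge> 4" and "\<And>w. Re w > c \<Longrightarrow> eta_deriv k (1 - w) = 0 \<Longrightarrow> Im w = 0"
    and "\<And>(n::nat) t1 t2. 2 * real n > c \<Longrightarrow> 0 < t1 \<Longrightarrow> t1 < t2 \<Longrightarrow>
      \<bar>side_arg (\<lambda>s. eta_deriv k s * 2 powr s) (Complex (1 - 2 * real n) t2) (Complex (1 - 2 * real n) t1)
        - side_arg zeta (Complex (1 - 2 * real n) t2) (Complex (1 - 2 * real n) t1)\<bar> \<le> (real k + 2) * pi"
proof -
  obtain a where a: "a \<ge> 4" "\<And>w. Re w > a \<Longrightarrow> eta_deriv k (1 - w) = 0 \<Longrightarrow> Im w = 0"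
    using eta_deriv_zeros_left_real[of k] by blast
  \<comment> \<open>On the line in question \<open>refl_P\<close> has modulus at least
    \<open>exp (pi * \<bar>Im w\<bar> / 2) / 4\<close>, so with \<open>1 / 8\<close> the relative
    error is at most \<open>1 / 2\<close>.\<close>
  obtain a' R where a': "a' \<ge> 4" and R: "R holomorphic_on {w. Re w > a'}"
    and aR: "\<And>w. Re w > a' \<Longrightarrow> Re (refl_lam w) \<ge> 1"
       "\<And>w. Re w > a' \<Longrightarrow> eta_deriv k (1 - w) = (-1) ^ k * refl_L w * refl_lam w ^ k * (refl_P w + R w)"
       "\<And>w. Re w > a' \<Longrightarrow> norm (R w) \<le> 1 / 8 * exp (pi * \<bar>Im w\<bar> / 2)"
    using eta_deriv_left[of "1 / 8" k] by auto
  define c where "c = max a a'"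
  have c: "c \<ge> a" "c \<ge> a'" "c \<ge> 4" using a by (auto simp: c_def)
  have side: "\<bar>side_arg (\<lambda>s. eta_deriv k s * 2 powr s) (Complex (1 - 2 * real n) t2) (Complex (1 - 2 * real n) t1)
        - side_arg zeta (Complex (1 - 2 * real n) t2) (Complex (1 - 2 * real n) t1)\<bar> \<le> (real k + 2) * pi"
    if n: "2 * real n > c" and t: "0 < t1" "t1 < t2" for n :: nat and t1 t2
  proof -
    define p q where "p = Complex (1 - 2 * real n) t2" and "q = Complex (1 - 2 * real n) t1"
    define S where "S = {s. Im s > 0} \<inter> {s. Re s < 1 - c}"
    have opS: "open S" unfolding S_def by (intro open_Int open_halfspace_Im_gt open_halfspace_Re_lt)
    have seg: "Re z = 1 - 2 * real n \<and> Im z > 0" if "z \<in> closed_segment p q" for z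
      using that t by (auto simp: p_def q_def closed_segment_same_Re closed_segment_eq_real_ivl split: if_splits)
    have segS: "closed_segment p q \<subseteq> S" using seg n by (force simp: S_def)
    have SD: "Re (1 - s) > c" "Im (1 - s) \<noteq> 0" "Im s > 0" "Re s < 0" "s \<noteq> 1" if "s \<in> S" for s
      using that c by (auto simp: S_def)
    define q1 q2 q3 where "q1 = (\<lambda>s. refl_lam (1 - s))" and "q2 = (\<lambda>s. (refl_P (1 - s) + R (1 - s)) / refl_P (1 - s))"
      and "q3 = (\<lambda>s::complex. 1 - 2 powr (s - 1))"
    define Q where "Q = (\<lambda>s. (- 1) ^ Suc k * 2 * q1 s ^ k * (q2 s * q3 s))"
    have Pnz: "refl_P (1 - s) \<noteq> 0" if "s \<in> S" for s
      using SD[OF that] c by (intro refl_P_nonzero) auto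
    have E1: "1 - 2 powr (1 - s) \<noteq> (0::complex)" if "s \<in> S" for s
      using SD[OF that] by (intro two_powr_neq_1) auto
    have eqQ: "eta_deriv k s * 2 powr s = zeta s * Q s" if s: "s \<in> S" for s
    proof -
      define w where "w = 1 - s"
      have w: "Re w > c" using SD[OF s] by (simp add: w_def)
      have "eta s = refl_L w * refl_P w" using eta_reflection[of w] w c by (simp add: eta_refl_eq w_def)
      moreover have "eta s = (1 - 2 powr w) * zeta s" using eta_conv_zeta[of s] SD[OF s] by (simp add: w_def)
      ultimately have LP: "refl_L w * refl_P w = (1 - 2 powr w) * zeta s" by simp
      have F: "eta_deriv k s = (-1) ^ k * refl_L w * refl_lam w ^ k * (refl_P w + R w)"
        using aR(2)[of w] w c by (simp add: w_def)
      have P: "refl_P w \<noteq> 0" using Pnz[OF s] by (simp add: w_def)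
      \<comment> \<open>Here \<open>w = 1 - s\<close>: multiplication by \<open>2 powr s\<close>
        replaces the large power \<open>2 powr w\<close> by the small one
        \<open>2 powr (s - 1)\<close>.\<close>
      have two: "(1 - 2 powr w) * 2 powr s = - 2 * (1 - 2 powr (s - 1) :: complex)"
      proof -
        have "2 powr w * 2 powr s = (2 powr 1 :: complex)" by (simp add: w_def powr_add[symmetric])
        moreover have "2 powr s = 2 powr 1 * (2 powr (s - 1) :: complex)" by (simp only: powr_add[symmetric]) simp
        ultimately show ?thesis by (simp add: algebra_simps)
      qed
      have "eta_deriv k s * 2 powr s = (-1) ^ k * refl_lam w ^ k * ((refl_P w + R w) / refl_P w) * ((refl_L w * refl_P w) * 2 powr s)"
        unfolding F using P by simp
      also have "(refl_L w * refl_P w) * 2 powr s = zeta s * ((1 - 2 powr w) * 2 powr s)"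
        unfolding LP by (simp only: mult_ac)
      also have "\<dots> = zeta s * (- 2 * (1 - 2 powr (s - 1)))" unfolding two ..
      also have "(-1) ^ k * refl_lam w ^ k * ((refl_P w + R w) / refl_P w) * (zeta s * (- 2 * (1 - 2 powr (s - 1)))) = zeta s * Q s"
      proof -
        have "(-1) ^ k * l * X * (z * (- 2 * Y)) = z * ((-1) ^ Suc k * 2 * l * (X * Y))" for l X z Y :: complex
          by (simp add: mult_ac)
        then show ?thesis unfolding Q_def q1_def q2_def q3_def w_def .
      qed
      finally show ?thesis .
    qed
    have sh: "(\<lambda>s. 1 - s) holomorphic_on S" by (intro holomorphic_intros)
    have comp: "(\<lambda>s. g (1 - s)) holomorphic_on S" if "g holomorphic_on {w. Re w > c}" for g :: "complex \<Rightarrow> complex"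
    proof -
      have "(g \<circ> (\<lambda>s. 1 - s)) holomorphic_on S"
        by (rule holomorphic_on_compose_gen[OF sh that]) (use SD in auto)
      then show ?thesis by (simp add: o_def)
    qed
    have h1: "q1 holomorphic_on S" unfolding q1_def by (rule comp, rule holomorphic_refl_lam) (use c in auto)
    have hP: "(\<lambda>s. refl_P (1 - s)) holomorphic_on S" by (rule comp, rule holomorphic_refl_P) (use c in auto)
    have hR: "(\<lambda>s. R (1 - s)) holomorphic_on S" by (rule comp, rule holomorphic_on_subset[OF R]) (use c in auto)
    have h2: "q2 holomorphic_on S" unfolding q2_def by (intro holomorphic_on_divide holomorphic_on_add hP hR Pnz)
    have h3: "q3 holomorphic_on S" unfolding q3_def by (intro holomorphic_intros) auto
    have v1: "arg_variation_le q1 p q pi"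
    proof (rule arg_variation_le_halfplane[OF opS segS h1, of 1])
      fix z assume "z \<in> closed_segment p q"
      then have "Re (1 - z) > c" using segS SD by blast
      then have "Re (refl_lam (1 - z)) \<ge> 1" using c by (intro aR) auto
      then show "Re (1 * q1 z) > 0" by (simp add: q1_def)
    qed auto
    have v2: "arg_variation_le q2 p q pi"
    proof (rule arg_variation_le_halfplane[OF opS segS h2, of 1])
      fix z assume z: "z \<in> closed_segment p q"
      define w where "w = 1 - z"
      have w: "Re w = 2 * real n" "Re w > c" "z \<in> S" using seg[OF z] n segS z by (auto simp: w_def)
      define y where "y = pi * Im w / 2"
      have cw: "of_real pi * w / 2 = Complex (pi * real n) y" by (simp add: complex_eq_iff y_def w)
      \<comment> \<open>Since \<open>Re w\<close> is an even integer, the cosine is real there and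
        its modulus is \<open>cosh y\<close>; off such lines it could come close to a zero.\<close>
      have "norm (cos (of_real pi * w / 2)) = (exp y + exp (- y)) / 2"
      proof -
        have c1: "\<bar>cos (pi * real n)\<bar> = 1" by (simp add: mult.commute)
        have "Re (cos (of_real pi * w / 2)) = cos (pi * real n) * ((exp y + exp (- y)) / 2)"
          unfolding cw by (simp add: Re_cos)
        moreover have "Im (cos (of_real pi * w / 2)) = 0" unfolding cw by (simp add: Im_cos)
        ultimately have "norm (cos (of_real pi * w / 2)) = \<bar>cos (pi * real n) * ((exp y + exp (- y)) / 2)\<bar>"
          by (simp only: cmod_def) simp
        then show ?thesis unfolding abs_mult c1 by (simp add: add_pos_pos less_imp_le abs_of_nonneg)
      qed
      also have "\<dots> \<ge> exp \<bar>y\<bar> / 2" by (cases "y \<ge> 0") auto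
      finally have cl: "norm (cos (of_real pi * w / 2)) \<ge> exp \<bar>y\<bar> / 2" .
      have "norm (refl_P w) \<ge> exp \<bar>y\<bar> / 2 * (1 / 2)"
        unfolding refl_P_def norm_mult using cl odd_zeta_bounds(1)[of w] w c by (intro mult_mono) auto
      moreover have "norm (R w) \<le> 1 / 8 * exp \<bar>y\<bar>" using aR(3)[of w] w c by (simp add: y_def abs_mult)
      ultimately have RP: "norm (R w) \<le> 1 / 2 * norm (refl_P w)" by simp
      have P: "refl_P w \<noteq> 0" using Pnz w by (simp add: w_def)
      then have "norm (R w / refl_P w) \<le> 1 / 2" using RP by (simp add: norm_divide field_simps)
      then have "Re (R w / refl_P w) \<ge> - 1 / 2" using abs_Re_le_cmod[of "R w / refl_P w"] by linarith
      moreover have "q2 z = 1 + R w / refl_P w" using P by (simp add: q2_def w_def add_divide_distrib)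
      ultimately show "Re (1 * q2 z) > 0" by simp
    qed auto
    have v3: "arg_variation_le q3 p q pi"
    proof (rule arg_variation_le_halfplane[OF opS segS h3, of 1])
      fix z assume "z \<in> closed_segment p q"
      then have "Re z < 0" using segS SD by blast
      then have "norm (2 powr (z - 1) :: complex) < 1" unfolding two_powr_Re by (simp add: powr_less_one)
      then show "Re (1 * q3 z) > 0" using complex_Re_le_cmod[of "2 powr (z - 1)"] by (simp add: q3_def)
    qed auto
    have vQ: "arg_variation_le Q p q (0 + real k * pi + (pi + pi))"
      unfolding Q_def
      by (intro arg_variation_le_mult arg_variation_le_power v1 v2 v3 arg_variation_le_const) simp
    have "\<bar>side_arg (\<lambda>s. eta_deriv k s * 2 powr s) p q - side_arg zeta p q\<bar> \<le> 0 + real k * pi + (pi + pi)"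
    proof (rule side_arg_mult_diff_le[OF opS segS])
      show "zeta holomorphic_on S" using SD(5)[of 1] by (intro holomorphic_zeta) auto
      show "zeta z \<noteq> 0" if "z \<in> S" for z using SD[OF that] by (intro zeta_nonzero_outside_strip) auto
      show "Q holomorphic_on S" unfolding Q_def by (intro holomorphic_intros h1 h2 h3)
      show "Q z \<noteq> 0" if "z \<in> S" for z
      proof
        assume "Q z = 0"
        then have "eta_deriv k (1 - (1 - z)) = 0" using eqQ[OF that] by simp
        then have "Im (1 - z) = 0" using SD[OF that] c by (intro a(2)) auto
        then show False using SD[OF that] by simp
      qed
    qed (use eqQ vQ in auto)
    then show ?thesis by (simp add: p_def q_def algebra_simps)
  qed
  show ?thesis by (rule that[of c]) (use c a side in auto)
qed

lemma finite_zeros_strip: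
  assumes "f holomorphic_on UNIV" "f z0 \<noteq> 0"
  shows "finite {s. a \<le> Re s \<and> Re s \<le> b \<and> 0 \<le> Im s \<and> Im s \<le> T \<and> f s = 0}"
proof -
  have "finite {s\<in>cbox (Complex a 0) (Complex b T). f s = 0}"
    by (rule finite_zeros_in_compact[OF assms(1), of _ z0]) (use assms in auto)
  then show ?thesis by (rule finite_subset[rotated]) (auto simp: in_cbox_complex_iff)
qed

lemma norm_eta_minus_1:
  assumes "Re s \<ge> 4"
  shows "norm (eta s - 1) \<le> 1 / 2"
proof -
  have "norm (eta s - 1) \<le> norm (eta s - 1 + 2 powr (- s)) + norm (2 powr (- s) :: complex)"
    using norm_triangle_ineq4[of "eta s - 1 + 2 powr (- s)" "2 powr (- s)"] by simp
  also have "\<dots> \<le> 18 * 3 powr (- Re s) + 2 powr (- Re s)"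
    unfolding two_powr_Re using eta_tail_bound[of s] assms by simp
  also have "\<dots> \<le> 18 * 3 powr (- 4) + 2 powr (- 4)"
    using assms by (intro add_mono mult_left_mono powr_mono) auto
  also have "3 powr (- 4) = (1 / 81 :: real)" by (subst powr_minus) simp
  also have "2 powr (- 4) = (1 / 16 :: real)" by (subst powr_minus) simp
  finally show ?thesis by simp
qed

theorem theorem6p1:
  fixes k :: nat
  shows "(\<forall>T. finite (zeros_in zeta (zeta_region T)) \<and>
              finite (zeros_in (eta_deriv k) (eta_region T))) \<and>
         (\<lambda>T. real (N_eta k T) - real (N_zeta T)) \<in> O[at_top](\<lambda>T. ln T)"
proof -
  obtain c where c: "c \<ge> 4" and creal: "\<And>w. Re w > c \<Longrightarrow> eta_deriv k (1 - w) = 0 \<Longrightarrow> Im w = 0"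
    and cside: "\<And>(n::nat) t1 t2. 2 * real n > c \<Longrightarrow> 0 < t1 \<Longrightarrow> t1 < t2 \<Longrightarrow>
      \<bar>side_arg (\<lambda>s. eta_deriv k s * 2 powr s) (Complex (1 - 2 * real n) t2) (Complex (1 - 2 * real n) t1)
        - side_arg zeta (Complex (1 - 2 * real n) t2) (Complex (1 - 2 * real n) t1)\<bar> \<le> (real k + 2) * pi"
    using left_side_quotient[of k] by blast
  obtain b where b: "b \<ge> 4" "\<And>s. Re s \<ge> b \<Longrightarrow> norm (eta_deriv k s * 2 powr s / right_coeff k - 1) \<le> 1 / 2"
    using eta_deriv_right_nonzero[of k] by blast
  obtain n :: nat where n: "c < real n" using reals_Archimedean2 by blast
  define x1 x2 where "x1 = 1 - 2 * real n" and "x2 = b"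
  have x: "x1 < 0" "4 \<le> x2" "x1 < x2" "2 * real n > c" using n c b by (auto simp: x1_def x2_def)
  define F where "F = eta_deriv k"
  define Ft where "Ft = (\<lambda>s. F s * 2 powr s)"
  define E where "E = (\<lambda>s::complex. 1 - 2 powr (1 - s))"
  have hF: "F holomorphic_on A" for A unfolding F_def by (rule holomorphic_eta_deriv)
  have hFt: "Ft holomorphic_on A" for A unfolding Ft_def by (intro holomorphic_intros hF) auto
  have hE: "E holomorphic_on A" for A unfolding E_def by (intro holomorphic_intros) auto
  have Ft0: "Ft s = 0 \<longleftrightarrow> F s = 0" for s by (simp add: Ft_def)
  have Fright: "F s \<noteq> 0" if "Re s \<ge> x2" for s
  proof
    assume "F s = 0"
    then show False using b(2)[of s] that by (simp add: F_def x2_def)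
  qed
  have Fzero: "x1 < Re s" "Re s < x2" if "F s = 0" "Im s > 0" for s
  proof -
    show "Re s < x2" using Fright[of s] that by linarith
    show "x1 < Re s"
    proof (rule ccontr)
      assume "\<not> x1 < Re s"
      then have "Re (1 - s) > c" using x by (simp add: x1_def)
      then show False using creal[of "1 - s"] that by (simp add: F_def)
    qed
  qed
  have zzero: "0 < Re s" "Re s < 1" if "zeta s = 0" "Im s > 0" for s
  proof -
    show "0 < Re s" using zeta_nonzero_outside_strip[of s] that by force
    show "Re s < 1" using zeta_nonzero_Re_ge_1[of s] that by force
  qed
  have eta_E: "eta s = E s * zeta s" if "Im s > 0" for s
    using eta_conv_zeta[of s] that unfolding E_def by force
  have E1: "norm (E (Complex x2 t) - 1) \<le> 1 / 2" for t
  proof -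
    have "norm (E (Complex x2 t) - 1) = 2 powr (1 - x2)" unfolding E_def by (simp add: two_powr_Re)
    also have "\<dots> \<le> 2 powr (- 1)" using x by (intro powr_mono) auto
    also have "\<dots> = 1 / 2" by (subst powr_minus) simp
    finally show ?thesis .
  qed
  have half: "1 / 2 \<le> norm z" if "norm (z - 1) \<le> 1 / 2" for z :: complex
    using norm_triangle_ineq2[of 1 z] that by (simp add: norm_minus_commute)
  have fin_F: "finite {s. 0 < Im s \<and> Im s \<le> T \<and> F s = 0}" for T
  proof (rule finite_subset)
    show "{s. 0 < Im s \<and> Im s \<le> T \<and> F s = 0} \<subseteq> {s. x1 \<le> Re s \<and> Re s \<le> x2 \<and> 0 \<le> Im s \<and> Im s \<le> T \<and> F s = 0}"
      using Fzero by (auto intro: less_imp_le)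
    show "finite {s. x1 \<le> Re s \<and> Re s \<le> x2 \<and> 0 \<le> Im s \<and> Im s \<le> T \<and> F s = 0}"
      by (rule finite_zeros_strip[OF hF, of "of_real x2"]) (rule Fright, simp)
  qed
  \<comment> \<open>This goes through the entire function \<open>eta\<close>, because the compact
    rectangle reaches the real axis and would contain the pole of \<open>zeta\<close>.\<close>
  have fin_z: "finite {s. 0 < Im s \<and> Im s \<le> T \<and> zeta s = 0}" for T
  proof (rule finite_subset)
    show "{s. 0 < Im s \<and> Im s \<le> T \<and> zeta s = 0} \<subseteq> {s. 0 \<le> Re s \<and> Re s \<le> 1 \<and> 0 \<le> Im s \<and> Im s \<le> T \<and> eta s = 0}"
      using zzero eta_E by (auto intro: less_imp_le)
    show "finite {s. 0 \<le> Re s \<and> Re s \<le> 1 \<and> 0 \<le> Im s \<and> Im s \<le> T \<and> eta s = 0}"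
    proof (rule finite_zeros_strip[OF holomorphic_eta])
      show "eta 4 \<noteq> 0" using norm_eta_minus_1[of 4] by auto
    qed
  qed
  have fin_E: "finite {s. 0 < Im s \<and> Im s \<le> T \<and> E s = 0}" for T
  proof (rule finite_subset)
    have "Re s = 1" if "E s = 0" for s
    proof -
      have "2 powr (1 - s) = (1 :: complex)" using that by (simp add: E_def)
      then have "2 powr (1 - Re s) = 1" using two_powr_Re[of "1 - s"] by simp
      then show ?thesis by simp
    qed
    then show "{s. 0 < Im s \<and> Im s \<le> T \<and> E s = 0} \<subseteq> {s. 1 \<le> Re s \<and> Re s \<le> 1 \<and> 0 \<le> Im s \<and> Im s \<le> T \<and> E s = 0}"
      by (auto intro: less_imp_le)
    show "finite {s. 1 \<le> Re s \<and> Re s \<le> 1 \<and> 0 \<le> Im s \<and> Im s \<le> T \<and> E s = 0}"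
      by (rule finite_zeros_strip[OF hE, of "Complex x2 0"]) (use E1[of 0] in auto)
  qed
  \<comment> \<open>The zeros of \<open>E\<close> are avoided too, since on the upper side
    \<open>zeta\<close> is treated as the quotient of \<open>eta\<close> and
    \<open>E\<close>.\<close>
  define U where "U = (\<lambda>T. Im ` ({s. 0 < Im s \<and> Im s \<le> T \<and> F s = 0} \<union> {s. 0 < Im s \<and> Im s \<le> T \<and> zeta s = 0} \<union> {s. 0 < Im s \<and> Im s \<le> T \<and> E s = 0}))"
  have finU: "finite (U T)" for T unfolding U_def by (intro finite_imageI finite_UnI fin_F fin_z fin_E)
  have gap: "\<exists>t. T < t \<and> t < T + 1 \<and> (\<forall>s. T < Im s \<and> Im s \<le> t \<longrightarrow> F s \<noteq> 0 \<and> zeta s \<noteq> 0 \<and> E s \<noteq> 0)" if T: "T \<ge> 0" for T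
  proof -
    obtain t where t: "T < t" "t < T + 1" "\<And>y. y \<in> U (T + 1) \<Longrightarrow> \<not> (T < y \<and> y \<le> t)"
      using exists_gap_after[OF finU[of "T + 1"], of T] by blast
    have "F s \<noteq> 0 \<and> zeta s \<noteq> 0 \<and> E s \<noteq> 0" if "T < Im s" "Im s \<le> t" for s
    proof -
      have "Im s \<notin> U (T + 1)" using t(3)[of "Im s"] that by auto
      then show ?thesis using that t T unfolding U_def by auto
    qed
    then show ?thesis using t by blast
  qed
  \<comment> \<open>The lower side is fixed once and for all below every zero in question, so it
    contributes the constant \<open>D\<close> below, independent of \<open>T\<close>.\<close>
  obtain t0 where t0: "0 < t0" "t0 < 1" "\<And>s. 0 < Im s \<Longrightarrow> Im s \<le> t0 \<Longrightarrow> F s \<noteq> 0 \<and> zeta s \<noteq> 0 \<and> E s \<noteq> 0"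
    using gap[of 0] by auto
  have growth_eta: "\<exists>C>0. \<exists>N. \<forall>s. \<bar>Re s\<bar> \<le> real m \<longrightarrow> norm (eta s) \<le> C * (1 + \<bar>Im s\<bar>) ^ N" for m
    using eta_strip_bound[of m] by metis
  have growth_E: "\<exists>C>0. \<exists>N. \<forall>s. \<bar>Re s\<bar> \<le> real m \<longrightarrow> norm (E s) \<le> C * (1 + \<bar>Im s\<bar>) ^ N" for m
  proof (rule exI[of _ "1 + 2 powr (1 + real m)"], intro conjI exI[of _ 0] allI impI)
    fix s assume s: "\<bar>Re s\<bar> \<le> real m"
    have "norm (E s) \<le> 1 + norm (2 powr (1 - s) :: complex)"
      using norm_triangle_ineq4[of 1 "2 powr (1 - s)"] by (simp add: E_def)
    also have "\<dots> \<le> 1 + 2 powr (1 + real m)" unfolding two_powr_Re using s by (intro add_left_mono powr_mono) auto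
    finally show "norm (E s) \<le> (1 + 2 powr (1 + real m)) * (1 + \<bar>Im s\<bar>) ^ 0" by simp
  qed (simp add: add_pos_pos)
  \<comment> \<open>The lower bound for \<open>F\<close> on \<open>Re s = x2\<close>: the normalized
    function is within \<open>1 / 2\<close> of \<open>1\<close>, and \<open>2 powr s\<close> has
    constant modulus there.\<close>
  define m0 where "m0 = norm (right_coeff k) / (2 * 2 powr x2)"
  have rc: "norm (right_coeff k) > 0" using right_coeff_nonzero by simp
  have m0: "m0 > 0" "m0 \<le> norm (F (Complex x2 t))" for t
  proof -
    show "m0 > 0" using rc by (simp add: m0_def)
    have "1 / 2 \<le> norm (F (Complex x2 t) * 2 powr (Complex x2 t) / right_coeff k)"
      unfolding F_def by (intro half b) (simp add: x2_def)
    then show "m0 \<le> norm (F (Complex x2 t))" using rc by (simp add: m0_def norm_mult norm_divide two_powr_Re field_simps)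
  qed
  obtain A1 A2 where A: "\<And>t. t > 0 \<Longrightarrow> (\<And>z. z \<in> closed_segment (Complex x2 t) (Complex x1 t) \<Longrightarrow> F z \<noteq> 0) \<Longrightarrow>
     arg_variation_le F (Complex x2 t) (Complex x1 t) (A1 + A2 * ln (1 + t))"
    using arg_variation_le_top_side[OF x(3) hF _ m0(1) m0(2)] eta_deriv_strip_bound[of _ k] unfolding F_def by blast
  obtain B1 B2 where B: "\<And>t. t > 0 \<Longrightarrow> (\<And>z. z \<in> closed_segment (Complex x2 t) (Complex x1 t) \<Longrightarrow> eta z \<noteq> 0) \<Longrightarrow>
     arg_variation_le eta (Complex x2 t) (Complex x1 t) (B1 + B2 * ln (1 + t))"
  proof (rule arg_variation_le_top_side[OF x(3) holomorphic_eta growth_eta, of "1 / 2"])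
    show "1 / 2 \<le> norm (eta (Complex x2 t))" for t using x by (intro half norm_eta_minus_1) auto
  qed auto
  obtain C1 C2 where C: "\<And>t. t > 0 \<Longrightarrow> (\<And>z. z \<in> closed_segment (Complex x2 t) (Complex x1 t) \<Longrightarrow> E z \<noteq> 0) \<Longrightarrow>
     arg_variation_le E (Complex x2 t) (Complex x1 t) (C1 + C2 * ln (1 + t))"
  proof (rule arg_variation_le_top_side[OF x(3) hE growth_E, of "1 / 2"])
    show "1 / 2 \<le> norm (E (Complex x2 t))" for t by (intro half E1)
  qed auto
  define D where "D = \<bar>side_arg Ft (Complex x1 t0) (Complex x2 t0) - side_arg zeta (Complex x1 t0) (Complex x2 t0)\<bar>"
  define K1 where "K1 = D + 2 * pi + (real k + 2) * pi + \<bar>A1\<bar> + \<bar>B1\<bar> + \<bar>C1\<bar>"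
  define K2 where "K2 = \<bar>A2\<bar> + \<bar>B2\<bar> + \<bar>C2\<bar>"
  have main: "\<bar>real (N_eta k T) - real (N_zeta T)\<bar> \<le> K1 + K2 * ln (T + 2)" if T: "T \<ge> 1" for T
  proof -
    \<comment> \<open>The upper side is so close above height \<open>T\<close> that the rectangle gains no zeros.\<close>
    obtain t where t: "T < t" "t < T + 1" "\<And>s. T < Im s \<Longrightarrow> Im s \<le> t \<Longrightarrow> F s \<noteq> 0 \<and> zeta s \<noteq> 0 \<and> E s \<noteq> 0"
      using gap[of T] T by auto
    have tt: "t0 < t" "t > 0" using t0 t T by auto
    define Bx where "Bx = box (Complex x1 t0) (Complex x2 t)"
    have inBx: "s \<in> Bx \<longleftrightarrow> x1 < Re s \<and> Re s < x2 \<and> t0 < Im s \<and> Im s < t" for s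
      by (auto simp: Bx_def in_box_complex_iff)
    have zF: "zeros_in Ft Bx = zeros_in F (eta_region T)"
    proof (intro equalityI subsetI)
      fix s assume s: "s \<in> zeros_in Ft Bx"
      then have "F s = 0" "t0 < Im s" "Im s < t" by (auto simp: zeros_in_def Ft0 inBx)
      moreover have "Im s \<le> T" using t(3)[of s] calculation by force
      ultimately show "s \<in> zeros_in F (eta_region T)" using t0 by (simp add: zeros_in_def eta_region_def)
    next
      fix s assume "s \<in> zeros_in F (eta_region T)"
      then have s: "F s = 0" "0 < Im s" "Im s \<le> T" by (auto simp: zeros_in_def eta_region_def)
      moreover have "t0 < Im s" using t0(3)[of s] s by force
      ultimately show "s \<in> zeros_in Ft Bx" using Fzero[of s] t by (simp add: zeros_in_def Ft0 inBx)
    qed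
    have zz: "zeros_in zeta Bx = zeros_in zeta (zeta_region T)"
    proof (intro equalityI subsetI)
      fix s assume s: "s \<in> zeros_in zeta Bx"
      then have "zeta s = 0" "t0 < Im s" "Im s < t" by (auto simp: zeros_in_def inBx)
      moreover have "Im s \<le> T" using t(3)[of s] calculation by force
      ultimately show "s \<in> zeros_in zeta (zeta_region T)" using t0 zzero[of s] by (simp add: zeros_in_def zeta_region_def)
    next
      fix s assume "s \<in> zeros_in zeta (zeta_region T)"
      then have s: "zeta s = 0" "0 < Im s" "Im s \<le> T" "0 < Re s" "Re s < 1" by (auto simp: zeros_in_def zeta_region_def)
      moreover have "t0 < Im s" using t0(3)[of s] s by force
      ultimately show "s \<in> zeros_in zeta Bx" using x t by (simp add: zeros_in_def inBx)
    qed
    have n1: "zero_count Ft Bx = N_eta k T"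
    proof -
      have "zorder Ft s = zorder F s" for s
        unfolding Ft_def by (rule zorder_mult_nonvanishing[OF hF, of "of_real x2"]) (auto intro!: holomorphic_intros Fright)
      then show ?thesis unfolding zero_count_def N_eta_def zF by (simp add: F_def)
    qed
    have n2: "zero_count zeta Bx = N_zeta T"
      unfolding zero_count_def N_zeta_def zz ..
    have bnd: "F s \<noteq> 0 \<and> zeta s \<noteq> 0" if "s \<in> cbox (Complex x1 t0) (Complex x2 t) - box (Complex x1 t0) (Complex x2 t)" for s
    proof -
      have s: "x1 \<le> Re s" "Re s \<le> x2" "t0 \<le> Im s" "Im s \<le> t" "s \<notin> Bx" using that by (auto simp: Bx_def in_cbox_complex_iff)
      have ex: "Im s = t0 \<or> Im s = t" if "x1 < Re s" "Re s < x2" using s that by (auto simp: inBx)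
      have ed: "F s \<noteq> 0 \<and> zeta s \<noteq> 0" if "Im s = t0 \<or> Im s = t" using t0(3)[of s] t(3)[of s] t0 t that by auto
      have Is: "Im s > 0" using s t0 by linarith
      show ?thesis
      proof (cases "x1 < Re s \<and> Re s < x2")
        case False
        then show ?thesis using Fzero[OF _ Is] zzero[OF _ Is] x by force
      qed (use ex ed in blast)
    qed
    have r1: "2 * pi * real (zero_count Ft Bx) =
       side_arg Ft (Complex x1 t0) (Complex x2 t0) + side_arg Ft (Complex x2 t0) (Complex x2 t)
     + side_arg Ft (Complex x2 t) (Complex x1 t) + side_arg Ft (Complex x1 t) (Complex x1 t0)"
      unfolding Bx_def
    proof (rule zero_count_rectangle[OF hFt, of "Complex x2 1"])
      show "Ft (Complex x2 1) \<noteq> 0" unfolding Ft0 by (rule Fright) simp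
    qed (use x t0 tt bnd Ft0 in auto)
    have r2: "2 * pi * real (zero_count zeta Bx) =
       side_arg zeta (Complex x1 t0) (Complex x2 t0) + side_arg zeta (Complex x2 t0) (Complex x2 t)
     + side_arg zeta (Complex x2 t) (Complex x1 t) + side_arg zeta (Complex x1 t) (Complex x1 t0)"
      unfolding Bx_def
    proof (rule zero_count_rectangle[of _ "Complex x2 1"])
      show "zeta (Complex x2 1) \<noteq> 0" using x by (intro zeta_nonzero_Re_ge_1) (auto simp: complex_eq_iff)
      show "zeta holomorphic_on {s. Im s > 0}" by (rule holomorphic_zeta) simp
    qed (use x t0 tt bnd in auto)
    have a1: "\<bar>side_arg Ft (Complex x2 t0) (Complex x2 t)\<bar> \<le> pi"
    proof (rule side_arg_le, rule arg_variation_le_halfplane[of UNIV _ _ _ "1 / right_coeff k"])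
      fix z assume "z \<in> closed_segment (Complex x2 t0) (Complex x2 t)"
      then have "Re z = x2" using closed_segment_same_Re[of "Complex x2 t0" "Complex x2 t"] by auto
      then have "norm (1 / right_coeff k * Ft z - 1) \<le> 1 / 2" using b(2)[of z] by (simp add: Ft_def F_def x2_def)
      then show "Re (1 / right_coeff k * Ft z) > 0" using abs_Re_le_cmod[of "1 / right_coeff k * Ft z - 1"] by auto
    qed (use hFt right_coeff_nonzero in auto)
    have a2: "\<bar>side_arg zeta (Complex x2 t0) (Complex x2 t)\<bar> \<le> pi"
    proof (rule side_arg_le, rule arg_variation_le_halfplane[of "- {1}" _ _ _ 1])
      have seg: "Re z = x2" if "z \<in> closed_segment (Complex x2 t0) (Complex x2 t)" for z
        using closed_segment_same_Re[of "Complex x2 t0" "Complex x2 t"] that by auto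
      show "closed_segment (Complex x2 t0) (Complex x2 t) \<subseteq> - {1}" using seg[of 1] x by auto
      fix z assume "z \<in> closed_segment (Complex x2 t0) (Complex x2 t)"
      then have "norm (zeta z - 1) < 1" using seg x by (intro norm_zeta_minus_1) auto
      then show "Re (1 * zeta z) > 0" using abs_Re_le_cmod[of "zeta z - 1"] by auto
    qed (auto intro: holomorphic_zeta)
    have segt: "Im z = t \<and> F z \<noteq> 0 \<and> zeta z \<noteq> 0 \<and> E z \<noteq> 0 \<and> eta z \<noteq> 0" if "z \<in> closed_segment (Complex x2 t) (Complex x1 t)" for z
    proof -
      have "Im z = t" using closed_segment_same_Im[of "Complex x2 t" "Complex x1 t"] that by auto
      then show ?thesis using t(3)[of z] t tt eta_E[of z] by auto
    qed
    have a3: "\<bar>side_arg Ft (Complex x2 t) (Complex x1 t)\<bar> \<le> A1 + A2 * ln (1 + t)"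
    proof (rule side_arg_le)
      \<comment> \<open>The logarithm \<open>s * ln 2\<close> has constant imaginary part along a
        horizontal segment, so the normalizing factor adds nothing.\<close>
      have "arg_variation_le (\<lambda>s. 2 powr s) (Complex x2 t) (Complex x1 t) 0"
        by (rule arg_variation_leI[of UNIV _ _ "\<lambda>s. s * of_real (ln 2)" 1])
           (auto intro!: holomorphic_intros simp: powr_def Ln_of_real[of 2, simplified])
      from arg_variation_le_mult[OF A[OF tt(2)] this]
      show "arg_variation_le Ft (Complex x2 t) (Complex x1 t) (A1 + A2 * ln (1 + t))" using segt by (simp add: Ft_def)
    qed
    \<comment> \<open>The disc estimate requires entire functions, so it is applied to
      \<open>eta\<close> and \<open>E\<close>; the variation of their quotient is at most the sum of
      both.\<close>
    have a4: "\<bar>side_arg zeta (Complex x2 t) (Complex x1 t)\<bar> \<le> (B1 + B2 * ln (1 + t)) + (C1 + C2 * ln (1 + t))"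
    proof (rule side_arg_le, rule arg_variation_le_cong)
      show "arg_variation_le (\<lambda>z. eta z * inverse (E z)) (Complex x2 t) (Complex x1 t) ((B1 + B2 * ln (1 + t)) + (C1 + C2 * ln (1 + t)))"
        by (intro arg_variation_le_mult arg_variation_le_inverse B C tt) (use segt in auto)
      let ?V = "{s. Im s > 0} \<inter> E -` (- {0})"
      show "open ?V"
        by (intro continuous_open_preimage holomorphic_on_imp_continuous_on hE open_halfspace_Im_gt) auto
      show "closed_segment (Complex x2 t) (Complex x1 t) \<subseteq> ?V" using segt tt by auto
      show "zeta z = eta z * inverse (E z)" if "z \<in> ?V" for z using eta_E[of z] that by auto
    qed
    have a5: "\<bar>side_arg Ft (Complex x1 t) (Complex x1 t0) - side_arg zeta (Complex x1 t) (Complex x1 t0)\<bar> \<le> (real k + 2) * pi"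
      using cside[OF x(4) t0(1) tt(1)] unfolding Ft_def F_def x1_def .
    have "\<bar>2 * pi * real (N_eta k T) - 2 * pi * real (N_zeta T)\<bar> \<le> D + 2 * pi + (real k + 2) * pi
       + (A1 + A2 * ln (1 + t)) + (B1 + B2 * ln (1 + t)) + (C1 + C2 * ln (1 + t))"
      using r1 r2 a1 a2 a3 a4 a5 unfolding D_def n1 n2 by linarith
    also have "\<dots> \<le> K1 + K2 * ln (T + 2)"
    proof -
      have l: "0 \<le> ln (1 + t)" "ln (1 + t) \<le> ln (T + 2)" using t tt by auto
      have m: "a * ln (1 + t) \<le> \<bar>a\<bar> * ln (T + 2)" for a :: real
        using l by (intro mult_mono) auto
      show ?thesis using m[of A2] m[of B2] m[of C2] unfolding K1_def K2_def by (simp add: algebra_simps) linarith?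
    qed
    finally have fin: "\<bar>2 * pi * real (N_eta k T) - 2 * pi * real (N_zeta T)\<bar> \<le> K1 + K2 * ln (T + 2)" .
    have "1 * \<bar>real (N_eta k T) - real (N_zeta T)\<bar> \<le> (2 * pi) * \<bar>real (N_eta k T) - real (N_zeta T)\<bar>"
      using pi_ge_two by (intro mult_right_mono) auto
    also have "\<dots> = \<bar>2 * pi * real (N_eta k T) - 2 * pi * real (N_zeta T)\<bar>"
      by (simp add: abs_mult right_diff_distrib[symmetric])
    finally show ?thesis using fin by simp
  qed
  have "(\<lambda>T. real (N_eta k T) - real (N_zeta T)) \<in> O[at_top](\<lambda>T. K1 + K2 * ln (T + 2))"
    by (rule bigoI[of _ 1]) (use main in \<open>auto intro!: eventually_mono[OF eventually_ge_at_top[of 1]] order_trans[OF _ abs_ge_self]\<close>)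
  also have "(\<lambda>T. K1 + K2 * ln (T + 2)) \<in> O[at_top](\<lambda>T. ln T)"
  proof (rule sum_in_bigo)
    show "(\<lambda>T. K1) \<in> O[at_top](\<lambda>T::real. ln T)" by real_asymp
    have "(\<lambda>T. ln (T + 2)) \<in> O[at_top](\<lambda>T::real. ln T)" by real_asymp
    then show "(\<lambda>T. K2 * ln (T + 2)) \<in> O[at_top](\<lambda>T::real. ln T)" by simp
  qed
  finally have "(\<lambda>T. real (N_eta k T) - real (N_zeta T)) \<in> O[at_top](\<lambda>T. ln T)" .
  moreover have "finite (zeros_in zeta (zeta_region T)) \<and> finite (zeros_in (eta_deriv k) (eta_region T))" for T
  proof
    show "finite (zeros_in zeta (zeta_region T))"
      by (rule finite_subset[OF _ fin_z[of T]]) (auto simp: zeros_in_def zeta_region_def)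
    show "finite (zeros_in (eta_deriv k) (eta_region T))"
      by (rule finite_subset[OF _ fin_F[of T]]) (auto simp: zeros_in_def eta_region_def F_def)
  qed
  ultimately show ?thesis by blast
qed

end
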